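(* Let $\psi:V\to X$ be a $G$-Galois cover, let $K$ be a subgroup of $G$, and let $Y$ be the normalisation of $V/K$, with quotient map $h:V\to Y$. Then $\mathrm{Pic}^0(V)[l]^{K}=\mathrm{Pic}^0(Y)[l]$, where $\mathrm{Pic}^0(Y)[l]$ is identified with its image $h^*(\mathrm{Pic}^0(Y)[l])\subset\mathrm{Pic}^0(V)[l]$.
   Context: $k$ is an algebraically closed field of characteristic $p>0$, $l\ne p$ is a prime, and $G$ is a finite cyclic group of order $p^a$, $a\ge1$. $\psi:V\to X$ is a $G$-Galois cover of smooth connected projective $k$-curves, étale away from a nonempty finite set of closed points of $X$. $\mathrm{Pic}^0(V)[l]$ is the $l$-torsion subgroup of the degree zero Picard group; $G=\mathrm{Aut}(V|X)$ acts on it (on the right) by pullback, and the superscript $K$ denotes the $K$-invariants. *)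

theory Defs
  imports
    "HOL-Library.Poly_Mapping"
    "HOL-Library.Extended_Nat"
    "HOL-Computational_Algebra.Polynomial"
    "HOL-Algebra.Algebra"
    "HOL-Analysis.Abstract_Topology"
begin

text \<open>
  Varieties are taken in the classical sense over an algebraically closed field: a variety is an
  irreducible locally closed set of closed points of some projective space, with its Zariski
  topology and its sheaf of regular functions.
\<close>

section \<open>Projective space and the Zariski topology\<close>

text \<open>
  All varieties live in one type: the projective space on the finitely supported sequences over
  \<open>'k\<close>, the union of all the finite-dimensional projective spaces \<open>proj_space n\<close>.
\<close>

quotient_type (overloaded) 'k proj = "nat \<Rightarrow> 'k::field" / partial:
  "\<lambda>v w. finite {i. v i \<noteq> 0} \<and> (\<exists>i. v i \<noteq> 0) \<and> (\<exists>c. c \<noteq> 0 \<and> w = (\<lambda>i. c * v i))"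
proof (rule part_equivpI)
  let ?R = "\<lambda>v w :: nat \<Rightarrow> 'k. finite {i. v i \<noteq> 0} \<and> (\<exists>i. v i \<noteq> 0) \<and>
              (\<exists>c. c \<noteq> 0 \<and> w = (\<lambda>i. c * v i))"
  show "\<exists>v. ?R v v"
    by (rule exI[where x = "\<lambda>i. if i = 0 then 1 else 0"])
      (auto intro: exI[where x = "1 :: 'k"] exI[where x = "0 :: nat"])
  show "symp ?R"
  proof (rule sympI)
    fix v w :: "nat \<Rightarrow> 'k"
    assume *: "?R v w"
    then obtain c where c: "c \<noteq> 0" "w = (\<lambda>i. c * v i)" by blast
    have "v = (\<lambda>i. inverse c * w i)" using c by (auto simp: fun_eq_iff mult.assoc[symmetric])
    moreover have "{i. w i \<noteq> 0} = {i. v i \<noteq> 0}" using c by auto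
    ultimately show "?R w v"
      using * c by (metis (no_types, lifting) inverse_nonzero_iff_nonzero mult_eq_0_iff)
  qed
  show "transp ?R"
  proof (rule transpI)
    fix u v w :: "nat \<Rightarrow> 'k"
    assume *: "?R u v" and **: "?R v w"
    obtain c d where "c \<noteq> 0" "v = (\<lambda>i. c * u i)" "d \<noteq> 0" "w = (\<lambda>i. d * v i)"
      using * ** by blast
    then have "d * c \<noteq> 0" "w = (\<lambda>i. (d * c) * u i)" by (auto simp: mult.assoc)
    then show "?R u w" using * by blast
  qed
qed

text \<open>Some choice of homogeneous coordinates of a point.\<close>

definition coords :: "'k::field proj \<Rightarrow> nat \<Rightarrow> 'k" where
  "coords P = rep_proj P"

definition proj_space :: "nat \<Rightarrow> 'k::field proj set" where
  "proj_space n = {P. \<forall>i>n. coords P i = 0}"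

text \<open>Polynomials in variables indexed by \<open>nat\<close>: exponent vectors mapped to coefficients.\<close>

type_synonym 'k mpol = "(nat \<Rightarrow>\<^sub>0 nat) \<Rightarrow>\<^sub>0 'k"

definition mon_eval :: "(nat \<Rightarrow> 'k::field) \<Rightarrow> (nat \<Rightarrow>\<^sub>0 nat) \<Rightarrow> 'k" where
  "mon_eval v m = (\<Prod>i\<in>Poly_Mapping.keys m. v i ^ Poly_Mapping.lookup m i)"

definition meval :: "(nat \<Rightarrow> 'k::field) \<Rightarrow> 'k mpol \<Rightarrow> 'k" where
  "meval v F = (\<Sum>m\<in>Poly_Mapping.keys F. Poly_Mapping.lookup F m * mon_eval v m)"

definition mon_deg :: "(nat \<Rightarrow>\<^sub>0 nat) \<Rightarrow> nat" where
  "mon_deg m = (\<Sum>i\<in>Poly_Mapping.keys m. Poly_Mapping.lookup m i)"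

definition homogeneous :: "nat \<Rightarrow> 'k::field mpol \<Rightarrow> bool" where
  "homogeneous d F \<longleftrightarrow> (\<forall>m\<in>Poly_Mapping.keys F. mon_deg m = d)"

lemma mon_eval_add: "mon_eval v (m + m') = mon_eval v m * mon_eval v m'"
proof -
  let ?A = "Poly_Mapping.keys m \<union> Poly_Mapping.keys m'"
  have *: "mon_eval v x = (\<Prod>i\<in>?A. v i ^ Poly_Mapping.lookup x i)"
    if "Poly_Mapping.keys x \<subseteq> ?A" for x
    unfolding mon_eval_def
    by (rule prod.mono_neutral_left) (use that in \<open>auto simp: in_keys_iff\<close>)
  show ?thesis
    using *[of m] *[of m'] *[of "m + m'"] Poly_Mapping.keys_add[of m m']
    by (simp add: lookup_add power_add prod.distrib)
qed

lemma mon_deg_add: "mon_deg (m + m') = mon_deg m + mon_deg m'"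
proof -
  let ?A = "Poly_Mapping.keys m \<union> Poly_Mapping.keys m'"
  have *: "mon_deg x = (\<Sum>i\<in>?A. Poly_Mapping.lookup x i)"
    if "Poly_Mapping.keys x \<subseteq> ?A" for x
    unfolding mon_deg_def
    by (rule sum.mono_neutral_left) (use that in \<open>auto simp: in_keys_iff\<close>)
  show ?thesis
    using *[of m] *[of m'] *[of "m + m'"] Poly_Mapping.keys_add[of m m']
    by (simp add: lookup_add sum.distrib)
qed

lemma meval_superset:
  assumes "finite A" "Poly_Mapping.keys F \<subseteq> A"
  shows "meval v F = (\<Sum>m\<in>A. Poly_Mapping.lookup F m * mon_eval v m)"
  unfolding meval_def
  by (rule sum.mono_neutral_left) (use assms in \<open>auto simp: in_keys_iff\<close>)

lemma meval_add: "meval v (F + G) = meval v F + meval v G"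
proof -
  let ?A = "Poly_Mapping.keys F \<union> Poly_Mapping.keys G"
  show ?thesis
    using meval_superset[of ?A F v] meval_superset[of ?A G v] meval_superset[of ?A "F + G" v]
      Poly_Mapping.keys_add[of F G]
    by (simp add: lookup_add distrib_right sum.distrib)
qed

lemma meval_single: "meval v (Poly_Mapping.single m c) = c * mon_eval v m"
  by (simp add: meval_def)

lemma meval_sum: "meval v (sum f A) = (\<Sum>a\<in>A. meval v (f a))"
  by (induction A rule: infinite_finite_induct) (auto simp: meval_add meval_def[of v 0])

lemma sum_singles:
  "F = (\<Sum>m\<in>Poly_Mapping.keys F. Poly_Mapping.single m (Poly_Mapping.lookup F m))"
proof (rule poly_mapping_eqI)
  fix k
  have "(\<Sum>m\<in>Poly_Mapping.keys F. Poly_Mapping.lookup F m when m = k) =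
        (\<Sum>m\<in>Poly_Mapping.keys F. if m = k then Poly_Mapping.lookup F m else 0)"
    by (intro sum.cong) (auto simp: when_def)
  also have "\<dots> = Poly_Mapping.lookup F k"
    by (auto simp: in_keys_iff)
  finally show "Poly_Mapping.lookup F k = Poly_Mapping.lookup
      (\<Sum>m\<in>Poly_Mapping.keys F. Poly_Mapping.single m (Poly_Mapping.lookup F m)) k"
    by (simp add: lookup_sum lookup_single)
qed

lemma meval_mult: "meval v (F * G) = meval v F * meval v G"
proof -
  let ?s = "\<lambda>F m. Poly_Mapping.single m (Poly_Mapping.lookup F m)"
  have "F * G = (\<Sum>m\<in>Poly_Mapping.keys F. ?s F m) * (\<Sum>m\<in>Poly_Mapping.keys G. ?s G m)"
    using sum_singles[of F] sum_singles[of G] by simp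
  also have "\<dots> = (\<Sum>m\<in>Poly_Mapping.keys F. \<Sum>m'\<in>Poly_Mapping.keys G.
      Poly_Mapping.single (m + m') (Poly_Mapping.lookup F m * Poly_Mapping.lookup G m'))"
    by (simp add: sum_product mult_single)
  finally have "meval v (F * G) = (\<Sum>m\<in>Poly_Mapping.keys F. \<Sum>m'\<in>Poly_Mapping.keys G.
      Poly_Mapping.lookup F m * Poly_Mapping.lookup G m' * mon_eval v (m + m'))"
    by (simp only: meval_sum meval_single)
  also have "\<dots> = meval v F * meval v G"
    by (simp add: meval_def sum_product mon_eval_add mult_ac)
  finally show ?thesis .
qed

lemma homogeneous_mult: "homogeneous d F \<Longrightarrow> homogeneous e G \<Longrightarrow> homogeneous (d + e) (F * G)"
  using keys_mult[of F G] by (fastforce simp: homogeneous_def mon_deg_add)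

definition zero_locus :: "'k::field mpol set \<Rightarrow> 'k proj set" where
  "zero_locus S = {P. \<forall>F\<in>S. meval (coords P) F = 0}"

definition zariski :: "'k::field proj topology" where
  "zariski = topology (\<lambda>U. \<exists>S. (\<forall>F\<in>S. \<exists>d. homogeneous d F) \<and> U = - zero_locus S)"

lemma istopology_zariski:
  "istopology (\<lambda>U :: 'k::field proj set. \<exists>S. (\<forall>F\<in>S. \<exists>d. homogeneous d F) \<and> U = - zero_locus S)"
  unfolding istopology_def
proof (intro conjI allI impI)
  fix U W :: "'k proj set"
  assume "\<exists>S. (\<forall>F\<in>S. \<exists>d. homogeneous d F) \<and> U = - zero_locus S"
    and "\<exists>S. (\<forall>F\<in>S. \<exists>d. homogeneous d F) \<and> W = - zero_locus S"
  then obtain S T where S: "\<forall>F\<in>S. \<exists>d. homogeneous d F" "U = - zero_locus S"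
    and T: "\<forall>F\<in>T. \<exists>d. homogeneous d F" "W = - zero_locus T" by blast
  have "U \<inter> W = - zero_locus {F * G |F G. F \<in> S \<and> G \<in> T}"
    using S T by (fastforce simp: zero_locus_def meval_mult)
  moreover have "\<forall>H\<in>{F * G |F G. F \<in> S \<and> G \<in> T}. \<exists>d. homogeneous d H"
    using S T homogeneous_mult by blast
  ultimately show "\<exists>S. (\<forall>F\<in>S. \<exists>d. homogeneous d F) \<and> U \<inter> W = - zero_locus S" by blast
next
  fix \<U> :: "'k proj set set"
  assume "\<forall>U\<in>\<U>. \<exists>S. (\<forall>F\<in>S. \<exists>d. homogeneous d F) \<and> U = - zero_locus S"
  then obtain S where S: "\<And>U. U \<in> \<U> \<Longrightarrow> (\<forall>F\<in>S U. \<exists>d. homogeneous d F) \<and> U = - zero_locus (S U)"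
    by metis
  have "\<Union>\<U> = - zero_locus (\<Union>U\<in>\<U>. S U)"
    using S by (auto simp: zero_locus_def) blast+
  then show "\<exists>S. (\<forall>F\<in>S. \<exists>d. homogeneous d F) \<and> \<Union>\<U> = - zero_locus S"
    using S by (intro exI[of _ "\<Union>U\<in>\<U>. S U"]) auto
qed

lemma openin_zariski:
  "openin zariski U \<longleftrightarrow> (\<exists>S. (\<forall>F\<in>S. \<exists>d. homogeneous d F) \<and> U = - zero_locus S)"
  by (simp add: zariski_def topology_inverse'[OF istopology_zariski])

abbreviation zar :: "'k::field proj set \<Rightarrow> 'k proj topology" where
  "zar V \<equiv> subtopology zariski V"

definition irreducible_set :: "'k::field proj set \<Rightarrow> bool" where
  "irreducible_set V \<longleftrightarrow> V \<noteq> {} \<and>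
     (\<forall>C D. closedin zariski C \<and> closedin zariski D \<and> V \<subseteq> C \<union> D \<longrightarrow> V \<subseteq> C \<or> V \<subseteq> D)"

definition variety :: "'k::field proj set \<Rightarrow> bool" where
  "variety V \<longleftrightarrow> irreducible_set V \<and>
     (\<exists>n. V \<subseteq> proj_space n) \<and> (\<exists>C U. closedin zariski C \<and> openin zariski U \<and> V = C \<inter> U)"

definition projective_variety :: "'k::field proj set \<Rightarrow> bool" where
  "projective_variety V \<longleftrightarrow> irreducible_set V \<and> (\<exists>n. V \<subseteq> proj_space n) \<and> closedin zariski V"

text \<open>Dimension: supremum of the lengths of chains of irreducible closed subsets.\<close>

definition krull_dim :: "'k::field proj set \<Rightarrow> enat" where
  "krull_dim V = Sup {enat n |n. \<exists>C :: nat \<Rightarrow> 'k proj set.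
     (\<forall>i\<le>n. closedin (zar V) (C i) \<and> irreducible_set (C i)) \<and> (\<forall>i<n. C i \<subset> C (Suc i))}"


section \<open>Regular functions and morphisms\<close>

text \<open>
  The quotients \<open>G / H\<close> do not depend on the chosen coordinates because \<open>G\<close> and \<open>H\<close> are
  homogeneous of the same degree. Values of \<open>f\<close> outside \<open>U\<close> are irrelevant.
\<close>

definition regular_fun :: "'k::field proj set \<Rightarrow> ('k proj \<Rightarrow> 'k) \<Rightarrow> bool" where
  "regular_fun U f \<longleftrightarrow> (\<forall>P\<in>U. \<exists>W d G H. openin (zar U) W \<and> P \<in> W \<and>
     homogeneous d G \<and> homogeneous d H \<and>
     (\<forall>Q\<in>W. meval (coords Q) H \<noteq> 0 \<and> f Q = meval (coords Q) G / meval (coords Q) H))"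

definition morphism :: "'k::field proj set \<Rightarrow> 'k proj set \<Rightarrow> ('k proj \<Rightarrow> 'k proj) \<Rightarrow> bool" where
  "morphism V W \<phi> \<longleftrightarrow> continuous_map (zar V) (zar W) \<phi> \<and>
     (\<forall>U f. openin (zar W) U \<and> regular_fun U f \<longrightarrow> regular_fun (V \<inter> \<phi> -` U) (f \<circ> \<phi>))"

definition isomorphism :: "'k::field proj set \<Rightarrow> 'k proj set \<Rightarrow> ('k proj \<Rightarrow> 'k proj) \<Rightarrow> bool" where
  "isomorphism V W \<phi> \<longleftrightarrow> morphism V W \<phi> \<and>
     (\<exists>\<chi>. morphism W V \<chi> \<and> (\<forall>P\<in>V. \<chi> (\<phi> P) = P) \<and> (\<forall>Q\<in>W. \<phi> (\<chi> Q) = Q))"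

definition affine_space :: "nat \<Rightarrow> 'k::field proj set" where
  "affine_space n = {P \<in> proj_space n. coords P 0 \<noteq> 0}"

text \<open>Affine in the sense of affine schemes; irreducibility is not required.\<close>

definition is_affine :: "'k::field proj set \<Rightarrow> bool" where
  "is_affine U \<longleftrightarrow> (\<exists>n A \<phi>. closedin (zar (affine_space n)) A \<and> isomorphism U A \<phi>)"

definition finite_morphism :: "'k::field proj set \<Rightarrow> 'k proj set \<Rightarrow> ('k proj \<Rightarrow> 'k proj) \<Rightarrow> bool" where
  "finite_morphism V W \<phi> \<longleftrightarrow> morphism V W \<phi> \<and>
     (\<forall>Q\<in>W. \<exists>U. openin (zar W) U \<and> Q \<in> U \<and> is_affine U \<and> is_affine (V \<inter> \<phi> -` U) \<and>
        (\<exists>(n::nat) g. (\<forall>i<n. regular_fun (V \<inter> \<phi> -` U) (g i)) \<and>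
           (\<forall>f. regular_fun (V \<inter> \<phi> -` U) f \<longrightarrow>
              (\<exists>a. (\<forall>i<n. regular_fun U (a i)) \<and>
                   (\<forall>P\<in>V \<inter> \<phi> -` U. f P = (\<Sum>i<n. a i (\<phi> P) * g i P))))))"


section \<open>Function field and local rings\<close>

text \<open>
  Rational functions are classes of pairs \<open>(U, f)\<close>, with \<open>U\<close> nonempty open and \<open>f\<close> regular on \<open>U\<close>,
  two pairs being identified if they agree on the intersection of their domains. The local ring at
  \<open>P\<close> is realised as a subring of the function field.
\<close>

definition rat_pairs :: "'k::field proj set \<Rightarrow> ('k proj set \<times> ('k proj \<Rightarrow> 'k)) set" where
  "rat_pairs V = {(U, f). openin (zar V) U \<and> U \<noteq> {} \<and> regular_fun U f}"

definition rat_rel ::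
    "'k::field proj set \<Rightarrow> (('k proj set \<times> ('k proj \<Rightarrow> 'k)) \<times> ('k proj set \<times> ('k proj \<Rightarrow> 'k))) set" where
  "rat_rel V = {((U, f), (U', f')). (U, f) \<in> rat_pairs V \<and> (U', f') \<in> rat_pairs V \<and>
     (\<forall>P\<in>U \<inter> U'. f P = f' P)}"

type_synonym 'k ratfun = "('k proj set \<times> ('k proj \<Rightarrow> 'k)) set"

definition rat :: "'k::field proj set \<Rightarrow> 'k proj set \<Rightarrow> ('k proj \<Rightarrow> 'k) \<Rightarrow> 'k ratfun" where
  "rat V U f = rat_rel V `` {(U, f)}"

definition function_field :: "'k::field proj set \<Rightarrow> 'k ratfun ring" where
  "function_field V =
     \<lparr> carrier = rat_pairs V // rat_rel V,
       monoid.mult = (\<lambda>a b. \<Union>(U, f)\<in>a. \<Union>(U', f')\<in>b. rat V (U \<inter> U') (\<lambda>P. f P * f' P)),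
       monoid.one = rat V V (\<lambda>_. 1),
       ring.zero = rat V V (\<lambda>_. 0),
       ring.add = (\<lambda>a b. \<Union>(U, f)\<in>a. \<Union>(U', f')\<in>b. rat V (U \<inter> U') (\<lambda>P. f P + f' P)) \<rparr>"

definition local_ring :: "'k::field proj set \<Rightarrow> 'k proj \<Rightarrow> 'k ratfun ring" where
  "local_ring V P = function_field V
     \<lparr> carrier := {rat V U f |U f. (U, f) \<in> rat_pairs V \<and> P \<in> U} \<rparr>"

definition max_ideal :: "'k::field proj set \<Rightarrow> 'k proj \<Rightarrow> 'k ratfun set" where
  "max_ideal V P = {rat V U f |U f. (U, f) \<in> rat_pairs V \<and> P \<in> U \<and> f P = 0}"

text \<open>\<open>cotangent_dim V P d\<close>: the \<open>k\<close>-vector space \<open>m / m\<^sup>2\<close> has a basis with \<open>d\<close> elements.\<close>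

definition cotangent_dim :: "'k::field proj set \<Rightarrow> 'k proj \<Rightarrow> nat \<Rightarrow> bool" where
  "cotangent_dim V P d \<longleftrightarrow>
     (let R = local_ring V P; m = max_ideal V P in
      \<exists>t. (\<forall>i<d. t i \<in> m) \<and>
          (\<forall>f\<in>m. \<exists>!c. c \<in> {..<d} \<rightarrow>\<^sub>E UNIV \<and>
             f \<ominus>\<^bsub>R\<^esub> (\<Oplus>\<^bsub>R\<^esub>i\<in>{..<d}. rat V V (\<lambda>_. c i) \<otimes>\<^bsub>R\<^esub> t i) \<in> ideal_prod R m m))"

definition smooth_variety :: "'k::field proj set \<Rightarrow> bool" where
  "smooth_variety V \<longleftrightarrow> (\<forall>P\<in>V. \<exists>d. krull_dim V = enat d \<and> cotangent_dim V P d)"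

definition smooth_projective_curve :: "'k::field proj set \<Rightarrow> bool" where
  "smooth_projective_curve V \<longleftrightarrow> projective_variety V \<and> krull_dim V = 1 \<and> smooth_variety V"

text \<open>
  The first coefficient in the argument of \<open>ring.eval\<close> is the leading one, so \<open>\<one> # cs\<close> is an
  arbitrary monic polynomial.
\<close>

definition normal_variety :: "'k::field proj set \<Rightarrow> bool" where
  "normal_variety V \<longleftrightarrow> (\<forall>P\<in>V. \<forall>a\<in>carrier (function_field V). \<forall>cs.
     set cs \<subseteq> carrier (local_ring V P) \<and>
     ring.eval (function_field V) (\<one>\<^bsub>function_field V\<^esub> # cs) a = \<zero>\<^bsub>function_field V\<^esub>
     \<longrightarrow> a \<in> carrier (local_ring V P))"

text \<open>Pullback of rational functions along a dominant morphism \<open>\<phi> : V \<rightarrow> W\<close>.\<close>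

definition pullback_rat ::
    "'k::field proj set \<Rightarrow> 'k proj set \<Rightarrow> ('k proj \<Rightarrow> 'k proj) \<Rightarrow> 'k ratfun \<Rightarrow> 'k ratfun" where
  "pullback_rat V W \<phi> a = (\<Union>(U, f)\<in>a. rat V (V \<inter> \<phi> -` U) (f \<circ> \<phi>))"


section \<open>Galois covers, quotients, normalisation\<close>

text \<open>Flatness of a ring homomorphism, by the equational criterion.\<close>

definition flat_hom :: "('a, 'm) ring_scheme \<Rightarrow> ('b, 'n) ring_scheme \<Rightarrow> ('a \<Rightarrow> 'b) \<Rightarrow> bool" where
  "flat_hom A B \<theta> \<longleftrightarrow>
     (\<forall>(n::nat) a x. (\<forall>i<n. a i \<in> carrier A \<and> x i \<in> carrier B) \<and>
        (\<Oplus>\<^bsub>B\<^esub>i\<in>{..<n}. \<theta> (a i) \<otimes>\<^bsub>B\<^esub> x i) = \<zero>\<^bsub>B\<^esub> \<longrightarrow>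
        (\<exists>(m::nat) y c. (\<forall>j<m. y j \<in> carrier B) \<and> (\<forall>i<n. \<forall>j<m. c i j \<in> carrier A) \<and>
           (\<forall>i<n. x i = (\<Oplus>\<^bsub>B\<^esub>j\<in>{..<m}. \<theta> (c i j) \<otimes>\<^bsub>B\<^esub> y j)) \<and>
           (\<forall>j<m. (\<Oplus>\<^bsub>A\<^esub>i\<in>{..<n}. a i \<otimes>\<^bsub>A\<^esub> c i j) = \<zero>\<^bsub>A\<^esub>)))"

text \<open>
  Flat and unramified at \<open>P\<close>. Since \<open>k\<close> is algebraically closed the residue field extension is
  trivial, so unramified means that the maximal ideal downstairs generates the one upstairs.
\<close>

definition etale_at ::
    "'k::field proj set \<Rightarrow> 'k proj set \<Rightarrow> ('k proj \<Rightarrow> 'k proj) \<Rightarrow> 'k proj \<Rightarrow> bool" where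
  "etale_at V W \<phi> P \<longleftrightarrow>
     flat_hom (local_ring W (\<phi> P)) (local_ring V P) (pullback_rat V W \<phi>) \<and>
     Idl\<^bsub>local_ring V P\<^esub> (pullback_rat V W \<phi> ` max_ideal W (\<phi> P)) = max_ideal V P"

text \<open>The group \<open>Aut(V|W)\<close> of a cover \<open>\<psi> : V \<rightarrow> W\<close>, a group of extensional bijections of \<open>V\<close> under composition.\<close>

definition deck_group ::
    "'k::field proj set \<Rightarrow> ('k proj \<Rightarrow> 'k proj) \<Rightarrow> ('k proj \<Rightarrow> 'k proj) monoid" where
  "deck_group V \<psi> = BijGroup V
     \<lparr> carrier := {\<sigma> \<in> Bij V. isomorphism V V \<sigma> \<and> (\<forall>P\<in>V. \<psi> (\<sigma> P) = \<psi> P)} \<rparr>"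

text \<open>
  A Galois cover: a finite surjective morphism whose function field extension is Galois, i.e. the
  field of invariants of \<open>Aut(V|W)\<close> (required to be finite) is the function field of \<open>W\<close>.
\<close>

definition galois_cover :: "'k::field proj set \<Rightarrow> 'k proj set \<Rightarrow> ('k proj \<Rightarrow> 'k proj) \<Rightarrow> bool" where
  "galois_cover V W \<psi> \<longleftrightarrow> finite_morphism V W \<psi> \<and> \<psi> ` V = W \<and>
     finite (carrier (deck_group V \<psi>)) \<and>
     {a \<in> carrier (function_field V). \<forall>\<sigma>\<in>carrier (deck_group V \<psi>). pullback_rat V V \<sigma> a = a}
       = pullback_rat V W \<psi> ` carrier (function_field W)"

text \<open>
  The quotient \<open>q : V \<rightarrow> V/K\<close>: points are \<open>K\<close>-orbits, the topology is the quotient topology, and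
  the regular functions on \<open>U\<close> are the \<open>K\<close>-invariant regular functions on the preimage of \<open>U\<close>
  (functions of the form \<open>f \<circ> q\<close> are exactly the \<open>K\<close>-invariant ones).
\<close>

definition is_quotient ::
    "'k::field proj set \<Rightarrow> ('k proj \<Rightarrow> 'k proj) set \<Rightarrow> 'k proj set \<Rightarrow> ('k proj \<Rightarrow> 'k proj) \<Rightarrow> bool" where
  "is_quotient V K Z q \<longleftrightarrow> variety Z \<and> quotient_map (zar V) (zar Z) q \<and>
     (\<forall>P\<in>V. \<forall>P'\<in>V. q P = q P' \<longleftrightarrow> (\<exists>\<sigma>\<in>K. P' = \<sigma> P)) \<and>
     (\<forall>U f. openin (zar Z) U \<longrightarrow> regular_fun U f = regular_fun (V \<inter> q -` U) (f \<circ> q))"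

definition birational_morphism ::
    "'k::field proj set \<Rightarrow> 'k proj set \<Rightarrow> ('k proj \<Rightarrow> 'k proj) \<Rightarrow> bool" where
  "birational_morphism Y Z \<nu> \<longleftrightarrow> morphism Y Z \<nu> \<and>
     (\<exists>U. openin (zar Z) U \<and> U \<noteq> {} \<and> isomorphism (Y \<inter> \<nu> -` U) U \<nu>)"

definition is_normalisation ::
    "'k::field proj set \<Rightarrow> 'k proj set \<Rightarrow> ('k proj \<Rightarrow> 'k proj) \<Rightarrow> bool" where
  "is_normalisation Y Z \<nu> \<longleftrightarrow>
     variety Y \<and> normal_variety Y \<and> finite_morphism Y Z \<nu> \<and> birational_morphism Y Z \<nu>"


section \<open>Divisors and the Picard group of a curve\<close>

abbreviation Div :: "'k::field proj set \<Rightarrow> ('k proj \<Rightarrow>\<^sub>0 int) monoid" where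
  "Div V \<equiv> free_Abelian_group V"

definition div_degree :: "('k::field proj \<Rightarrow>\<^sub>0 int) \<Rightarrow> int" where
  "div_degree D = (\<Sum>P\<in>Poly_Mapping.keys D. Poly_Mapping.lookup D P)"

definition uniformizer :: "'k::field proj set \<Rightarrow> 'k proj \<Rightarrow> 'k ratfun \<Rightarrow> bool" where
  "uniformizer V P t \<longleftrightarrow> t \<in> max_ideal V P \<and> max_ideal V P = PIdl\<^bsub>local_ring V P\<^esub> t"

text \<open>Order of vanishing at \<open>P\<close> of a nonzero rational function.\<close>

definition ord_at :: "'k::field proj set \<Rightarrow> 'k proj \<Rightarrow> 'k ratfun \<Rightarrow> int" where
  "ord_at V P a = (THE n. \<exists>t u. uniformizer V P t \<and> u \<in> Units (local_ring V P) \<and>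
     a = u \<otimes>\<^bsub>function_field V\<^esub> (t [^]\<^bsub>function_field V\<^esub> (n::int)))"

definition Prin :: "'k::field proj set \<Rightarrow> ('k proj \<Rightarrow>\<^sub>0 int) set" where
  "Prin V = {D \<in> carrier (Div V).
     \<exists>a\<in>carrier (function_field V) - {\<zero>\<^bsub>function_field V\<^esub>}. \<forall>P\<in>V. Poly_Mapping.lookup D P = ord_at V P a}"

definition Pic :: "'k::field proj set \<Rightarrow> ('k proj \<Rightarrow>\<^sub>0 int) set monoid" where
  "Pic V = Div V Mod Prin V"

definition Pic0 :: "'k::field proj set \<Rightarrow> ('k proj \<Rightarrow>\<^sub>0 int) set monoid" where
  "Pic0 V = (Pic V)
     \<lparr> carrier := {Prin V #>\<^bsub>Div V\<^esub> D |D. D \<in> carrier (Div V) \<and> div_degree D = 0} \<rparr>"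

definition torsion :: "('a, 'm) monoid_scheme \<Rightarrow> nat \<Rightarrow> 'a set" where
  "torsion G n = {c \<in> carrier G. c [^]\<^bsub>G\<^esub> n = \<one>\<^bsub>G\<^esub>}"

definition ram_index ::
    "'k::field proj set \<Rightarrow> 'k proj set \<Rightarrow> ('k proj \<Rightarrow> 'k proj) \<Rightarrow> 'k proj \<Rightarrow> int" where
  "ram_index V W \<phi> P =
     (THE e. \<exists>t. uniformizer W (\<phi> P) t \<and> e = ord_at V P (pullback_rat V W \<phi> t))"

text \<open>
  Pullback of divisors along a finite morphism of smooth curves: the linear extension of
  \<open>Q \<mapsto> \<Sum>P\<in>\<phi>\<^sup>-\<^sup>1(Q). e\<^sub>P P\<close>, and the induced map on divisor classes.
\<close>

definition pullback_div ::
    "'k::field proj set \<Rightarrow> 'k proj set \<Rightarrow> ('k proj \<Rightarrow> 'k proj) \<Rightarrow> ('k proj \<Rightarrow>\<^sub>0 int) \<Rightarrow> ('k proj \<Rightarrow>\<^sub>0 int)" where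
  "pullback_div V W \<phi> =
     frag_extend (\<lambda>Q. \<Sum>P\<in>{P \<in> V. \<phi> P = Q}. frag_cmul (ram_index V W \<phi> P) (frag_of P))"

definition pullback_pic ::
    "'k::field proj set \<Rightarrow> 'k proj set \<Rightarrow> ('k proj \<Rightarrow> 'k proj) \<Rightarrow> ('k proj \<Rightarrow>\<^sub>0 int) set \<Rightarrow> ('k proj \<Rightarrow>\<^sub>0 int) set" where
  "pullback_pic V W \<phi> c = (\<Union>D\<in>c. Prin V #>\<^bsub>Div V\<^esub> pullback_div V W \<phi> D)"

end

theory Submission
  imports Defs "HOL-Library.Function_Algebras"
begin

text \<open>
  Write \<open>n = |K|\<close>, a power of \<open>p\<close>, and let \<open>h\<^sub>*\<close> be the push-forward of divisors along \<open>h : V \<rightarrow> Y\<close>, so that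
  \<open>h\<^sup>* h\<^sub>* D = \<Sum>\<sigma>\<in>K. \<sigma>\<^sup>* D\<close>. Principal divisors push forward to principal divisors, since the norm
  \<open>\<Prod>\<sigma>\<in>K. \<sigma>\<^sup>* f\<close> descends to \<open>Y\<close>. If \<open>h\<^sup>* D\<close> is principal then so is \<open>n D\<close>, which gives injectivity on
  \<open>l\<close>-torsion; if \<open>D\<close> is an invariant \<open>l\<close>-torsion class then \<open>n D = h\<^sup>* h\<^sub>* D\<close>, and \<open>n\<close> is invertible
  modulo \<open>l\<close>.

  The geometric input is that \<open>Y\<close> is a smooth curve with \<open>h\<close> the quotient map, and that the
  ramification index of \<open>h\<close> at \<open>P\<close> is the order of the stabiliser of \<open>P\<close>, also in the wild case.
  The norm of a function with a simple zero at \<open>P\<close> and no other zero or pole on the orbit of \<open>P\<close> is an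
  invariant function of order \<open>|Stab(P)|\<close>; no smaller positive order is possible for invariant functions.

  Rational functions on \<open>V\<close> are handled as ordinary functions on the ambient space, compared
  along the filter of nonempty open subsets of \<open>V\<close>.
\<close>

section \<open>Regular functions\<close>

text \<open>The obstacle is wild ramification: the stabilisers are p-groups in characteristic p, so
  their orders cannot be divided by. What can be used is that the functions
  \<open>t o \<sigma>\<close>, for a uniformiser \<open>t\<close> at P and \<sigma> in Stab(P), are
  pairwise distinct. They serve as nodes for Lagrange interpolation, and an invariant function of
  too small positive order would contradict the interpolation formula. This bound and the norm
  together show that the orders at P of nonzero invariant functions are exactly the multiples of
  |Stab(P)|. An invariant function of order |Stab(P)| therefore descends to a uniformiser at h(P),
  so that regularity of Y and the ramification index come out of one argument. On V, discrete
  valuations are extracted from the definition of smoothness: Nakayama turns the one-dimensional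
  cotangent space into a generator of the maximal ideal, and Krull's intersection theorem, resting
  on Hilbert's basis theorem, gives nonzero functions finite order. Degree zero is preserved by
  counting: push-forward keeps degrees, and pullback along h multiplies them by |K|.\<close>

lemma homogeneous_add_same: "homogeneous d F \<Longrightarrow> homogeneous d G \<Longrightarrow> homogeneous d (F + G)"
  using Poly_Mapping.keys_add[of F G] by (auto simp: homogeneous_def)

lemma homogeneous_single: "homogeneous (mon_deg m) (Poly_Mapping.single m c)"
  by (simp add: homogeneous_def)

lemma homogeneous_const: "homogeneous 0 (Poly_Mapping.single 0 c)"
  using homogeneous_single[of 0 c] by (simp add: mon_deg_def)

lemma meval_const [simp]: "meval v (Poly_Mapping.single 0 c) = c"
  by (simp add: meval_single mon_eval_def)

lemma meval_one [simp]: "meval v 1 = 1"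
  using meval_const[of v 1] by simp

lemma openin_nonvanishing:
  assumes "homogeneous d H"
  shows "openin zariski {P. meval (coords P) H \<noteq> 0}"
  unfolding openin_zariski
  by (rule exI[of _ "{H}"]) (use assms in \<open>auto simp: zero_locus_def\<close>)

lemma topspace_zariski [simp]: "topspace zariski = UNIV"
proof -
  have "openin zariski (UNIV :: 'k::field proj set)"
    using openin_nonvanishing[OF homogeneous_const, of "1 :: 'k"] by simp
  then show ?thesis
    using openin_subset by fastforce
qed

lemma openin_zar_subset: "openin (zar V) U \<Longrightarrow> U \<subseteq> V"
  using openin_subset by fastforce

lemma openin_zar_self [simp]: "openin (zar V) V"
  by (simp add: openin_subtopology_refl)

lemma openin_zar_restrict: "openin zariski O' \<Longrightarrow> openin (zar V) (V \<inter> O')"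
  by (auto simp: openin_subtopology)

text \<open>Regularity as a condition at one point, with neighbourhoods open in \<open>V\<close>
  itself. The domain \<open>U\<close> of \<open>regular_fun\<close> disappears, so sums and
  quotients are formed without tracking a common domain; \<open>regular_fun_iff\<close> translates
  back.\<close>

definition regular_at :: "'k::field proj set \<Rightarrow> 'k proj \<Rightarrow> ('k proj \<Rightarrow> 'k) \<Rightarrow> bool" where
  "regular_at V P f \<longleftrightarrow> (\<exists>d G H U. openin (zar V) U \<and> P \<in> U \<and> homogeneous d G \<and> homogeneous d H \<and>
     (\<forall>Q\<in>U. meval (coords Q) H \<noteq> 0 \<and> f Q = meval (coords Q) G / meval (coords Q) H))"

lemma regular_atE:
  assumes "regular_at V P f"
  obtains d G H U where "openin (zar V) U" "P \<in> U" "homogeneous d G" "homogeneous d H"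
    "\<And>Q. Q \<in> U \<Longrightarrow> meval (coords Q) H \<noteq> 0"
    "\<And>Q. Q \<in> U \<Longrightarrow> f Q = meval (coords Q) G / meval (coords Q) H"
  using assms unfolding regular_at_def by blast

lemma regular_atI:
  assumes "openin (zar V) U" "P \<in> U" "homogeneous d G" "homogeneous d H"
    "\<And>Q. Q \<in> U \<Longrightarrow> meval (coords Q) H \<noteq> 0"
    "\<And>Q. Q \<in> U \<Longrightarrow> f Q = meval (coords Q) G / meval (coords Q) H"
  shows "regular_at V P f"
  unfolding regular_at_def using assms by blast

lemma regular_at_mem: "regular_at V P f \<Longrightarrow> P \<in> V"
  by (elim regular_atE) (use openin_zar_subset in blast)

lemma regular_fun_iff:
  assumes "openin (zar V) U"
  shows "regular_fun U f \<longleftrightarrow> (\<forall>P\<in>U. regular_at V P f)"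
proof -
  have "zar U = subtopology (zar V) U"
    using openin_zar_subset[OF assms] by (simp add: subtopology_subtopology Int_absorb1)
  then have *: "openin (zar U) W \<longleftrightarrow> openin (zar V) W \<and> W \<subseteq> U" for W
    using openin_open_subtopology[OF assms] by simp
  show ?thesis
  proof
    assume r: "regular_fun U f"
    show "\<forall>P\<in>U. regular_at V P f"
    proof
      fix P assume "P \<in> U"
      with r have "\<exists>W d G H. openin (zar U) W \<and> P \<in> W \<and> homogeneous d G \<and> homogeneous d H \<and>
          (\<forall>Q\<in>W. meval (coords Q) H \<noteq> 0 \<and> f Q = meval (coords Q) G / meval (coords Q) H)"
        unfolding regular_fun_def by (rule bspec)
      then obtain W d G H where "openin (zar U) W" "P \<in> W" "homogeneous d G" "homogeneous d H"
        "\<forall>Q\<in>W. meval (coords Q) H \<noteq> 0 \<and> f Q = meval (coords Q) G / meval (coords Q) H"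
        by (elim exE conjE)
      then show "regular_at V P f"
        using * by (intro regular_atI[of V W P d G H]) auto
    qed
  next
    assume r: "\<forall>P\<in>U. regular_at V P f"
    show "regular_fun U f"
      unfolding regular_fun_def
    proof
      fix P assume P: "P \<in> U"
      then have "regular_at V P f" using r by blast
      then show "\<exists>W d G H. openin (zar U) W \<and> P \<in> W \<and> homogeneous d G \<and> homogeneous d H \<and>
          (\<forall>Q\<in>W. meval (coords Q) H \<noteq> 0 \<and> f Q = meval (coords Q) G / meval (coords Q) H)"
      proof (rule regular_atE)
        fix d G H W
        assume "openin (zar V) W" "P \<in> W" "homogeneous d G" "homogeneous d H"
          "\<And>Q. Q \<in> W \<Longrightarrow> meval (coords Q) H \<noteq> 0"
          "\<And>Q. Q \<in> W \<Longrightarrow> f Q = meval (coords Q) G / meval (coords Q) H"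
        then show ?thesis
          using assms * P
          by (intro exI[of _ "W \<inter> U"] exI[of _ d] exI[of _ G] exI[of _ H]) auto
      qed
    qed
  qed
qed

lemma regular_at_cong:
  assumes "regular_at V P f" "openin (zar V) U" "P \<in> U" "\<And>Q. Q \<in> U \<Longrightarrow> f Q = g Q"
  shows "regular_at V P g"
  using assms(1)
proof (rule regular_atE)
  fix d G H W
  assume "openin (zar V) W" "P \<in> W" "homogeneous d G" "homogeneous d H"
    "\<And>Q. Q \<in> W \<Longrightarrow> meval (coords Q) H \<noteq> 0"
    "\<And>Q. Q \<in> W \<Longrightarrow> f Q = meval (coords Q) G / meval (coords Q) H"
  then show ?thesis
    using assms(2-4) by (intro regular_atI[of V "W \<inter> U" P d G H]) (auto simp flip: assms(4))
qed

lemma regular_at_nhd: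
  assumes "regular_at V P f"
  shows "\<exists>U. openin (zar V) U \<and> P \<in> U \<and> (\<forall>Q\<in>U. regular_at V Q f)"
  using assms unfolding regular_at_def by blast

lemma regular_at_quotient:
  assumes "P \<in> V" "homogeneous d G" "homogeneous d H" "meval (coords P) H \<noteq> 0"
  shows "regular_at V P (\<lambda>Q. meval (coords Q) G / meval (coords Q) H)"
  by (rule regular_atI[OF openin_zar_restrict[OF openin_nonvanishing[OF assms(3)]], of P V d G H])
    (use assms in auto)

lemma regular_at_const: "P \<in> V \<Longrightarrow> regular_at V P (\<lambda>_. c)"
  using regular_at_quotient[of P V 0 "Poly_Mapping.single 0 c" "Poly_Mapping.single 0 1"]
    homogeneous_const[of c] homogeneous_const[of "1 :: 'a"] by simp

lemma regular_at_add:
  assumes "regular_at V P f" "regular_at V P g"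
  shows "regular_at V P (\<lambda>Q. f Q + g Q)"
  using assms(1)
proof (rule regular_atE)
  fix d G H U
  assume f: "openin (zar V) U" "P \<in> U" "homogeneous d G" "homogeneous d H"
    "\<And>Q. Q \<in> U \<Longrightarrow> meval (coords Q) H \<noteq> 0"
    "\<And>Q. Q \<in> U \<Longrightarrow> f Q = meval (coords Q) G / meval (coords Q) H"
  show ?thesis using assms(2)
  proof (rule regular_atE)
    fix d' G' H' U'
    assume g: "openin (zar V) U'" "P \<in> U'" "homogeneous d' G'" "homogeneous d' H'"
      "\<And>Q. Q \<in> U' \<Longrightarrow> meval (coords Q) H' \<noteq> 0"
      "\<And>Q. Q \<in> U' \<Longrightarrow> g Q = meval (coords Q) G' / meval (coords Q) H'"
    show ?thesis
      using f g homogeneous_mult[OF f(3) g(4)] homogeneous_mult[OF f(4) g(3)]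
        homogeneous_mult[OF f(4) g(4)]
      by (intro regular_atI[of V "U \<inter> U'" P "d + d'" "G * H' + H * G'" "H * H'"])
        (auto intro!: homogeneous_add_same simp: meval_add meval_mult add_frac_eq)
  qed
qed

lemma regular_at_mult:
  assumes "regular_at V P f" "regular_at V P g"
  shows "regular_at V P (\<lambda>Q. f Q * g Q)"
  using assms(1)
proof (rule regular_atE)
  fix d G H U
  assume f: "openin (zar V) U" "P \<in> U" "homogeneous d G" "homogeneous d H"
    "\<And>Q. Q \<in> U \<Longrightarrow> meval (coords Q) H \<noteq> 0"
    "\<And>Q. Q \<in> U \<Longrightarrow> f Q = meval (coords Q) G / meval (coords Q) H"
  show ?thesis using assms(2)
  proof (rule regular_atE)
    fix d' G' H' U'
    assume g: "openin (zar V) U'" "P \<in> U'" "homogeneous d' G'" "homogeneous d' H'"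
      "\<And>Q. Q \<in> U' \<Longrightarrow> meval (coords Q) H' \<noteq> 0"
      "\<And>Q. Q \<in> U' \<Longrightarrow> g Q = meval (coords Q) G' / meval (coords Q) H'"
    show ?thesis
      using f g
      by (intro regular_atI[of V "U \<inter> U'" P "d + d'" "G * G'" "H * H'"])
        (auto intro!: homogeneous_mult simp: meval_mult)
  qed
qed

lemma regular_at_nonzero_nhd:
  assumes "regular_at V P f" "f P \<noteq> 0"
  shows "\<exists>U. openin (zar V) U \<and> P \<in> U \<and> (\<forall>Q\<in>U. f Q \<noteq> 0)"
  using assms(1)
proof (rule regular_atE)
  fix d G H U
  assume f: "openin (zar V) U" "P \<in> U" "homogeneous d G" "homogeneous d H"
    "\<And>Q. Q \<in> U \<Longrightarrow> meval (coords Q) H \<noteq> 0"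
    "\<And>Q. Q \<in> U \<Longrightarrow> f Q = meval (coords Q) G / meval (coords Q) H"
  show ?thesis
    using openin_Int[OF f(1) openin_zar_restrict[OF openin_nonvanishing[OF f(3)], of V]] f assms(2)
      openin_zar_subset[OF f(1)]
    by (intro exI[of _ "U \<inter> (V \<inter> {Q. meval (coords Q) G \<noteq> 0})"]) auto
qed

lemma regular_at_inverse:
  assumes "regular_at V P f" "f P \<noteq> 0"
  shows "regular_at V P (\<lambda>Q. inverse (f Q))"
  using assms(1)
proof (rule regular_atE)
  fix d G H U
  assume f: "openin (zar V) U" "P \<in> U" "homogeneous d G" "homogeneous d H"
    "\<And>Q. Q \<in> U \<Longrightarrow> meval (coords Q) H \<noteq> 0"
    "\<And>Q. Q \<in> U \<Longrightarrow> f Q = meval (coords Q) G / meval (coords Q) H"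
  obtain U' where U': "openin (zar V) U'" "P \<in> U'" "\<forall>Q\<in>U'. f Q \<noteq> 0"
    using regular_at_nonzero_nhd[OF assms] by blast
  show ?thesis
    using f U'
    by (intro regular_atI[of V "U \<inter> U'" P d H G]) auto
qed

lemma regular_at_uminus: "regular_at V P f \<Longrightarrow> regular_at V P (\<lambda>Q. - f Q)"
  using regular_at_mult[OF regular_at_const[of P V "-1"], of f] regular_at_mem by fastforce

lemma regular_at_diff:
  "regular_at V P f \<Longrightarrow> regular_at V P g \<Longrightarrow> regular_at V P (\<lambda>Q. f Q - g Q)"
  using regular_at_add[OF _ regular_at_uminus, of V P f g] by simp

lemma regular_at_divide:
  "regular_at V P f \<Longrightarrow> regular_at V P g \<Longrightarrow> g P \<noteq> 0 \<Longrightarrow> regular_at V P (\<lambda>Q. f Q / g Q)"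
  using regular_at_mult[OF _ regular_at_inverse, of V P f g] by (simp add: divide_inverse)

lemma regular_at_power: "regular_at V P f \<Longrightarrow> regular_at V P (\<lambda>Q. f Q ^ n)"
  by (induction n) (auto intro: regular_at_const regular_at_mult regular_at_mem)

lemma regular_at_sum:
  "P \<in> V \<Longrightarrow> (\<And>i. i \<in> I \<Longrightarrow> regular_at V P (f i)) \<Longrightarrow> regular_at V P (\<lambda>Q. \<Sum>i\<in>I. f i Q)"
  by (induction I rule: infinite_finite_induct) (auto intro: regular_at_const regular_at_add)

section \<open>The filter of dense open sets\<close>

definition generic :: "'k::field proj set \<Rightarrow> 'k proj filter" where
  "generic V = (INF U\<in>{U. openin (zar V) U \<and> U \<noteq> {}}. principal U)"

text \<open>One point of regularity is enough, since it brings a nonempty open set of such points.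
  The remaining values of \<open>f\<close> are arbitrary, which is why identities between rational
  functions are stated along \<open>generic V\<close>.\<close>

definition rational :: "'k::field proj set \<Rightarrow> ('k proj \<Rightarrow> 'k) \<Rightarrow> bool" where
  "rational V f \<longleftrightarrow> (\<exists>P. regular_at V P f)"

text \<open>The class in the function field, described by eventual equality so that no domain of
  \<open>f\<close> has to be named; \<open>rat_eq\<close> identifies it with
  \<open>rat\<close>.\<close>

definition ratfun_class :: "'k::field proj set \<Rightarrow> ('k proj \<Rightarrow> 'k) \<Rightarrow> 'k ratfun" where
  "ratfun_class V f = {(U, g) \<in> rat_pairs V. \<forall>\<^sub>F P in generic V. f P = g P}"

lemma rat_pairs_iff:
  "(U, f) \<in> rat_pairs V \<longleftrightarrow> openin (zar V) U \<and> U \<noteq> {} \<and> (\<forall>P\<in>U. regular_at V P f)"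
  using regular_fun_iff[of V U f] by (auto simp: rat_pairs_def)

lemma rational_iff: "rational V f \<longleftrightarrow> (\<exists>U. (U, f) \<in> rat_pairs V)"
  unfolding rational_def rat_pairs_iff using regular_at_nhd by fastforce

lemma rationalI: "regular_at V P f \<Longrightarrow> rational V f"
  by (auto simp: rational_def)

locale irreducible_space =
  fixes V :: "'k::field proj set"
  assumes irreducible_space: "irreducible_set V"
begin

text \<open>Two disjoint nonempty open sets would have complements that cover \<open>V\<close>
  although neither contains it. This is what makes the nonempty open sets the base of a proper
  filter.\<close>

lemma open_Int_nonempty:
  assumes "openin (zar V) U" "openin (zar V) W" "U \<noteq> {}" "W \<noteq> {}"
  shows "U \<inter> W \<noteq> {}"
proof
  assume e: "U \<inter> W = {}"
  obtain S T where ST: "openin zariski S" "U = S \<inter> V" "openin zariski T" "W = T \<inter> V"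
    using assms(1,2) by (auto simp: openin_subtopology)
  have "closedin zariski (- S)" "closedin zariski (- T)"
    using ST by (auto simp: closedin_def Compl_eq_Diff_UNIV[symmetric])
  moreover have "V \<subseteq> - S \<union> - T"
    using e ST by blast
  ultimately have "V \<subseteq> - S \<or> V \<subseteq> - T"
    using irreducible_space unfolding irreducible_set_def by blast
  then show False
    using assms(3,4) ST by blast
qed

lemma nonempty: "V \<noteq> {}"
  using irreducible_space by (simp add: irreducible_set_def)

lemma eventually_generic:
  "eventually A (generic V) \<longleftrightarrow> (\<exists>U. openin (zar V) U \<and> U \<noteq> {} \<and> (\<forall>P\<in>U. A P))"
proof -
  have "eventually A (generic V) \<longleftrightarrow>
      (\<exists>U\<in>{U. openin (zar V) U \<and> U \<noteq> {}}. eventually A (principal U))"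
    unfolding generic_def
  proof (rule eventually_INF_base)
    show "{U. openin (zar V) U \<and> U \<noteq> {}} \<noteq> {}"
      using nonempty openin_zar_self by blast
  next
    fix a b
    assume "a \<in> {U. openin (zar V) U \<and> U \<noteq> {}}" "b \<in> {U. openin (zar V) U \<and> U \<noteq> {}}"
    then show "\<exists>x\<in>{U. openin (zar V) U \<and> U \<noteq> {}}. principal x \<le> inf (principal a) (principal b)"
      using open_Int_nonempty by (intro bexI[of _ "a \<inter> b"]) auto
  qed
  then show ?thesis by (auto simp: eventually_principal)
qed

lemma eventually_open: "openin (zar V) U \<Longrightarrow> P \<in> U \<Longrightarrow> (\<And>Q. Q \<in> U \<Longrightarrow> A Q) \<Longrightarrow> eventually A (generic V)"
  unfolding eventually_generic by blast

lemma eventually_mem: "\<forall>\<^sub>F P in generic V. P \<in> V"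
  using eventually_generic nonempty openin_zar_self by blast

lemma eventually_ex: "eventually A (generic V) \<Longrightarrow> \<exists>P\<in>V. A P"
  unfolding eventually_generic using openin_zar_subset by blast

lemma eventually_const_generic [simp]: "eventually (\<lambda>_. c) (generic V) \<longleftrightarrow> c"
  using eventually_ex by fastforce

lemma eventually_regular:
  assumes "rational V f"
  shows "\<forall>\<^sub>F P in generic V. regular_at V P f"
proof -
  obtain P where "regular_at V P f"
    using assms rational_def by blast
  from regular_at_nhd[OF this] show ?thesis
    by (auto intro: eventually_open)
qed

lemma eventually_nonzero:
  assumes "regular_at V P f" "f P \<noteq> 0"
  shows "\<forall>\<^sub>F Q in generic V. f Q \<noteq> 0"
  using regular_at_nonzero_nhd[OF assms] by (auto intro: eventually_open)

text \<open>The reason that rational functions form a field: a nonzero value at a single point of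
  regularity spreads to a neighbourhood, so there is no third case.\<close>

lemma rational_cases:
  assumes "rational V f"
  obtains "\<forall>\<^sub>F P in generic V. f P = 0" | "\<forall>\<^sub>F P in generic V. f P \<noteq> 0"
proof (cases "\<exists>P. regular_at V P f \<and> f P \<noteq> 0")
  case True
  then show ?thesis using that(2) eventually_nonzero by metis
next
  case False
  then have "\<forall>\<^sub>F P in generic V. f P = 0"
    by (intro eventually_mono[OF eventually_regular[OF assms]]) blast
  then show ?thesis using that(1) by blast
qed

lemma rational_not_zero:
  assumes "rational V f" "\<not> (\<forall>\<^sub>F P in generic V. f P = 0)"
  shows "\<forall>\<^sub>F P in generic V. f P \<noteq> 0"
  using rational_cases[OF assms(1)] assms(2) by blast

text \<open>The passage from generic to particular: a difference that is nonzero at \<open>P\<close>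
  would be nonzero on a neighbourhood. Identities are derived along the filter, where division is
  harmless, and then evaluated at \<open>P\<close> by this principle.\<close>

lemma regular_at_eqD:
  assumes "regular_at V P f" "regular_at V P g" "\<forall>\<^sub>F Q in generic V. f Q = g Q"
  shows "f P = g P"
proof (rule ccontr)
  assume "f P \<noteq> g P"
  then have "\<forall>\<^sub>F Q in generic V. f Q - g Q \<noteq> 0"
    using eventually_nonzero[OF regular_at_diff[OF assms(1,2)]] by simp
  with assms(3) have "\<forall>\<^sub>F Q in generic V. False"
    by eventually_elim auto
  then show False by simp
qed

lemma rational_cong:
  assumes "rational V f" "\<forall>\<^sub>F P in generic V. f P = g P"
  shows "rational V g"
proof -
  from assms(2) obtain U where U: "openin (zar V) U" "U \<noteq> {}" "\<forall>P\<in>U. f P = g P"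
    by (auto simp: eventually_generic)
  have "\<forall>\<^sub>F P in generic V. regular_at V P f \<and> P \<in> U"
    using eventually_regular[OF assms(1)] U(1,2) by (auto simp: eventually_conj_iff eventually_generic)
  then obtain P where "regular_at V P f" "P \<in> U"
    using eventually_ex by blast
  then show ?thesis
    using regular_at_cong[OF _ U(1)] U(3) rationalI by blast
qed

lemma rational_const [intro]: "rational V (\<lambda>_. c)"
  using nonempty regular_at_const rational_def by blast

lemma rational_add [intro]:
  assumes "rational V f" "rational V g"
  shows "rational V (\<lambda>P. f P + g P)"
  using eventually_ex[OF eventually_conj[OF eventually_regular[OF assms(1)] eventually_regular[OF assms(2)]]]
    regular_at_add rationalI by blast

lemma rational_mult [intro]:
  assumes "rational V f" "rational V g"
  shows "rational V (\<lambda>P. f P * g P)"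
  using eventually_ex[OF eventually_conj[OF eventually_regular[OF assms(1)] eventually_regular[OF assms(2)]]]
    regular_at_mult rationalI by blast

text \<open>Since \<open>inverse 0 = 0\<close>, the inverse of a generically zero function is again
  generically zero; this is the first case.\<close>

lemma rational_inverse [intro]:
  assumes "rational V f"
  shows "rational V (\<lambda>P. inverse (f P))"
  using assms
proof (cases rule: rational_cases)
  case 1
  then have "\<forall>\<^sub>F P in generic V. 0 = inverse (f P)"
    by eventually_elim auto
  then show ?thesis
    by (rule rational_cong[OF rational_const])
next
  case 2
  then show ?thesis
    using eventually_ex[OF eventually_conj[OF eventually_regular[OF assms(1)] 2]]
      regular_at_inverse rationalI by blast
qed

lemma rational_uminus [intro]: "rational V f \<Longrightarrow> rational V (\<lambda>P. - f P)"
  using rational_mult[OF rational_const[of "-1"], of f] by simp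

lemma rational_diff [intro]: "rational V f \<Longrightarrow> rational V g \<Longrightarrow> rational V (\<lambda>P. f P - g P)"
  using rational_add[OF _ rational_uminus, of f g] by simp

lemma rational_power: "rational V f \<Longrightarrow> rational V (\<lambda>P. f P ^ n)"
  by (induction n) auto

lemma rational_power_int: "rational V f \<Longrightarrow> rational V (\<lambda>P. f P powi n)"
  unfolding power_int_def by (cases "n \<ge> 0") (auto intro: rational_power)

text \<open>By the identity principle, agreement on the whole overlap of the domains, as
  \<open>rat_rel\<close> demands, is no stronger than generic agreement.\<close>

lemma rat_pairs_eq_iff:
  assumes "(U, f) \<in> rat_pairs V" "(U', g) \<in> rat_pairs V"
  shows "(\<forall>P\<in>U \<inter> U'. f P = g P) \<longleftrightarrow> (\<forall>\<^sub>F P in generic V. f P = g P)"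
proof
  assume "\<forall>P\<in>U \<inter> U'. f P = g P"
  moreover have "openin (zar V) (U \<inter> U')" "U \<inter> U' \<noteq> {}"
    using assms open_Int_nonempty by (auto simp: rat_pairs_iff)
  ultimately show "\<forall>\<^sub>F P in generic V. f P = g P"
    using eventually_generic by blast
next
  assume "\<forall>\<^sub>F P in generic V. f P = g P"
  then show "\<forall>P\<in>U \<inter> U'. f P = g P"
    using assms regular_at_eqD by (auto simp: rat_pairs_iff)
qed

lemma rat_eq: "(U, f) \<in> rat_pairs V \<Longrightarrow> rat V U f = ratfun_class V f"
  unfolding rat_def ratfun_class_def rat_rel_def using rat_pairs_eq_iff by fastforce

lemma ratfun_class_eq_iff:
  assumes "rational V f"
  shows "ratfun_class V f = ratfun_class V g \<longleftrightarrow> (\<forall>\<^sub>F P in generic V. f P = g P)"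
proof
  assume e: "ratfun_class V f = ratfun_class V g"
  obtain U where "(U, f) \<in> rat_pairs V"
    using assms rational_iff by blast
  then have "(U, f) \<in> ratfun_class V f"
    by (auto simp: ratfun_class_def)
  then have "\<forall>\<^sub>F P in generic V. g P = f P"
    using e by (auto simp: ratfun_class_def)
  then show "\<forall>\<^sub>F P in generic V. f P = g P"
    by eventually_elim auto
next
  assume e: "\<forall>\<^sub>F P in generic V. f P = g P"
  have "(\<forall>\<^sub>F P in generic V. f P = h P) \<longleftrightarrow> (\<forall>\<^sub>F P in generic V. g P = h P)" for h
    by (rule eventually_cong[OF e]) auto
  then show "ratfun_class V f = ratfun_class V g"
    by (simp add: ratfun_class_def)
qed

lemma ratfun_class_eqI:
  "rational V f \<Longrightarrow> \<forall>\<^sub>F P in generic V. f P = g P \<Longrightarrow> ratfun_class V f = ratfun_class V g"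
  using ratfun_class_eq_iff by blast

lemma mem_ratfun_class:
  "(U, g) \<in> ratfun_class V f \<longleftrightarrow> (U, g) \<in> rat_pairs V \<and> (\<forall>\<^sub>F P in generic V. f P = g P)"
  by (auto simp: ratfun_class_def)

lemma ratfun_class_nonempty: "rational V f \<Longrightarrow> \<exists>U. (U, f) \<in> ratfun_class V f"
  by (auto simp: ratfun_class_def rational_iff)

text \<open>The operations of \<open>function_field\<close> are unions over all representatives.
  Once each representative gives the same class, and there is at least one, the union is that
  class.\<close>

lemma UN_ratfun_class:
  assumes "rational V f" "\<And>U g. (U, g) \<in> ratfun_class V f \<Longrightarrow> F U g = c"
  shows "(\<Union>(U, g)\<in>ratfun_class V f. F U g) = c"
  using ratfun_class_nonempty[OF assms(1)] assms(2) by (fastforce simp: split_beta)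

lemma carrier_function_field: "carrier (function_field V) = ratfun_class V ` {f. rational V f}"
  unfolding function_field_def quotient_def
proof -
  have "(\<Union>x\<in>rat_pairs V. {rat_rel V `` {x}}) = ratfun_class V ` {f. rational V f}"
    using rat_eq[unfolded rat_def] by (fastforce simp: rational_iff image_iff)
  then show "carrier \<lparr>carrier = \<Union>x\<in>rat_pairs V. {rat_rel V `` {x}},
       monoid.mult = (\<lambda>a b. \<Union>(U, f)\<in>a. \<Union>(U', f')\<in>b. rat V (U \<inter> U') (\<lambda>P. f P * f' P)),
       monoid.one = rat V V (\<lambda>_. 1),
       ring.zero = rat V V (\<lambda>_. 0),
       ring.add = (\<lambda>a b. \<Union>(U, f)\<in>a. \<Union>(U', f')\<in>b. rat V (U \<inter> U') (\<lambda>P. f P + f' P))\<rparr>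
     = ratfun_class V ` {f. rational V f}" by simp
qed

lemma ratfun_mult:
  assumes "rational V f" "rational V g"
  shows "ratfun_class V f \<otimes>\<^bsub>function_field V\<^esub> ratfun_class V g = ratfun_class V (\<lambda>P. f P * g P)"
proof -
  have *: "rat V (U \<inter> U') (\<lambda>P. f' P * g' P) = ratfun_class V (\<lambda>P. f P * g P)"
    if "(U, f') \<in> ratfun_class V f" "(U', g') \<in> ratfun_class V g" for U f' U' g'
  proof -
    have "(U \<inter> U', \<lambda>P. f' P * g' P) \<in> rat_pairs V"
      using that open_Int_nonempty by (auto simp: mem_ratfun_class rat_pairs_iff intro: regular_at_mult)
    moreover have "\<forall>\<^sub>F P in generic V. f P = f' P" "\<forall>\<^sub>F P in generic V. g P = g' P"
      using that by (auto simp: mem_ratfun_class)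
    then have "\<forall>\<^sub>F P in generic V. f P * g P = f' P * g' P"
      by eventually_elim auto
    ultimately show ?thesis
      using rat_eq ratfun_class_eqI[OF rational_mult[OF assms]] by simp
  qed
  show ?thesis
    unfolding function_field_def monoid.simps
    by (rule UN_ratfun_class[OF assms(1)], rule UN_ratfun_class[OF assms(2)]) (rule *)
qed

lemma ratfun_add:
  assumes "rational V f" "rational V g"
  shows "ratfun_class V f \<oplus>\<^bsub>function_field V\<^esub> ratfun_class V g = ratfun_class V (\<lambda>P. f P + g P)"
proof -
  have *: "rat V (U \<inter> U') (\<lambda>P. f' P + g' P) = ratfun_class V (\<lambda>P. f P + g P)"
    if "(U, f') \<in> ratfun_class V f" "(U', g') \<in> ratfun_class V g" for U f' U' g'
  proof -
    have "(U \<inter> U', \<lambda>P. f' P + g' P) \<in> rat_pairs V"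
      using that open_Int_nonempty by (auto simp: mem_ratfun_class rat_pairs_iff intro: regular_at_add)
    moreover have "\<forall>\<^sub>F P in generic V. f P = f' P" "\<forall>\<^sub>F P in generic V. g P = g' P"
      using that by (auto simp: mem_ratfun_class)
    then have "\<forall>\<^sub>F P in generic V. f P + g P = f' P + g' P"
      by eventually_elim auto
    ultimately show ?thesis
      using rat_eq ratfun_class_eqI[OF rational_add[OF assms]] by simp
  qed
  show ?thesis
    unfolding function_field_def ring.simps
    by (rule UN_ratfun_class[OF assms(1)], rule UN_ratfun_class[OF assms(2)]) (rule *)
qed

lemma rat_const: "rat V V (\<lambda>_. c) = ratfun_class V (\<lambda>_. c)"
  by (rule rat_eq) (use nonempty in \<open>auto simp: rat_pairs_iff regular_at_const\<close>)

lemma ratfun_one: "\<one>\<^bsub>function_field V\<^esub> = ratfun_class V (\<lambda>_. 1)"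
  unfolding function_field_def by (simp add: rat_const)

lemma ratfun_zero: "\<zero>\<^bsub>function_field V\<^esub> = ratfun_class V (\<lambda>_. 0)"
  unfolding function_field_def by (simp add: rat_const)

lemma ratfun_eq_zero_iff:
  "rational V f \<Longrightarrow> ratfun_class V f = \<zero>\<^bsub>function_field V\<^esub> \<longleftrightarrow> (\<forall>\<^sub>F P in generic V. f P = 0)"
  by (simp add: ratfun_zero ratfun_class_eq_iff)

lemma rat_regular: "P \<in> U \<Longrightarrow> (U, f) \<in> rat_pairs V \<Longrightarrow> rat V U f = ratfun_class V f \<and> regular_at V P f"
  by (auto simp: rat_eq rat_pairs_iff)

lemma regular_rat: "regular_at V P f \<Longrightarrow> \<exists>U. (U, f) \<in> rat_pairs V \<and> P \<in> U \<and> rat V U f = ratfun_class V f"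
  using regular_at_nhd rat_eq unfolding rat_pairs_iff by (metis empty_iff)

lemma carrier_local_ring: "carrier (local_ring V P) = ratfun_class V ` {f. regular_at V P f}"
proof -
  have "{rat V U f |U f. (U, f) \<in> rat_pairs V \<and> P \<in> U} = ratfun_class V ` {f. regular_at V P f}"
    using rat_regular regular_rat by (fastforce simp: image_iff)
  then show ?thesis by (simp add: local_ring_def)
qed

lemma max_ideal_eq: "max_ideal V P = ratfun_class V ` {f. regular_at V P f \<and> f P = 0}"
  unfolding max_ideal_def using rat_regular regular_rat by (fastforce simp: image_iff)

lemma local_ring_simps [simp]:
  "monoid.mult (local_ring V P) = monoid.mult (function_field V)"
  "ring.add (local_ring V P) = ring.add (function_field V)"
  "monoid.one (local_ring V P) = monoid.one (function_field V)"
  "ring.zero (local_ring V P) = ring.zero (function_field V)"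
  by (simp_all add: local_ring_def)

end

section \<open>Commutative algebra\<close>

text \<open>In a finite field the product \<open>q\<close> of all \<open>X - a\<close> vanishes
  everywhere, so \<open>1 + q\<close> has positive degree and no root.\<close>

lemma infinite_UNIV_alg_closed: "infinite (UNIV :: 'k::alg_closed_field set)"
proof
  assume fin: "finite (UNIV :: 'k set)"
  define q :: "'k poly" where "q = (\<Prod>a\<in>UNIV. [:-a, 1:])"
  have "Polynomial.degree q = card (UNIV :: 'k set)"
    unfolding q_def by (subst degree_prod_sum_eq) auto
  moreover have "card (UNIV :: 'k set) > 0"
    using fin by (simp add: card_gt_0_iff)
  ultimately have "Polynomial.degree (1 + q) > 0"
    by (simp add: degree_add_eq_right)
  then obtain x where "poly (1 + q) x = 0"
    using alg_closed_imp_poly_has_root by blast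
  moreover have "poly q x = 0"
    unfolding q_def using fin by (simp add: poly_prod) 
  ultimately show False by simp
qed

lemma exists_avoiding:
  fixes F :: "'k::alg_closed_field set"
  assumes "finite F"
  shows "\<exists>c. c \<notin> F"
  using assms infinite_UNIV_alg_closed by (meson ex_new_if_finite)

text \<open>Leading coefficient of the Lagrange interpolation polynomial of \<open>x\<^sup>k\<close>.\<close>

lemma sum_power_div_differences:
  fixes T :: "'k::field set"
  assumes "finite T" "card T = Suc e" "k \<le> e"
  shows "(\<Sum>x\<in>T. x ^ k * (\<Prod>y\<in>T - {x}. inverse (x - y))) = (if k = e then 1 else 0)"
proof -
  define N where "N x = (\<Prod>y\<in>T - {x}. [:-y, 1:])" for x
  define q where "q = (\<Sum>x\<in>T. Polynomial.smult (x ^ k * (\<Prod>y\<in>T - {x}. inverse (x - y))) (N x))"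
  have degN: "Polynomial.degree (N x) = e" if "x \<in> T" for x
    unfolding N_def using assms that by (subst degree_prod_sum_eq) auto
  have "Polynomial.lead_coeff (N x) = 1" for x
    unfolding N_def by (simp add: lead_coeff_prod)
  then have coeffN: "Polynomial.coeff (N x) e = 1" if "x \<in> T" for x
    using degN[OF that] by metis
  have deg: "Polynomial.degree q \<le> e"
    unfolding q_def by (rule degree_sum_le) (use assms degN in \<open>auto intro: order.trans[OF degree_smult_le]\<close>)
  have "poly q z = poly (Polynomial.monom 1 k) z" if z: "z \<in> T" for z
  proof -
    have "poly (N x) z = 0" if "x \<in> T" "x \<noteq> z" for x
      unfolding N_def using assms z that by (auto simp: poly_prod)
    then have "poly q z = (\<Sum>x\<in>T. if x = z then x ^ k * (\<Prod>y\<in>T - {x}. inverse (x - y)) * poly (N x) z else 0)"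
      unfolding q_def by (auto simp: poly_sum intro!: sum.cong)
    also have "\<dots> = z ^ k * (\<Prod>y\<in>T - {z}. inverse (z - y)) * poly (N z) z"
      using z assms by simp
    also have "poly (N z) z = (\<Prod>y\<in>T - {z}. z - y)"
      unfolding N_def by (simp add: poly_prod)
    also have "z ^ k * (\<Prod>y\<in>T - {z}. inverse (z - y)) * (\<Prod>y\<in>T - {z}. z - y) = z ^ k"
      by (auto simp: mult.assoc simp flip: prod.distrib intro!: prod.neutral)
    finally show ?thesis by (simp add: poly_monom)
  qed
  then have "q = Polynomial.monom 1 k"
    by (rule poly_eqI_degree[of T]) (use deg assms in \<open>auto simp: degree_monom_eq\<close>)
  then have "Polynomial.coeff q e = (if k = e then 1 else 0)" by simp
  moreover have "Polynomial.coeff q e = (\<Sum>x\<in>T. x ^ k * (\<Prod>y\<in>T - {x}. inverse (x - y)))"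
    unfolding q_def by (auto simp: coeff_sum coeffN intro!: sum.cong)
  ultimately show ?thesis by simp
qed

section \<open>Noetherian subrings and Hilbert's basis theorem\<close>

definition subring_set :: "'a::comm_ring_1 set \<Rightarrow> bool" where
  "subring_set R \<longleftrightarrow> 1 \<in> R \<and> (\<forall>a\<in>R. \<forall>b\<in>R. a - b \<in> R \<and> a * b \<in> R)"

lemma subring_set_closed:
  assumes "subring_set R"
  shows "1 \<in> R" "0 \<in> R" "a \<in> R \<Longrightarrow> b \<in> R \<Longrightarrow> a - b \<in> R" "a \<in> R \<Longrightarrow> b \<in> R \<Longrightarrow> a * b \<in> R"
    "a \<in> R \<Longrightarrow> - a \<in> R" "a \<in> R \<Longrightarrow> b \<in> R \<Longrightarrow> a + b \<in> R"
proof -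
  show 1: "1 \<in> R" and d: "\<And>a b. a \<in> R \<Longrightarrow> b \<in> R \<Longrightarrow> a - b \<in> R"
    and "\<And>a b. a \<in> R \<Longrightarrow> b \<in> R \<Longrightarrow> a * b \<in> R"
    using assms by (auto simp: subring_set_def)
  show 0: "0 \<in> R" using d[OF 1 1] by simp
  show m: "\<And>a. a \<in> R \<Longrightarrow> - a \<in> R" using d[OF 0] by fastforce
  show "\<And>a b. a \<in> R \<Longrightarrow> b \<in> R \<Longrightarrow> a + b \<in> R" using d[OF _ m] by fastforce
qed

lemma subring_set_sum:
  "subring_set R \<Longrightarrow> (\<And>i. i \<in> I \<Longrightarrow> f i \<in> R) \<Longrightarrow> sum f I \<in> R"
  by (induction I rule: infinite_finite_induct) (auto simp: subring_set_closed)

lemma subring_set_prod: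
  "subring_set R \<Longrightarrow> (\<And>i. i \<in> I \<Longrightarrow> f i \<in> R) \<Longrightarrow> prod f I \<in> R"
  by (induction I rule: infinite_finite_induct) (auto simp: subring_set_closed)

lemma subring_set_power:
  "subring_set R \<Longrightarrow> a \<in> R \<Longrightarrow> a ^ n \<in> R"
  by (induction n) (auto simp: subring_set_closed)

definition initial_span :: "'a::comm_ring_1 set \<Rightarrow> (nat \<Rightarrow> 'a) \<Rightarrow> nat \<Rightarrow> 'a set" where
  "initial_span R s m = {(\<Sum>i<m. r i * s i) |r. \<forall>i<m. r i \<in> R}"

text \<open>The ascending chain condition, for the ideals spanned by initial segments of a sequence.\<close>

definition noetherian :: "'a::comm_ring_1 set \<Rightarrow> bool" where
  "noetherian R \<longleftrightarrow> (\<forall>s. range s \<subseteq> R \<longrightarrow> (\<exists>m. s m \<in> initial_span R s m))"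

lemma initial_span_add:
  assumes "subring_set R" "a \<in> initial_span R s m" "b \<in> initial_span R s m"
  shows "a + b \<in> initial_span R s m"
proof -
  obtain r r' where "\<forall>i<m. r i \<in> R" "a = (\<Sum>i<m. r i * s i)"
    "\<forall>i<m. r' i \<in> R" "b = (\<Sum>i<m. r' i * s i)"
    using assms(2,3) by (auto simp: initial_span_def)
  then show ?thesis
    unfolding initial_span_def using subring_set_closed(6)[OF assms(1)]
    by (intro CollectI exI[of _ "\<lambda>i. r i + r' i"]) (auto simp: distrib_right sum.distrib)
qed

lemma initial_span_mult:
  assumes "subring_set R" "c \<in> R" "a \<in> initial_span R s m"
  shows "c * a \<in> initial_span R s m"
proof -
  obtain r where "\<forall>i<m. r i \<in> R" "a = (\<Sum>i<m. r i * s i)"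
    using assms(3) by (auto simp: initial_span_def)
  then show ?thesis
    unfolding initial_span_def using subring_set_closed(4)[OF assms(1,2)]
    by (intro CollectI exI[of _ "\<lambda>i. c * r i"]) (auto simp: sum_distrib_left mult.assoc)
qed

lemma initial_span_mono:
  assumes "subring_set R" "m \<le> m'"
  shows "initial_span R s m \<subseteq> initial_span R s m'"
proof
  fix a assume "a \<in> initial_span R s m"
  then obtain r where r: "\<forall>i<m. r i \<in> R" "a = (\<Sum>i<m. r i * s i)"
    by (auto simp: initial_span_def)
  have "a = (\<Sum>i<m'. (if i < m then r i else 0) * s i)"
    unfolding r(2) using assms(2) by (intro sum.mono_neutral_cong_left) auto
  moreover have "\<forall>i<m'. (if i < m then r i else 0) \<in> R"
    using r subring_set_closed(2)[OF assms(1)] by auto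
  ultimately show "a \<in> initial_span R s m'"
    unfolding initial_span_def by (intro CollectI exI[of _ "\<lambda>i. if i < m then r i else 0"]) auto
qed

lemma initial_span_member:
  assumes "subring_set R" "i < m"
  shows "s i \<in> initial_span R s m"
proof -
  have "s i = (\<Sum>j<m. (if j = i then 1 else 0) * s j)"
    using assms(2) by (simp add: if_distrib[of "\<lambda>x. x * _"] cong: if_cong)
  then show ?thesis
    unfolding initial_span_def using subring_set_closed(1,2)[OF assms(1)]
    by (intro CollectI exI[of _ "\<lambda>j. if j = i then 1 else 0"]) auto
qed

lemma initial_span_sum:
  assumes "subring_set R" "\<And>i. i \<in> I \<Longrightarrow> f i \<in> initial_span R s m"
  shows "sum f I \<in> initial_span R s m"
proof -
  have "0 \<in> initial_span R s m"
    unfolding initial_span_def using subring_set_closed(2)[OF assms(1)]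
    by (intro CollectI exI[of _ "\<lambda>_. 0"]) auto
  then show ?thesis
    using assms(2)
    by (induction I rule: infinite_finite_induct) (auto intro: initial_span_add[OF assms(1)])
qed

text \<open>The ring R[x] inside the ambient ring. The element \<open>x\<close> may satisfy
  algebraic relations over \<open>R\<close>, so different polynomials can have the same
  value.\<close>

definition adjoin :: "'a::comm_ring_1 set \<Rightarrow> 'a \<Rightarrow> 'a set" where
  "adjoin R x = {poly p x |p. \<forall>i. Polynomial.coeff p i \<in> R}"

lemma subring_set_adjoin:
  assumes "subring_set R"
  shows "subring_set (adjoin R x)"
  unfolding subring_set_def
proof (intro conjI ballI)
  show "1 \<in> adjoin R x"
    unfolding adjoin_def using subring_set_closed(1,2)[OF assms]
    by (intro CollectI exI[of _ 1]) (auto simp: coeff_1)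
  fix a b assume "a \<in> adjoin R x" "b \<in> adjoin R x"
  then obtain p q where pq: "a = poly p x" "b = poly q x" "\<forall>i. Polynomial.coeff p i \<in> R" "\<forall>i. Polynomial.coeff q i \<in> R"
    by (auto simp: adjoin_def)
  then show "a - b \<in> adjoin R x"
    unfolding adjoin_def using subring_set_closed(3)[OF assms]
    by (intro CollectI exI[of _ "p - q"]) auto
  have "Polynomial.coeff (p * q) i \<in> R" for i
    unfolding coeff_mult using pq subring_set_closed(4)[OF assms]
    by (intro subring_set_sum[OF assms]) auto
  then show "a * b \<in> adjoin R x"
    unfolding adjoin_def using pq by (intro CollectI exI[of _ "p * q"]) auto
qed

lemma adjoin_superset: "subring_set R \<Longrightarrow> R \<subseteq> adjoin R x"
  unfolding adjoin_def using subring_set_closed(2)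
  by (auto simp: coeff_pCons split: nat.splits intro!: exI[of _ "[:_:]"])

lemma adjoin_generator: "subring_set R \<Longrightarrow> x \<in> adjoin R x"
  unfolding adjoin_def using subring_set_closed(1,2)
  by (auto simp: coeff_pCons split: nat.splits intro!: exI[of _ "[:0, 1:]"])

text \<open>Hilbert's basis theorem, with the usual choice of least degree made for values at
  \<open>x\<close>: \<open>f k\<close> has least degree among the polynomials whose value lies in
  the ideal but outside the span of the earlier values. A relation among the leading coefficients
  then produces a polynomial that contradicts minimality.\<close>

theorem noetherian_adjoin:
  fixes R :: "'a::comm_ring_1 set"
  assumes R: "subring_set R" and noeth: "noetherian R"
  shows "noetherian (adjoin R x)"
  unfolding noetherian_def
proof (intro allI impI, rule ccontr)
  define A where "A = adjoin R x"
  have A: "subring_set A" "R \<subseteq> A" "x \<in> A"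
    using R by (simp_all add: A_def subring_set_adjoin adjoin_superset adjoin_generator)
  define Pol where "Pol = {p. \<forall>i. Polynomial.coeff p i \<in> R}"
  fix s assume s: "range s \<subseteq> adjoin R x" and "\<not> (\<exists>m. s m \<in> initial_span (adjoin R x) s m)"
  then have not_span: "\<And>m. s m \<notin> initial_span A s m"
    by (auto simp: A_def)
  \<comment> \<open>The ideal generated by the whole sequence, as an ascending union none of whose
    stages exhausts it.\<close>
  define I where "I = (\<Union>m. initial_span A s m)"
  have I_finite: "\<exists>M. \<forall>i<k. g i \<in> initial_span A s M" if "\<forall>i<k. g i \<in> I" for k :: nat and g
    using that
  proof (induction k)
    case (Suc k)
    then obtain M M' where "\<forall>i<k. g i \<in> initial_span A s M" "g k \<in> initial_span A s M'"
      by (auto simp: I_def)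
    then have "\<forall>i<Suc k. g i \<in> initial_span A s (max M M')"
      using initial_span_mono[OF A(1), of M "max M M'" s] initial_span_mono[OF A(1), of M' "max M M'" s]
      by (auto simp: less_Suc_eq)
    then show ?case by blast
  qed simp
  have I_add: "a + b \<in> I" if "a \<in> I" "b \<in> I" for a b
  proof -
    have "\<forall>i<2. (if i = (0::nat) then a else b) \<in> I"
      using that by simp
    from I_finite[of 2 "\<lambda>i. if i = 0 then a else b", OF this]
    obtain M where M: "\<forall>i<2::nat. (if i = 0 then a else b) \<in> initial_span A s M" by blast
    have "a \<in> initial_span A s M" using M[rule_format, of 0] by simp
    moreover have "b \<in> initial_span A s M" using M[rule_format, of 1] by simp
    ultimately show ?thesis using initial_span_add[OF A(1)] unfolding I_def by blast
  qed
  have I_mult: "c * a \<in> I" if "c \<in> A" "a \<in> I" for a c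
    using that initial_span_mult[OF A(1)] unfolding I_def by blast
  define Sp where "Sp f k = initial_span A (\<lambda>i. poly (f i) x) k" for f :: "nat \<Rightarrow> 'a poly" and k
  have "\<exists>f. \<forall>k. f k \<in> Pol \<and> poly (f k) x \<in> I \<and> poly (f k) x \<notin> Sp f k \<and>
      (\<forall>q\<in>Pol. poly q x \<in> I \<and> poly q x \<notin> Sp f k \<longrightarrow> Polynomial.degree (f k) \<le> Polynomial.degree q)"
  proof (rule dependent_wellorder_choice)
    fix r and f g :: "nat \<Rightarrow> 'a poly" and k
    assume "\<And>y. y < k \<Longrightarrow> f y = g y"
    then have "(\<Sum>i<k. r i * poly (f i) x) = (\<Sum>i<k. r i * poly (g i) x)" for r
      by (intro sum.cong) auto
    then have "Sp f k = Sp g k"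
      by (simp add: Sp_def initial_span_def)
    then show "(r \<in> Pol \<and> poly r x \<in> I \<and> poly r x \<notin> Sp f k \<and>
        (\<forall>q\<in>Pol. poly q x \<in> I \<and> poly q x \<notin> Sp f k \<longrightarrow> Polynomial.degree r \<le> Polynomial.degree q)) =
      (r \<in> Pol \<and> poly r x \<in> I \<and> poly r x \<notin> Sp g k \<and>
        (\<forall>q\<in>Pol. poly q x \<in> I \<and> poly q x \<notin> Sp g k \<longrightarrow> Polynomial.degree r \<le> Polynomial.degree q))"
      by simp
  next
    fix k and f :: "nat \<Rightarrow> 'a poly"
    assume IH: "\<And>y. y < k \<Longrightarrow> f y \<in> Pol \<and> poly (f y) x \<in> I \<and> poly (f y) x \<notin> Sp f y \<and>
      (\<forall>q\<in>Pol. poly q x \<in> I \<and> poly q x \<notin> Sp f y \<longrightarrow> Polynomial.degree (f y) \<le> Polynomial.degree q)"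
    \<comment> \<open>The earlier values lie in one stage \<open>M\<close>, so \<open>s M\<close>
      belongs to \<open>I\<close> but not to their span: a candidate for the next polynomial
      exists.\<close>
    then obtain M where M: "\<forall>i<k. poly (f i) x \<in> initial_span A s M"
      using I_finite[of k "\<lambda>i. poly (f i) x"] by auto
    have sub: "Sp f k \<subseteq> initial_span A s M"
    proof
      fix a assume "a \<in> Sp f k"
      then obtain r where "\<forall>i<k. r i \<in> A" "a = (\<Sum>i<k. r i * poly (f i) x)"
        by (auto simp: Sp_def initial_span_def)
      then show "a \<in> initial_span A s M"
        using M by (auto intro!: initial_span_sum[OF A(1)] initial_span_mult[OF A(1)])
    qed
    obtain q where q: "q \<in> Pol" "poly q x = s M"
      using s by (auto simp: adjoin_def Pol_def image_subset_iff) metis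
    have "s M \<in> I"
      using initial_span_member[OF A(1), of M "Suc M"] by (auto simp: I_def)
    moreover have "s M \<notin> Sp f k"
      using not_span sub by blast
    ultimately have "q \<in> Pol \<and> poly q x \<in> I \<and> poly q x \<notin> Sp f k"
      using q by simp
    from ex_has_least_nat[of "\<lambda>q. q \<in> Pol \<and> poly q x \<in> I \<and> poly q x \<notin> Sp f k", OF this, of Polynomial.degree]
    show "\<exists>r. r \<in> Pol \<and> poly r x \<in> I \<and> poly r x \<notin> Sp f k \<and>
        (\<forall>q\<in>Pol. poly q x \<in> I \<and> poly q x \<notin> Sp f k \<longrightarrow> Polynomial.degree r \<le> Polynomial.degree q)"
      by blast
  qed
  then obtain f where f: "\<And>k. f k \<in> Pol" "\<And>k. poly (f k) x \<in> I" "\<And>k. poly (f k) x \<notin> Sp f k"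
    and f_min: "\<And>k q. q \<in> Pol \<Longrightarrow> poly q x \<in> I \<Longrightarrow> poly q x \<notin> Sp f k \<Longrightarrow> Polynomial.degree (f k) \<le> Polynomial.degree q"
    by blast
  have "range (\<lambda>k. Polynomial.lead_coeff (f k)) \<subseteq> R"
    using f(1) by (auto simp: Pol_def)
  then obtain m r where r: "\<And>i. i < m \<Longrightarrow> r i \<in> R"
    "Polynomial.lead_coeff (f m) = (\<Sum>i<m. r i * Polynomial.lead_coeff (f i))"
    using noeth unfolding noetherian_def initial_span_def by blast
  have deg_mono: "Polynomial.degree (f i) \<le> Polynomial.degree (f m)" if "i < m" for i
    using initial_span_mono[OF A(1), of i m] that f(3)[of m] by (intro f_min f) (auto simp: Sp_def)
  \<comment> \<open>The monomial lifts \<open>f i\<close> to the degree of \<open>f m\<close>. The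
    subtraction of degrees is not truncated, because the degrees of the chosen polynomials increase
    (\<open>deg_mono\<close>).\<close>
  define h where "h i = Polynomial.monom (r i) (Polynomial.degree (f m) - Polynomial.degree (f i)) * f i" for i
  define g where "g = f m - (\<Sum>i<m. h i)"
  have h_Pol: "Polynomial.coeff (h i) j \<in> R" if "i < m" for i j
    using f(1)[of i] r(1)[OF that] subring_set_closed(2,4)[OF R] by (auto simp: h_def coeff_monom_mult Pol_def)
  then have g_Pol: "g \<in> Pol"
    using f(1)[of m] by (auto simp: g_def Pol_def coeff_sum intro!: subring_set_closed(3)[OF R] subring_set_sum[OF R])
  define c where "c i = r i * x ^ (Polynomial.degree (f m) - Polynomial.degree (f i))" for i
  have c: "c i \<in> A" if "i < m" for i
    using A r(1)[OF that] by (auto simp: c_def intro!: subring_set_closed(4) subring_set_power)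
  have poly_g: "poly g x = poly (f m) x - (\<Sum>i<m. c i * poly (f i) x)"
    by (simp add: g_def h_def c_def poly_sum poly_monom)
  have neg: "- (\<Sum>i<m. c i * poly (f i) x) = (\<Sum>i<m. (- c i) * poly (f i) x)"
    by (simp add: sum_negf)
  have "\<exists>M. \<forall>i<m. poly (f i) x \<in> initial_span A s M"
    using f(2) by (intro I_finite) auto
  then have sum_I: "- (\<Sum>i<m. c i * poly (f i) x) \<in> I"
    unfolding neg I_def using c subring_set_closed(5)[OF A(1)]
    by (blast intro: initial_span_sum[OF A(1)] initial_span_mult[OF A(1)])
  then have g_I: "poly g x \<in> I"
    using I_add[OF f(2)[of m] sum_I] by (simp add: poly_g)
  have sum_Sp: "(\<Sum>i<m. c i * poly (f i) x) \<in> Sp f m"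
    using c by (auto simp: Sp_def initial_span_def)
  have g_Sp: "poly g x \<notin> Sp f m"
  proof
    assume "poly g x \<in> Sp f m"
    then have "poly g x + (\<Sum>i<m. c i * poly (f i) x) \<in> Sp f m"
      using sum_Sp initial_span_add[OF A(1)] by (auto simp: Sp_def)
    then show False using f(3)[of m] by (simp add: poly_g)
  qed
  have "Polynomial.coeff (h i) (Polynomial.degree (f m)) = r i * Polynomial.lead_coeff (f i)" if "i < m" for i
    using deg_mono[OF that] by (simp add: h_def coeff_monom_mult)
  then have coeff_g: "Polynomial.coeff g (Polynomial.degree (f m)) = 0"
    using r(2) by (simp add: g_def coeff_sum)
  have "Polynomial.degree (h i) \<le> Polynomial.degree (f m)" if "i < m" for i
    unfolding h_def using deg_mono[OF that] degree_mult_le[of "Polynomial.monom (r i) (Polynomial.degree (f m) - Polynomial.degree (f i))" "f i"]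
      degree_monom_le[of "r i" "Polynomial.degree (f m) - Polynomial.degree (f i)"] by linarith
  then have "Polynomial.degree g \<le> Polynomial.degree (f m)"
    unfolding g_def by (intro degree_diff_le degree_sum_le) auto
  moreover have "Polynomial.degree (f m) \<le> Polynomial.degree g"
    using f_min[OF g_Pol g_I g_Sp] .
  \<comment> \<open>Minimality forces \<open>g\<close> to have the degree of \<open>f m\<close>,
    exactly where its coefficient was cancelled. Hence \<open>g = 0\<close>, and the value
    \<open>0\<close> lies in every span. This also covers a constant \<open>f m\<close>.\<close>
  ultimately have "Polynomial.lead_coeff g = 0" using coeff_g by simp
  then have "poly g x = 0" by simp
  moreover have "0 \<in> Sp f m"
    using initial_span_sum[OF A(1), of "{}" "\<lambda>_. 0"] by (simp add: Sp_def)
  ultimately show False using g_Sp by simp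
qed

section \<open>Homogeneous coordinates\<close>

lemma coords_rel:
  "finite {i. coords P i \<noteq> 0} \<and> (\<exists>i. coords P i \<noteq> 0)"
  using Quotient3_rep_reflp[OF Quotient3_proj, of P] by (simp add: coords_def)

lemma coords_nonzero: "\<exists>i. coords P i \<noteq> 0"
  using coords_rel by blast

lemma coords_eqI:
  assumes "c \<noteq> 0" "\<And>i. coords Q i = c * coords P i"
  shows "P = Q"
proof -
  have "rep_proj Q = (\<lambda>i. c * rep_proj P i)"
    using assms(2) by (auto simp: coords_def)
  then show ?thesis
    using Quotient3_rel_rep[OF Quotient3_proj, of P Q] coords_rel[of P] assms(1)
    by (auto simp: coords_def)
qed

definition variable :: "nat \<Rightarrow> 'k::field mpol" where
  "variable i = Poly_Mapping.single (Poly_Mapping.single i 1) 1"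

lemma meval_variable [simp]: "meval v (variable i) = v i"
  by (simp add: variable_def meval_single mon_eval_def)

lemma homogeneous_variable: "homogeneous 1 (variable i)"
  using homogeneous_single[of "Poly_Mapping.single i 1"] by (simp add: variable_def mon_deg_def)

lemma homogeneous_scale: "homogeneous d F \<Longrightarrow> homogeneous d (Poly_Mapping.single 0 c * F)"
  using homogeneous_mult[OF homogeneous_const, of d F c] by simp

lemma mon_eval_scale: "mon_eval (\<lambda>i. c * v i) m = c ^ mon_deg m * mon_eval v m"
  by (simp add: mon_eval_def mon_deg_def power_mult_distrib prod.distrib power_sum)

lemma meval_scale:
  assumes "homogeneous d F"
  shows "meval (\<lambda>i. c * v i) F = c ^ d * meval v F"
  using assms by (auto simp: meval_def homogeneous_def mon_eval_scale sum_distrib_left mult_ac intro!: sum.cong)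

text \<open>Coordinates in the chart where the linear form \<open>L\<close> is nonzero. A general
  \<open>L\<close> is allowed so that one chart can contain any given finite set of points.\<close>

definition affine_coords :: "'k::field mpol \<Rightarrow> 'k proj \<Rightarrow> nat \<Rightarrow> 'k" where
  "affine_coords L R i = coords R i / meval (coords R) L"

lemma meval_affine_coords:
  assumes "homogeneous d F"
  shows "meval (affine_coords L R) F = meval (coords R) F / meval (coords R) L ^ d"
proof -
  have "affine_coords L R = (\<lambda>i. inverse (meval (coords R) L) * coords R i)"
    by (simp add: affine_coords_def fun_eq_iff divide_inverse_commute)
  then show ?thesis
    using meval_scale[OF assms, of "inverse (meval (coords R) L)" "coords R"]
    by (simp add: power_inverse divide_inverse_commute)
qed

lemma regular_affine_coords:
  assumes "P \<in> V" "homogeneous 1 L" "meval (coords P) L \<noteq> 0"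
  shows "regular_at V P (\<lambda>R. affine_coords L R i)"
  using regular_at_quotient[OF assms(1) homogeneous_variable assms(2,3), of i]
  by (simp add: affine_coords_def)

text \<open>Numerator and denominator are forms of the same degree, so passing to the chart divides
  both by the same power of \<open>L\<close> and leaves their quotient unchanged.\<close>

lemma regular_at_affine_fraction:
  assumes "regular_at V P f" "homogeneous 1 L" "meval (coords P) L \<noteq> 0"
  obtains U G H where "openin (zar V) U" "P \<in> U" "\<And>Q. Q \<in> U \<Longrightarrow> meval (coords Q) L \<noteq> 0"
    "\<And>Q. Q \<in> U \<Longrightarrow> meval (affine_coords L Q) H \<noteq> 0"
    "\<And>Q. Q \<in> U \<Longrightarrow> f Q = meval (affine_coords L Q) G / meval (affine_coords L Q) H"
  using assms(1)
proof (rule regular_atE)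
  fix d G H U
  assume f: "openin (zar V) U" "P \<in> U" "homogeneous d G" "homogeneous d H"
    "\<And>Q. Q \<in> U \<Longrightarrow> meval (coords Q) H \<noteq> 0"
    "\<And>Q. Q \<in> U \<Longrightarrow> f Q = meval (coords Q) G / meval (coords Q) H"
  have U: "openin (zar V) (U \<inter> (V \<inter> {Q. meval (coords Q) L \<noteq> 0}))"
    by (intro openin_Int f openin_zar_restrict openin_nonvanishing[OF assms(2)])
  show ?thesis
    by (rule that[OF U, of H G])
      (use f assms(3) openin_zar_subset[OF f(1)] in \<open>auto simp: meval_affine_coords\<close>)
qed

section \<open>The local ring at a smooth point of a curve\<close>

context irreducible_space
begin

definition vanishing_at :: "'k proj \<Rightarrow> ('k proj \<Rightarrow> 'k) \<Rightarrow> bool" where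
  "vanishing_at P f \<longleftrightarrow> regular_at V P f \<and> f P = 0"

text \<open>A span with coefficients of kind \<open>C\<close>, up to generic equality. For
  \<open>x i\<close> in the local ring, \<open>C = regular_at V P\<close> gives the ideal they
  generate, and \<open>C = vanishing_at P\<close> the product of the maximal ideal with it.\<close>

definition combination ::
    "(('k proj \<Rightarrow> 'k) \<Rightarrow> bool) \<Rightarrow> nat set \<Rightarrow> (nat \<Rightarrow> 'k proj \<Rightarrow> 'k) \<Rightarrow> ('k proj \<Rightarrow> 'k) \<Rightarrow> bool" where
  "combination C I x f \<longleftrightarrow>
     (\<exists>a. (\<forall>i\<in>I. C (a i)) \<and> (\<forall>\<^sub>F R in generic V. f R = (\<Sum>i\<in>I. a i R * x i R)))"

lemma combination_cong:
  assumes "combination C I x f" "\<forall>\<^sub>F R in generic V. f R = g R"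
  shows "combination C I x g"
proof -
  obtain a where a: "\<forall>i\<in>I. C (a i)" "\<forall>\<^sub>F R in generic V. f R = (\<Sum>i\<in>I. a i R * x i R)"
    using assms(1) by (auto simp: combination_def)
  have "\<forall>\<^sub>F R in generic V. g R = (\<Sum>i\<in>I. a i R * x i R)"
    using a(2) assms(2) by eventually_elim auto
  then show ?thesis using a(1) by (auto simp: combination_def)
qed

lemma combination_add:
  assumes "combination C I x f" "combination C I x g" "\<And>a b. C a \<Longrightarrow> C b \<Longrightarrow> C (\<lambda>R. a R + b R)"
  shows "combination C I x (\<lambda>R. f R + g R)"
proof -
  obtain a b where a: "\<forall>i\<in>I. C (a i)" "\<forall>\<^sub>F R in generic V. f R = (\<Sum>i\<in>I. a i R * x i R)"
    and b: "\<forall>i\<in>I. C (b i)" "\<forall>\<^sub>F R in generic V. g R = (\<Sum>i\<in>I. b i R * x i R)"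
    using assms(1,2) by (auto simp: combination_def)
  have "\<forall>\<^sub>F R in generic V. f R + g R = (\<Sum>i\<in>I. (a i R + b i R) * x i R)"
    using a(2) b(2) by eventually_elim (simp add: distrib_right sum.distrib)
  moreover have "\<forall>i\<in>I. C (\<lambda>R. a i R + b i R)" using a b assms(3) by blast
  ultimately show ?thesis
    unfolding combination_def by (intro exI[of _ "\<lambda>i R. a i R + b i R"]) auto
qed

lemma combination_mult:
  assumes "combination C I x f" "\<And>a. C a \<Longrightarrow> C' (\<lambda>R. g R * a R)"
  shows "combination C' I x (\<lambda>R. g R * f R)"
proof -
  obtain a where a: "\<forall>i\<in>I. C (a i)" "\<forall>\<^sub>F R in generic V. f R = (\<Sum>i\<in>I. a i R * x i R)"
    using assms(1) by (auto simp: combination_def)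
  have "\<forall>\<^sub>F R in generic V. g R * f R = (\<Sum>i\<in>I. (g R * a i R) * x i R)"
    using a(2) by eventually_elim (simp add: sum_distrib_left mult.assoc)
  moreover have "\<forall>i\<in>I. C' (\<lambda>R. g R * a i R)" using a assms(2) by blast
  ultimately show ?thesis
    unfolding combination_def by (intro exI[of _ "\<lambda>i R. g R * a i R"]) auto
qed

abbreviation regular_combination where
  "regular_combination P \<equiv> combination (regular_at V P)"

lemma regular_combination_add:
  "regular_combination P I x f \<Longrightarrow> regular_combination P I x g \<Longrightarrow>
    regular_combination P I x (\<lambda>R. f R + g R)"
  by (rule combination_add) (auto intro: regular_at_add)

lemma regular_combination_mult:
  "regular_combination P I x f \<Longrightarrow> regular_at V P g \<Longrightarrow> regular_combination P I x (\<lambda>R. g R * f R)"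
  by (rule combination_mult[where C = "regular_at V P" and C' = "regular_at V P"])
    (auto intro: regular_at_mult)

lemma regular_combination_zero: "P \<in> V \<Longrightarrow> regular_combination P I x (\<lambda>_. 0)"
  unfolding combination_def by (intro exI[of _ "\<lambda>_ _. 0"]) (auto intro: regular_at_const)

lemma regular_combination_sum:
  "P \<in> V \<Longrightarrow> (\<And>j. j \<in> J \<Longrightarrow> regular_combination P I x (f j)) \<Longrightarrow>
    regular_combination P I x (\<lambda>R. \<Sum>j\<in>J. f j R)"
  by (induction J rule: infinite_finite_induct)
    (auto intro: regular_combination_zero regular_combination_add)

lemma regular_combination_generator:
  assumes "P \<in> V" "finite I" "i \<in> I"
  shows "regular_combination P I x (x i)"
proof -
  have "x i R = (\<Sum>j\<in>I. (if j = i then 1 else 0) * x j R)" for R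
    using assms(2,3) by (simp add: if_distrib[of "\<lambda>c. c * _"] cong: if_cong)
  then show ?thesis
    unfolding combination_def
    by (intro exI[of _ "\<lambda>j R. if j = i then 1 else 0"]) (auto intro: regular_at_const assms)
qed

lemma regular_combination_trans:
  assumes "regular_combination P I x f" "\<And>i. i \<in> I \<Longrightarrow> regular_combination P J z (x i)" "P \<in> V"
  shows "regular_combination P J z f"
proof -
  obtain a where a: "\<forall>i\<in>I. regular_at V P (a i)" "\<forall>\<^sub>F R in generic V. f R = (\<Sum>i\<in>I. a i R * x i R)"
    using assms(1) by (auto simp: combination_def)
  have "regular_combination P J z (\<lambda>R. \<Sum>i\<in>I. a i R * x i R)"
    using a(1) assms by (intro regular_combination_sum regular_combination_mult) auto
  moreover have "\<forall>\<^sub>F R in generic V. (\<Sum>i\<in>I. a i R * x i R) = f R"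
    using a(2) by eventually_elim auto
  ultimately show ?thesis using combination_cong by blast
qed

text \<open>The functions \<open>f\<close> for which \<open>f - f(P)\<close> lies in the ideal generated by the \<open>y\<^sub>i - y\<^sub>i(P)\<close>
  form a ring containing the \<open>y\<^sub>i\<close> and closed under division.\<close>

lemma vanishing_at_generators:
  assumes V: "V \<subseteq> proj_space n" and L: "homogeneous 1 L" "meval (coords P) L \<noteq> 0"
    and f: "regular_at V P f"
  shows "regular_combination P {..n} (\<lambda>i R. affine_coords L R i - affine_coords L P i) (\<lambda>R. f R - f P)"
proof -
  have P: "P \<in> V" using f regular_at_mem by blast
  define x where "x = (\<lambda>i R. affine_coords L R i - affine_coords L P i)"
  define good where "good f \<longleftrightarrow> regular_at V P f \<and> regular_combination P {..n} x (\<lambda>R. f R - f P)" for f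
  have const: "good (\<lambda>_. c)" for c
    using regular_combination_zero[OF P] by (simp add: good_def regular_at_const P)
  have add: "good (\<lambda>R. f R + g R)" if "good f" "good g" for f g
    using that regular_combination_add[of P "{..n}" x "\<lambda>R. f R - f P" "\<lambda>R. g R - g P"]
    by (auto simp: good_def algebra_simps intro: regular_at_add)
  have mult: "good (\<lambda>R. f R * g R)" if "good f" "good g" for f g
  proof -
    have "regular_combination P {..n} x (\<lambda>R. g R * (f R - f P) + f P * (g R - g P))"
      using that P by (intro regular_combination_add regular_combination_mult regular_at_const)
        (auto simp: good_def)
    then show ?thesis
      using that by (auto simp: good_def algebra_simps intro: regular_at_mult)
  qed
  have inv: "good (\<lambda>R. inverse (f R))" if "good f" "f P \<noteq> 0" for f
  proof -
    have f: "regular_at V P f" using that by (simp add: good_def)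
    \<comment> \<open>From \<open>1/f - 1/f(P) = - (f - f(P)) / (f(P) f)\<close>.\<close>
    have "regular_combination P {..n} x (\<lambda>R. (- inverse (f P)) * inverse (f R) * (f R - f P))"
      using that P f by (intro regular_combination_mult regular_at_mult regular_at_const regular_at_inverse)
        (auto simp: good_def)
    moreover have "\<forall>\<^sub>F R in generic V. (- inverse (f P)) * inverse (f R) * (f R - f P) = inverse (f R) - inverse (f P)"
      using eventually_nonzero[OF f that(2)]
      by eventually_elim (use that(2) in \<open>simp add: field_simps\<close>)
    ultimately have "regular_combination P {..n} x (\<lambda>R. inverse (f R) - inverse (f P))"
      by (rule combination_cong)
    then show ?thesis
      using regular_at_inverse[OF f that(2)] by (simp add: good_def)
  qed
  have coord: "good (\<lambda>R. affine_coords L R i)" for i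
  proof (cases "i \<le> n")
    case True
    then show ?thesis
      using regular_combination_generator[OF P, of "{..n}" i x] regular_affine_coords[OF P L]
      by (simp add: good_def x_def)
  next
    case False
    have "affine_coords L R i = 0" if "R \<in> V" for R
      using that V False by (auto simp: affine_coords_def proj_space_def)
    then have "\<forall>\<^sub>F R in generic V. 0 = affine_coords L R i - affine_coords L P i"
      using eventually_mem P by (auto elim: eventually_mono)
    then show ?thesis
      using combination_cong[OF regular_combination_zero[OF P]] regular_affine_coords[OF P L]
      by (simp add: good_def)
  qed
  have sum: "good (\<lambda>R. \<Sum>i\<in>I. g i R)" if "\<And>i. i \<in> I \<Longrightarrow> good (g i)" for I :: "(nat \<Rightarrow>\<^sub>0 nat) set" and g
    using that by (induction I rule: infinite_finite_induct) (auto intro: const add)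
  have prod: "good (\<lambda>R. \<Prod>i\<in>I. g i R)" if "\<And>i. i \<in> I \<Longrightarrow> good (g i)" for I :: "nat set" and g
    using that by (induction I rule: infinite_finite_induct) (auto intro: const mult)
  have power: "good (\<lambda>R. g R ^ m)" if "good g" for g m
    using that by (induction m) (auto intro: const mult)
  have poly: "good (\<lambda>R. meval (affine_coords L R) F)" for F
    unfolding meval_def mon_eval_def by (intro sum mult prod power coord const)
  obtain U G H where U: "openin (zar V) U" "P \<in> U" "\<And>Q. Q \<in> U \<Longrightarrow> meval (affine_coords L Q) H \<noteq> 0"
    "\<And>Q. Q \<in> U \<Longrightarrow> f Q = meval (affine_coords L Q) G / meval (affine_coords L Q) H"
    using regular_at_affine_fraction[OF f L] by metis
  have "good (\<lambda>R. meval (affine_coords L R) G * inverse (meval (affine_coords L R) H))"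
    using U by (intro mult inv poly) auto
  then have "regular_combination P {..n} x
      (\<lambda>R. meval (affine_coords L R) G * inverse (meval (affine_coords L R) H) - f P)"
    using U(4)[OF U(2)] by (simp add: good_def divide_inverse)
  moreover have "\<forall>\<^sub>F R in generic V.
      meval (affine_coords L R) G * inverse (meval (affine_coords L R) H) - f P = f R - f P"
    using eventually_open[OF U(1,2)] U(4) by (simp add: divide_inverse)
  ultimately show ?thesis unfolding x_def by (rule combination_cong)
qed

text \<open>Generators are eliminated one at a time. The relation for \<open>x i\<close> modulo
  \<open>x \<tau>\<close> has coefficients vanishing at \<open>P\<close>; when the other generators
  are substituted into it, the coefficient of \<open>x i\<close> itself vanishes at
  \<open>P\<close>, and the relation can be solved for \<open>x i\<close>.\<close>

lemma nakayama:
  assumes P: "P \<in> V" and I: "finite I" "\<tau> \<notin> I" "regular_at V P (x \<tau>)"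
    "\<And>i. i \<in> I \<Longrightarrow> regular_at V P (x i)"
    and cot: "\<And>i. i \<in> I \<Longrightarrow> \<exists>c. combination (vanishing_at P) I x (\<lambda>R. x i R - c * x \<tau> R)"
    and i: "i \<in> I"
  shows "regular_combination P {\<tau>} x (x i)"
proof -
  \<comment> \<open>\<open>D\<close> is the set of generators already eliminated; the case
    \<open>D = I\<close> is the claim.\<close>
  have "\<forall>j\<in>I. regular_combination P (insert \<tau> (I - D)) x (x j)" if "D \<subseteq> I" for D
    using finite_subset[OF that I(1)] that
  proof (induction D rule: finite_induct)
    case empty
    then show ?case using I(1) by (auto intro: regular_combination_generator P)
  next
    case (insert i D)
    define J where "J = insert \<tau> (I - insert i D)"
    have iJ: "i \<notin> J" "i \<in> I" "finite J" "insert i J = insert \<tau> (I - D)"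
      using insert I by (auto simp: J_def)
    have IH: "\<exists>s b. regular_combination P J x s \<and> regular_at V P b \<and>
        (\<forall>\<^sub>F R in generic V. x j R = s R + b R * x i R)" if j: "j \<in> I" for j
    proof -
      obtain a where a: "\<forall>k\<in>insert i J. regular_at V P (a k)"
        "\<forall>\<^sub>F R in generic V. x j R = (\<Sum>k\<in>insert i J. a k R * x k R)"
        using insert.IH insert.prems j unfolding iJ(4) by (auto simp: combination_def)
      have "regular_combination P J x (\<lambda>R. \<Sum>k\<in>J. a k R * x k R)"
        using a(1) by (auto simp: combination_def)
      moreover have "\<forall>\<^sub>F R in generic V. x j R = (\<Sum>k\<in>J. a k R * x k R) + a i R * x i R"
        using a(2) by eventually_elim (use iJ(1,3) in \<open>simp add: add.commute\<close>)
      ultimately show ?thesis using a(1) by blast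
    qed
    then obtain s b where sb: "\<And>j. j \<in> I \<Longrightarrow> regular_combination P J x (s j)"
      "\<And>j. j \<in> I \<Longrightarrow> regular_at V P (b j)"
      "\<And>j. j \<in> I \<Longrightarrow> \<forall>\<^sub>F R in generic V. x j R = s j R + b j R * x i R"
      by metis
    obtain c e where e: "\<forall>j\<in>I. vanishing_at P (e j)"
      "\<forall>\<^sub>F R in generic V. x i R - c * x \<tau> R = (\<Sum>j\<in>I. e j R * x j R)"
      using cot[OF iJ(2)] by (auto simp: combination_def)
    \<comment> \<open>\<open>\<beta>\<close> is the coefficient of \<open>x i\<close> after the
      substitution and \<open>\<gamma>\<close> collects what is expressed through \<open>J\<close>.
      The relation becomes \<open>(1 - \<beta>) x i = \<gamma>\<close>, where
      \<open>1 - \<beta>\<close> is a unit at \<open>P\<close>.\<close>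
    define \<beta> where "\<beta> R = (\<Sum>j\<in>I. e j R * b j R)" for R
    define \<gamma> where "\<gamma> R = c * x \<tau> R + (\<Sum>j\<in>I. e j R * s j R)" for R
    have \<beta>: "regular_at V P \<beta>" "\<beta> P = 0"
      unfolding \<beta>_def using e(1) sb(2) P by (auto simp: vanishing_at_def intro!: regular_at_sum regular_at_mult)
    have unit: "regular_at V P (\<lambda>R. 1 - \<beta> R)"
      by (intro regular_at_diff regular_at_const P \<beta>)
    have \<gamma>: "regular_combination P J x \<gamma>"
      unfolding \<gamma>_def using e(1) sb(1) P iJ(3)
      by (auto simp: vanishing_at_def J_def intro!: regular_combination_add regular_combination_sum
          regular_combination_mult regular_combination_generator regular_at_const)
    have "\<forall>\<^sub>F R in generic V. \<forall>j\<in>I. x j R = s j R + b j R * x i R"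
      using sb(3) I(1) by (simp add: eventually_ball_finite)
    moreover have "\<forall>\<^sub>F R in generic V. 1 - \<beta> R \<noteq> 0"
      using eventually_nonzero[OF unit] \<beta>(2) by simp
    ultimately have "\<forall>\<^sub>F R in generic V. inverse (1 - \<beta> R) * \<gamma> R = x i R"
      using e(2)
    proof eventually_elim
      case (elim R)
      have "x i R - c * x \<tau> R = (\<Sum>j\<in>I. e j R * (s j R + b j R * x i R))"
        using elim by simp
      also have "\<dots> = (\<Sum>j\<in>I. e j R * s j R) + \<beta> R * x i R"
        by (simp add: distrib_left sum.distrib \<beta>_def sum_distrib_right mult.assoc)
      finally have "(1 - \<beta> R) * x i R = \<gamma> R"
        by (simp add: \<gamma>_def algebra_simps)
      then show ?case using elim(2) by (simp add: field_simps)
    qed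
    then have xi: "regular_combination P J x (x i)"
      using combination_cong[OF regular_combination_mult[OF \<gamma> regular_at_inverse[OF unit]]] \<beta>(2) by simp
    show ?case
    proof
      fix j assume j: "j \<in> I"
      have "regular_combination P J x (\<lambda>R. s j R + b j R * x i R)"
        using sb j xi by (intro regular_combination_add regular_combination_mult) auto
      moreover have "\<forall>\<^sub>F R in generic V. s j R + b j R * x i R = x j R"
        using sb(3)[OF j] by eventually_elim auto
      ultimately show "regular_combination P (insert \<tau> (I - insert i D)) x (x j)"
        unfolding J_def[symmetric] by (rule combination_cong)
    qed
  qed
  from this[of I] show ?thesis using i by simp
qed

definition generates_max_ideal :: "'k proj \<Rightarrow> ('k proj \<Rightarrow> 'k) \<Rightarrow> bool" where
  "generates_max_ideal P t \<longleftrightarrow> vanishing_at P t \<and>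
     (\<forall>f. vanishing_at P f \<longrightarrow> (\<exists>g. regular_at V P g \<and> (\<forall>\<^sub>F R in generic V. f R = g R * t R)))"

text \<open>More than a generator of the maximal ideal: this includes that the local ring is a
  discrete valuation ring, in the form that every nonzero rational function is a unit times an
  integral power of \<open>t\<close>.\<close>

definition uniformizing :: "'k proj \<Rightarrow> ('k proj \<Rightarrow> 'k) \<Rightarrow> bool" where
  "uniformizing P t \<longleftrightarrow> vanishing_at P t \<and> (\<forall>\<^sub>F R in generic V. t R \<noteq> 0) \<and>
     (\<forall>f. rational V f \<longrightarrow> \<not> (\<forall>\<^sub>F R in generic V. f R = 0) \<longrightarrow>
       (\<exists>n u. regular_at V P u \<and> u P \<noteq> 0 \<and> (\<forall>\<^sub>F R in generic V. f R = u R * t R powi n)))"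

text \<open>Nakayama lifts a generator of the cotangent space to one of the maximal ideal; the
  differences of affine coordinates are the finite generating system that it requires.\<close>

lemma cotangent_generator:
  assumes V: "V \<subseteq> proj_space n" and P: "P \<in> V" and t: "vanishing_at P t"
    and cot: "\<And>f. vanishing_at P f \<Longrightarrow> \<exists>c. combination (vanishing_at P) {..n}
      (\<lambda>i R. affine_coords L R i - affine_coords L P i) (\<lambda>R. f R - c * t R)"
    and L: "homogeneous 1 L" "meval (coords P) L \<noteq> 0"
  shows "generates_max_ideal P t"
proof -
  \<comment> \<open>\<open>t\<close> is stored under the spare index \<open>Suc n\<close>, which
    lies outside the range \<open>{..n}\<close> of the coordinates.\<close>
  define x where "x i R = (if i = Suc n then t R else affine_coords L R i - affine_coords L P i)" for i R
  have eq: "combination C {..n} (\<lambda>i R. affine_coords L R i - affine_coords L P i) f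
      \<longleftrightarrow> combination C {..n} x f" for C f
  proof -
    have "(\<Sum>i\<le>n. a i R * x i R) = (\<Sum>i\<le>n. a i R * (affine_coords L R i - affine_coords L P i))" for a R
      by (intro sum.cong) (auto simp: x_def)
    then show ?thesis by (simp add: combination_def)
  qed
  have xi: "vanishing_at P (x i)" if "i \<le> n" for i
    using that regular_at_diff[OF regular_affine_coords[OF P L] regular_at_const[OF P], of i]
    by (simp add: vanishing_at_def x_def[abs_def])
  have xt: "x (Suc n) = t" by (simp add: x_def fun_eq_iff)
  have "\<exists>g. regular_at V P g \<and> (\<forall>\<^sub>F R in generic V. f R = g R * t R)" if f: "vanishing_at P f" for f
  proof -
    have "regular_combination P {..n} x f"
      using vanishing_at_generators[OF V L, of f] f by (simp add: vanishing_at_def eq)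
    moreover have "regular_combination P {Suc n} x (x i)" if "i \<in> {..n}" for i
      using that t xi cot[unfolded eq]
      by (intro nakayama[where I = "{..n}"] P) (auto simp: xt vanishing_at_def)
    ultimately have "regular_combination P {Suc n} x f"
      using regular_combination_trans P by blast
    then show ?thesis by (auto simp: combination_def xt)
  qed
  then show ?thesis using t by (simp add: generates_max_ideal_def)
qed

end

section \<open>Krull's intersection theorem\<close>

lemma sum_fun_apply: "(\<Sum>i\<in>I. f i) R = (\<Sum>i\<in>I. f i R)"
  by (induction I rule: infinite_finite_induct) auto

lemma prod_fun_apply: "(\<Prod>i\<in>I. f i) R = (\<Prod>i\<in>I. f i R)"
  for f :: "_ \<Rightarrow> _ \<Rightarrow> 'k::comm_ring_1"
  by (induction I rule: infinite_finite_induct) auto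

lemma power_fun_apply: "(f ^ n) R = f R ^ n"
  for f :: "_ \<Rightarrow> 'k::comm_ring_1"
  by (induction n) auto

text \<open>The coordinate ring of the chart, built by one adjunction per coordinate so that
  Hilbert's theorem applies each time. Its elements are functions on the whole ambient space,
  combined pointwise. A variety in \<open>proj_space n\<close> has \<open>n + 1\<close> coordinates,
  hence the argument \<open>Suc n\<close> later.\<close>

primrec affine_functions :: "'k::field mpol \<Rightarrow> nat \<Rightarrow> ('k proj \<Rightarrow> 'k) set" where
  "affine_functions L 0 = range (\<lambda>c _. c)"
| "affine_functions L (Suc n) = adjoin (affine_functions L n) (\<lambda>R. affine_coords L R n)"

lemma subring_set_affine_functions: "subring_set (affine_functions L n)"
proof (induction n)
  case 0
  show ?case
    by (auto simp: subring_set_def fun_eq_iff image_iff)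
qed (simp add: subring_set_adjoin)

lemma noetherian_affine_functions: "noetherian (affine_functions L n)"
proof (induction n)
  case 0
  show ?case
    unfolding noetherian_def
  proof (intro allI impI)
    fix s :: "nat \<Rightarrow> 'a proj \<Rightarrow> 'a"
    assume "range s \<subseteq> affine_functions L 0"
    then have "\<exists>c. s i = (\<lambda>_. c)" for i
      by auto
    then obtain c where c: "\<And>i. s i = (\<lambda>_. c i)" by metis
    show "\<exists>m. s m \<in> initial_span (affine_functions L 0) s m"
    proof (cases "c 0 = 0")
      case True
      then have "s 0 \<in> initial_span (affine_functions L 0) s 0"
        by (auto simp: initial_span_def c fun_eq_iff)
      then show ?thesis by blast
    next
      case False
      then have "s 1 \<in> initial_span (affine_functions L 0) s 1"
        unfolding initial_span_def
        by (intro CollectI exI[of _ "\<lambda>_ _. c 1 / c 0"]) (auto simp: c fun_eq_iff)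
      then show ?thesis by blast
    qed
  qed
qed (simp add: noetherian_adjoin subring_set_affine_functions)

lemma affine_functions_mono: "m \<le> n \<Longrightarrow> affine_functions L m \<subseteq> affine_functions L n"
  by (rule lift_Suc_mono_le[of "affine_functions L"])
    (auto dest: adjoin_superset[OF subring_set_affine_functions, THEN subsetD])

lemma affine_coords_in_affine_functions: "i < n \<Longrightarrow> (\<lambda>R. affine_coords L R i) \<in> affine_functions L n"
  using affine_functions_mono[of "Suc i" n L] adjoin_generator[OF subring_set_affine_functions, of "\<lambda>R. affine_coords L R i" L i]
  by auto

lemma regular_affine_functions:
  assumes "P \<in> V" "homogeneous 1 L" "meval (coords P) L \<noteq> 0"
  shows "a \<in> affine_functions L n \<Longrightarrow> regular_at V P a"
proof (induction n arbitrary: a)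
  case 0
  then show ?case using regular_at_const[OF assms(1)] by auto
next
  case (Suc n)
  then obtain p where p: "a = poly p (\<lambda>R. affine_coords L R n)"
    "\<forall>i. Polynomial.coeff p i \<in> affine_functions L n"
    by (auto simp: adjoin_def)
  have "regular_at V P (poly p (\<lambda>R. affine_coords L R n))"
    using p(2)
  proof (induction p)
    case 0
    then show ?case using regular_at_const[OF assms(1), of 0] by (simp add: zero_fun_def)
  next
    case (pCons b p)
    have "b \<in> affine_functions L n" "\<forall>i. Polynomial.coeff p i \<in> affine_functions L n"
      using pCons.prems by (metis coeff_pCons_0, metis coeff_pCons_Suc)
    then show ?case
      using regular_at_add[OF Suc.IH regular_at_mult[OF regular_affine_coords[OF assms] pCons.IH]]
      by (simp add: plus_fun_def times_fun_def)
  qed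
  then show ?case by (simp add: p)
qed

lemma meval_in_affine_functions:
  assumes "V \<subseteq> proj_space n"
  shows "\<exists>a\<in>affine_functions L (Suc n). \<forall>R\<in>V. meval (affine_coords L R) F = a R"
proof -
  \<comment> \<open>\<open>F\<close> may involve variables beyond \<open>n\<close>; these vanish on
    \<open>V\<close> and are replaced by \<open>0\<close>.\<close>
  define y where "y i = (if i \<le> n then (\<lambda>R. affine_coords L R i) else 0)" for i
  define a where "a = (\<Sum>m\<in>Poly_Mapping.keys F. (\<lambda>_. Poly_Mapping.lookup F m) *
      (\<Prod>i\<in>Poly_Mapping.keys m. y i ^ Poly_Mapping.lookup m i))"
  note sub = subring_set_affine_functions[of L "Suc n"]
  have "y i \<in> affine_functions L (Suc n)" for i
    using affine_coords_in_affine_functions[of i "Suc n" L] subring_set_closed(2)[OF sub]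
    by (simp add: y_def del: affine_functions.simps)
  moreover have "(\<lambda>_. c) \<in> affine_functions L (Suc n)" for c
    using affine_functions_mono[of 0 "Suc n" L] by auto
  ultimately have "a \<in> affine_functions L (Suc n)"
    unfolding a_def
    by (intro subring_set_sum[OF sub] subring_set_closed(4)[OF sub] subring_set_prod[OF sub]
        subring_set_power[OF sub])
  moreover have "y i R = affine_coords L R i" if "R \<in> V" for i R
    using assms that by (auto simp: y_def affine_coords_def proj_space_def)
  then have "\<forall>R\<in>V. meval (affine_coords L R) F = a R"
    by (simp add: a_def meval_def mon_eval_def sum_fun_apply prod_fun_apply power_fun_apply)
  ultimately show ?thesis by blast
qed

context irreducible_space
begin

lemma affine_fraction:
  assumes V: "V \<subseteq> proj_space n" and L: "homogeneous 1 L" "meval (coords P) L \<noteq> 0"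
    and f: "regular_at V P f"
  obtains a b where "a \<in> affine_functions L (Suc n)" "b \<in> affine_functions L (Suc n)" "b P \<noteq> 0"
    "\<forall>\<^sub>F R in generic V. f R = a R / b R"
proof -
  obtain U G H where U: "openin (zar V) U" "P \<in> U" "\<And>Q. Q \<in> U \<Longrightarrow> meval (affine_coords L Q) H \<noteq> 0"
    "\<And>Q. Q \<in> U \<Longrightarrow> f Q = meval (affine_coords L Q) G / meval (affine_coords L Q) H"
    using regular_at_affine_fraction[OF f L] by metis
  obtain a b where ab: "a \<in> affine_functions L (Suc n)" "b \<in> affine_functions L (Suc n)"
    "\<forall>R\<in>V. meval (affine_coords L R) G = a R" "\<forall>R\<in>V. meval (affine_coords L R) H = b R"
    using meval_in_affine_functions[OF V] by metis
  have "\<forall>\<^sub>F R in generic V. f R = a R / b R"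
    using ab U openin_zar_subset[OF U(1)] by (intro eventually_open[OF U(1,2)]) auto
  moreover have "b P \<noteq> 0"
    using ab(4) U openin_zar_subset[OF U(1)] by fastforce
  ultimately show ?thesis using that ab by blast
qed

text \<open>Krull's intersection theorem for a principal maximal ideal: if \<open>f = t\<^sup>i g\<^sub>i\<close> for all \<open>i\<close> and
  \<open>g\<^sub>i = a\<^sub>i / b\<^sub>i\<close>, a relation \<open>a\<^sub>m = \<Sum>i<m. r\<^sub>i a\<^sub>i\<close> gives \<open>b\<^sub>m = \<Sum>i<m. r\<^sub>i b\<^sub>i t\<^sup>m\<^sup>-\<^sup>i\<close>,
  which vanishes at \<open>P\<close>.\<close>

lemma regular_eq_unit_mult_power:
  assumes V: "V \<subseteq> proj_space n" and t: "generates_max_ideal P t" "\<forall>\<^sub>F R in generic V. t R \<noteq> 0"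
    and f: "regular_at V P f" "\<not> (\<forall>\<^sub>F R in generic V. f R = 0)"
  shows "\<exists>u m. regular_at V P u \<and> u P \<noteq> 0 \<and> (\<forall>\<^sub>F R in generic V. f R = u R * t R ^ m)"
proof (rule ccontr)
  assume neg: "\<not> ?thesis"
  have P: "P \<in> V" using f(1) regular_at_mem by blast
  obtain j where "coords P j \<noteq> 0" using coords_nonzero by blast
  then obtain L :: "'k mpol" where L: "homogeneous 1 L" "meval (coords P) L \<noteq> 0"
    using homogeneous_variable[of j] by (metis meval_variable)
  define A where "A = affine_functions L (Suc n)"
  have "\<exists>g. \<forall>i. regular_at V P (g i) \<and> (\<forall>\<^sub>F R in generic V. f R = g i R * t R ^ i)"
  proof -
    have "\<exists>g. \<forall>i. regular_at V P (g i) \<and> (\<forall>\<^sub>F R in generic V. f R = g i R * t R ^ i)"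
    proof (rule dependent_nat_choice[where Q = "\<lambda>_ _ _. True", simplified])
      show "\<exists>g. regular_at V P g \<and> (\<forall>\<^sub>F R in generic V. f R = g R * t R ^ 0)"
        using f(1) by auto
    next
      fix g i assume g: "regular_at V P g \<and> (\<forall>\<^sub>F R in generic V. f R = g R * t R ^ i)"
      \<comment> \<open>If \<open>g P\<close> were nonzero, \<open>f = g t^i\<close> would be the
        factorisation that \<open>neg\<close> denies.\<close>
      then have "g P = 0" using neg by blast
      then obtain h where h: "regular_at V P h" "\<forall>\<^sub>F R in generic V. g R = h R * t R"
        using t(1) g unfolding generates_max_ideal_def vanishing_at_def by blast
      have "\<forall>\<^sub>F R in generic V. f R = h R * t R ^ Suc i"
        using h(2) g[THEN conjunct2] by eventually_elim (simp add: mult_ac)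
      then show "\<exists>h. regular_at V P h \<and> (\<forall>\<^sub>F R in generic V. f R = h R * t R ^ Suc i)"
        using h(1) by blast
    qed
    then show ?thesis by blast
  qed
  then obtain g where g: "\<And>i. regular_at V P (g i)" "\<And>i. \<forall>\<^sub>F R in generic V. f R = g i R * t R ^ i"
    by blast
  have "\<forall>i. \<exists>a b. a \<in> A \<and> b \<in> A \<and> b P \<noteq> 0 \<and> (\<forall>\<^sub>F R in generic V. g i R = a R / b R)"
    using affine_fraction[OF V L g(1)] unfolding A_def by metis
  then obtain a b where ab: "\<And>i. a i \<in> A" "\<And>i. b i \<in> A" "\<And>i. b i P \<noteq> 0"
    "\<And>i. \<forall>\<^sub>F R in generic V. g i R = a i R / b i R"
    by metis
  have "range a \<subseteq> A" using ab(1) by auto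
  then obtain m r where r: "\<And>i. i < m \<Longrightarrow> r i \<in> A" "a m = (\<Sum>i<m. r i * a i)"
    using noetherian_affine_functions[of L "Suc n"] unfolding noetherian_def initial_span_def A_def by blast
  have reg: "regular_at V P c" if "c \<in> A" for c
    using regular_affine_functions[OF P L] that unfolding A_def by blast
  have nz: "\<forall>\<^sub>F R in generic V. b i R \<noteq> 0" for i
    using eventually_nonzero[OF reg[OF ab(2)] ab(3)] .
  have "\<forall>\<^sub>F R in generic V. \<forall>i\<in>{..m}. b i R \<noteq> 0 \<and> g i R = a i R / b i R \<and> f R = g i R * t R ^ i"
    by (intro eventually_ball_finite ballI eventually_conj nz ab g) auto
  moreover note t(2)
  moreover have "\<forall>\<^sub>F R in generic V. f R \<noteq> 0"
    using rational_not_zero[OF rationalI f(2)] f(1) by blast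
  ultimately have "\<forall>\<^sub>F R in generic V. b m R = (\<Sum>i<m. r i R * b i R * t R ^ (m - i))"
  proof eventually_elim
    case (elim R)
    have "f R = g m R * t R ^ m" using elim(1) by blast
    then have gm: "g m R \<noteq> 0" using elim(3) by auto
    have *: "a i R = b i R * t R ^ (m - i) * g m R" if "i \<le> m" for i
    proof -
      have e: "g i R * t R ^ i = g m R * t R ^ m" using elim(1) that by (metis atMost_iff order_refl)
      have "t R ^ m = t R ^ (m - i) * t R ^ i"
        using that by (simp flip: power_add)
      then have "g i R = t R ^ (m - i) * g m R"
        using elim(2) e by simp
      moreover have "a i R = b i R * g i R" using elim(1) that by simp
      ultimately show ?thesis by simp
    qed
    have "b m R * g m R = a m R" using *[of m] by simp
    also have "\<dots> = (\<Sum>i<m. r i R * a i R)" by (simp add: r(2) sum_fun_apply)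
    also have "\<dots> = (\<Sum>i<m. r i R * b i R * t R ^ (m - i)) * g m R"
      unfolding sum_distrib_right by (intro sum.cong) (auto simp: *)
    finally show ?case using gm by simp
  qed
  moreover have "regular_at V P (\<lambda>R. \<Sum>i<m. r i R * b i R * t R ^ (m - i))"
    using t(1) ab r(1) P reg
    by (intro regular_at_sum regular_at_mult regular_at_power)
      (auto simp: generates_max_ideal_def vanishing_at_def)
  ultimately have "b m P = (\<Sum>i<m. r i P * b i P * t P ^ (m - i))"
    using regular_at_eqD[OF reg[OF ab(2)]] by blast
  also have "\<dots> = 0"
    using t(1) by (auto simp: generates_max_ideal_def vanishing_at_def power_0_left intro!: sum.neutral)
  finally show False using ab(3) by blast
qed

text \<open>A rational function is a quotient of elements of \<open>affine_functions\<close>. These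
  are all regular at \<open>P\<close>, so it is enough to factor numerator and denominator.\<close>

lemma uniformizingI:
  assumes V: "V \<subseteq> proj_space n" and t: "generates_max_ideal P t" "\<forall>\<^sub>F R in generic V. t R \<noteq> 0"
  shows "uniformizing P t"
proof -
  have P: "P \<in> V" using t(1) regular_at_mem by (auto simp: generates_max_ideal_def vanishing_at_def)
  obtain j where "coords P j \<noteq> 0" using coords_nonzero by blast
  then obtain L :: "'k mpol" where L: "homogeneous 1 L" "meval (coords P) L \<noteq> 0"
    using homogeneous_variable[of j] by (metis meval_variable)
  have "\<exists>k u. regular_at V P u \<and> u P \<noteq> 0 \<and> (\<forall>\<^sub>F R in generic V. f R = u R * t R powi k)"
    if f: "rational V f" "\<not> (\<forall>\<^sub>F R in generic V. f R = 0)" for f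
  proof -
    have "\<forall>\<^sub>F R in generic V. meval (coords R) L \<noteq> 0"
      using P L openin_zar_restrict[OF openin_nonvanishing[OF L(1)], of V]
      by (auto intro!: eventually_open[of "V \<inter> {Q. meval (coords Q) L \<noteq> 0}" P])
    \<comment> \<open>\<open>f\<close> may have a pole at \<open>P\<close>. The fraction is taken at
      a point \<open>P0\<close> of the same chart where \<open>f\<close> is regular, and its two
      terms are then examined at \<open>P\<close>.\<close>
    then obtain P0 where P0: "regular_at V P0 f" "meval (coords P0) L \<noteq> 0"
      using eventually_ex[OF eventually_conj[OF eventually_regular[OF f(1)]]] by blast
    obtain a b where ab: "a \<in> affine_functions L (Suc n)" "b \<in> affine_functions L (Suc n)" "b P0 \<noteq> 0"
      "\<forall>\<^sub>F R in generic V. f R = a R / b R"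
      using affine_fraction[OF V L(1) P0(2,1)] .
    note reg = regular_affine_functions[OF P L ab(1)] regular_affine_functions[OF P L ab(2)]
    have "\<forall>\<^sub>F R in generic V. b R \<noteq> 0"
      using eventually_nonzero[OF regular_affine_functions[OF regular_at_mem[OF P0(1)] L(1) P0(2) ab(2)] ab(3)] .
    then have b0: "\<not> (\<forall>\<^sub>F R in generic V. b R = 0)"
      by (metis (mono_tags, lifting) eventually_conj eventually_ex)
    have a0: "\<not> (\<forall>\<^sub>F R in generic V. a R = 0)"
    proof
      assume "\<forall>\<^sub>F R in generic V. a R = 0"
      then have "\<forall>\<^sub>F R in generic V. f R = 0" using ab(4) by eventually_elim auto
      then show False using f(2) by blast
    qed
    obtain u i where u: "regular_at V P u" "u P \<noteq> 0" "\<forall>\<^sub>F R in generic V. a R = u R * t R ^ i"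
      using regular_eq_unit_mult_power[OF V t reg(1) a0] by blast
    obtain v j where v: "regular_at V P v" "v P \<noteq> 0" "\<forall>\<^sub>F R in generic V. b R = v R * t R ^ j"
      using regular_eq_unit_mult_power[OF V t reg(2) b0] by blast
    have "\<forall>\<^sub>F R in generic V. f R = (u R / v R) * t R powi (int i - int j)"
      using ab(4) u(3) v(3) t(2) by eventually_elim (simp add: power_int_diff)
    moreover have "regular_at V P (\<lambda>R. u R / v R)" "u P / v P \<noteq> 0"
      using u v by (auto intro: regular_at_divide)
    ultimately show ?thesis by blast
  qed
  then show ?thesis using t by (auto simp: uniformizing_def generates_max_ideal_def)
qed

end

section \<open>The function field and orders of vanishing\<close>

lemma powi_nonpos_cancel: "x \<noteq> 0 \<Longrightarrow> n \<le> 0 \<Longrightarrow> x powi n * x ^ nat (- n) = 1" for x :: "'a::field"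
  by (cases "n = 0") (auto simp: power_int_def power_inverse)

lemma powi_split: "x \<noteq> 0 \<Longrightarrow> m \<le> n \<Longrightarrow> x powi n = x ^ nat (n - m) * x powi m" for x :: "'a::field"
  using power_int_add[of x "n - m" m] by (simp add: power_int_def)

context irreducible_space
begin

text \<open>One argument for the function field (\<open>C = rational V\<close>) and for all local
  rings (\<open>C = regular_at V P\<close>): they share their operations, and the ring axioms hold
  pointwise for representatives.\<close>

lemma cring_of_functions:
  fixes R :: "'k ratfun ring"
  assumes carrier: "carrier R = ratfun_class V ` Collect C" and C: "\<And>f. C f \<Longrightarrow> rational V f"
    and ops: "monoid.mult R = monoid.mult (function_field V)" "ring.add R = ring.add (function_field V)"
      "monoid.one R = monoid.one (function_field V)" "ring.zero R = ring.zero (function_field V)"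
    and closed: "\<And>c. C (\<lambda>_. c)" "\<And>f g. C f \<Longrightarrow> C g \<Longrightarrow> C (\<lambda>P. f P + g P)"
      "\<And>f g. C f \<Longrightarrow> C g \<Longrightarrow> C (\<lambda>P. f P * g P)"
  shows "cring R" "C f \<Longrightarrow> \<ominus>\<^bsub>R\<^esub> ratfun_class V f = ratfun_class V (\<lambda>P. - f P)"
proof -
  have m: "ratfun_class V f \<otimes>\<^bsub>R\<^esub> ratfun_class V g = ratfun_class V (\<lambda>P. f P * g P)"
    and a: "ratfun_class V f \<oplus>\<^bsub>R\<^esub> ratfun_class V g = ratfun_class V (\<lambda>P. f P + g P)"
    if "C f" "C g" for f g
    using that C by (simp_all add: ops ratfun_mult ratfun_add)
  have c: "\<one>\<^bsub>R\<^esub> = ratfun_class V (\<lambda>_. 1)" "\<zero>\<^bsub>R\<^esub> = ratfun_class V (\<lambda>_. 0)"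
    by (simp_all add: ops ratfun_one ratfun_zero)
  have neg: "C (\<lambda>P. - f P)" if "C f" for f
    using closed(3)[OF closed(1)[of "-1"] that] by (simp only: mult_minus1)
  have ag: "abelian_group R"
  proof (rule abelian_groupI)
    fix x assume "x \<in> carrier R"
    then obtain f where f: "C f" "x = ratfun_class V f" by (auto simp: carrier)
    have "ratfun_class V (\<lambda>P. - f P) \<oplus>\<^bsub>R\<^esub> x = \<zero>\<^bsub>R\<^esub>"
      unfolding f(2) a[OF neg[OF f(1)] f(1)] c by simp
    then show "\<exists>y\<in>carrier R. y \<oplus>\<^bsub>R\<^esub> x = \<zero>\<^bsub>R\<^esub>"
      using neg f by (auto simp: carrier)
  qed (auto simp: carrier a c closed add_ac)
  show "cring R"
  proof (rule cringI[OF ag])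
    show "comm_monoid R"
      by (rule comm_monoidI) (auto simp: carrier m c closed mult_ac)
  qed (auto simp: carrier m a closed distrib_right)
  then interpret R: cring R .
  assume f: "C f"
  show "\<ominus>\<^bsub>R\<^esub> ratfun_class V f = ratfun_class V (\<lambda>P. - f P)"
  proof (rule R.minus_equality)
    show "ratfun_class V f \<in> carrier R" "ratfun_class V (\<lambda>P. - f P) \<in> carrier R"
      using f neg[OF f] unfolding carrier by blast+
    show "ratfun_class V (\<lambda>P. - f P) \<oplus>\<^bsub>R\<^esub> ratfun_class V f = \<zero>\<^bsub>R\<^esub>"
      unfolding a[OF neg[OF f] f] c by simp
  qed
qed

lemma cring_function_field: "cring (function_field V)"
  by (rule cring_of_functions(1)[where C = "rational V"]) (auto simp: carrier_function_field)

lemma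
  assumes "P \<in> V"
  shows cring_local_ring: "cring (local_ring V P)"
    and local_ring_uminus: "regular_at V P f \<Longrightarrow>
      \<ominus>\<^bsub>local_ring V P\<^esub> ratfun_class V f = ratfun_class V (\<lambda>P. - f P)"
proof -
  show "cring (local_ring V P)"
    by (rule cring_of_functions(1)[where C = "regular_at V P"])
      (auto simp: carrier_local_ring rationalI intro: regular_at_const regular_at_add regular_at_mult assms)
  show "regular_at V P f \<Longrightarrow> \<ominus>\<^bsub>local_ring V P\<^esub> ratfun_class V f = ratfun_class V (\<lambda>P. - f P)"
    by (rule cring_of_functions(2)[where C = "regular_at V P"])
      (auto simp: carrier_local_ring rationalI intro: regular_at_const regular_at_add regular_at_mult assms)
qed

lemma Units_local_ring:
  assumes "P \<in> V"
  shows "Units (local_ring V P) = ratfun_class V ` {f. regular_at V P f \<and> f P \<noteq> 0}"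
proof -
  interpret R: cring "local_ring V P" by (rule cring_local_ring[OF assms])
  show ?thesis
  proof (intro equalityI subsetI)
    fix x assume "x \<in> Units (local_ring V P)"
    then obtain y where y: "x \<in> carrier (local_ring V P)" "y \<in> carrier (local_ring V P)"
      "x \<otimes>\<^bsub>local_ring V P\<^esub> y = \<one>\<^bsub>local_ring V P\<^esub>"
      unfolding Units_def by blast
    then obtain f g where fg: "regular_at V P f" "x = ratfun_class V f" "regular_at V P g" "y = ratfun_class V g"
      by (auto simp: carrier_local_ring)
    then have "\<forall>\<^sub>F R in generic V. f R * g R = 1"
      using y(3) by (simp add: ratfun_mult ratfun_one rationalI rational_mult ratfun_class_eq_iff)
    then have "f P * g P = 1"
      using regular_at_eqD[OF regular_at_mult[OF fg(1,3)] regular_at_const[OF assms]] by blast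
    then show "x \<in> ratfun_class V ` {f. regular_at V P f \<and> f P \<noteq> 0}"
      using fg by auto
  next
    fix x assume "x \<in> ratfun_class V ` {f. regular_at V P f \<and> f P \<noteq> 0}"
    then obtain f where f: "regular_at V P f" "f P \<noteq> 0" "x = ratfun_class V f" by auto
    have "\<forall>\<^sub>F R in generic V. f R * inverse (f R) = 1"
      using eventually_nonzero[OF f(1,2)] by eventually_elim simp
    then have "x \<otimes>\<^bsub>local_ring V P\<^esub> ratfun_class V (\<lambda>R. inverse (f R)) = \<one>\<^bsub>local_ring V P\<^esub>"
      using f(1) by (simp add: f(3) ratfun_mult ratfun_one rationalI rational_inverse rational_mult ratfun_class_eq_iff)
    moreover have "x \<in> carrier (local_ring V P)" "ratfun_class V (\<lambda>R. inverse (f R)) \<in> carrier (local_ring V P)"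
      using f by (auto simp: carrier_local_ring regular_at_inverse)
    ultimately show "x \<in> Units (local_ring V P)"
      unfolding Units_def using R.m_comm
      by (auto intro!: bexI[of _ "ratfun_class V (\<lambda>R. inverse (f R))"])
  qed
qed

lemma uniformizer_iff:
  "uniformizer V P a \<longleftrightarrow> (\<exists>t. a = ratfun_class V t \<and> generates_max_ideal P t)"
proof -
  have pidl: "PIdl\<^bsub>local_ring V P\<^esub> (ratfun_class V t) =
      ratfun_class V ` {\<lambda>R. g R * t R |g. regular_at V P g}" if "regular_at V P t" for t
  proof -
    have "ratfun_class V g \<otimes>\<^bsub>function_field V\<^esub> ratfun_class V t = ratfun_class V (\<lambda>R. g R * t R)"
      if "regular_at V P g" for g
      using that \<open>regular_at V P t\<close> by (simp add: ratfun_mult rationalI)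
    then show ?thesis
      unfolding cgenideal_def carrier_local_ring by (auto simp: image_iff)
  qed
  show ?thesis
  proof
    assume "uniformizer V P a"
    then obtain t where t: "a = ratfun_class V t" "vanishing_at P t"
      and m: "max_ideal V P = PIdl\<^bsub>local_ring V P\<^esub> (ratfun_class V t)"
      by (auto simp: uniformizer_def max_ideal_eq vanishing_at_def)
    have "\<exists>g. regular_at V P g \<and> (\<forall>\<^sub>F R in generic V. f R = g R * t R)" if "vanishing_at P f" for f
    proof -
      have "ratfun_class V f \<in> max_ideal V P"
        using that unfolding max_ideal_eq vanishing_at_def by blast
      then have "ratfun_class V f \<in> ratfun_class V ` {\<lambda>R. g R * t R |g. regular_at V P g}"
        using t pidl[of t] m by (simp add: vanishing_at_def)
      then obtain g where "regular_at V P g" "ratfun_class V f = ratfun_class V (\<lambda>R. g R * t R)"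
        by auto
      then show ?thesis
        using that ratfun_class_eq_iff[OF rationalI, of P f "\<lambda>R. g R * t R"] by (auto simp: vanishing_at_def)
    qed
    then show "\<exists>t. a = ratfun_class V t \<and> generates_max_ideal P t"
      using t by (auto simp: generates_max_ideal_def)
  next
    assume "\<exists>t. a = ratfun_class V t \<and> generates_max_ideal P t"
    then obtain t where t: "a = ratfun_class V t" "regular_at V P t" "t P = 0"
      "\<And>f. vanishing_at P f \<Longrightarrow> \<exists>g. regular_at V P g \<and> (\<forall>\<^sub>F R in generic V. f R = g R * t R)"
      by (auto simp: generates_max_ideal_def vanishing_at_def)
    have "max_ideal V P = PIdl\<^bsub>local_ring V P\<^esub> a"
      unfolding t(1) pidl[OF t(2)] max_ideal_eq
    proof (intro equalityI subsetI)
      fix x assume "x \<in> ratfun_class V ` {f. regular_at V P f \<and> f P = 0}"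
      then obtain f where f: "x = ratfun_class V f" "vanishing_at P f" by (auto simp: vanishing_at_def)
      then obtain g where g: "regular_at V P g" "\<forall>\<^sub>F R in generic V. f R = g R * t R"
        using t(4) by blast
      then have "x = ratfun_class V (\<lambda>R. g R * t R)"
        using f ratfun_class_eqI[OF rationalI g(2), of P] by (simp add: vanishing_at_def)
      then show "x \<in> ratfun_class V ` {\<lambda>R. g R * t R |g. regular_at V P g}"
        using g(1) by blast
    next
      fix x assume "x \<in> ratfun_class V ` {\<lambda>R. g R * t R |g. regular_at V P g}"
      then obtain g where "x = ratfun_class V (\<lambda>R. g R * t R)" "regular_at V P g" by blast
      then show "x \<in> ratfun_class V ` {f. regular_at V P f \<and> f P = 0}"
        using regular_at_mult[OF _ t(2)] t(3) by auto
    qed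
    moreover have "a \<in> max_ideal V P"
      using t by (auto simp: max_ideal_eq)
    ultimately show "uniformizer V P a" by (simp add: uniformizer_def)
  qed
qed

section \<open>Nonzero rational functions and their orders\<close>

definition nonzero_rational :: "('k proj \<Rightarrow> 'k) \<Rightarrow> bool" where
  "nonzero_rational f \<longleftrightarrow> rational V f \<and> (\<forall>\<^sub>F R in generic V. f R \<noteq> 0)"

lemma nonzero_rationalI:
  "rational V f \<Longrightarrow> \<not> (\<forall>\<^sub>F R in generic V. f R = 0) \<Longrightarrow> nonzero_rational f"
  using rational_not_zero by (simp add: nonzero_rational_def)

lemma nonzero_rational_not_zero: "nonzero_rational f \<Longrightarrow> \<not> (\<forall>\<^sub>F R in generic V. f R = 0)"
  unfolding nonzero_rational_def by (metis (mono_tags, lifting) eventually_conj eventually_ex)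

lemma nonzero_rational_unit: "regular_at V P f \<Longrightarrow> f P \<noteq> 0 \<Longrightarrow> nonzero_rational f"
  using eventually_nonzero by (auto simp: nonzero_rational_def rationalI)

lemma nonzero_rational_mult:
  "nonzero_rational f \<Longrightarrow> nonzero_rational g \<Longrightarrow> nonzero_rational (\<lambda>R. f R * g R)"
  by (auto simp: nonzero_rational_def eventually_conj_iff)

lemma nonzero_rational_inverse:
  "nonzero_rational f \<Longrightarrow> nonzero_rational (\<lambda>R. inverse (f R))"
  by (auto simp: nonzero_rational_def)

lemma nonzero_rational_powi:
  assumes "nonzero_rational f"
  shows "nonzero_rational (\<lambda>R. f R powi n)"
proof -
  have "\<forall>\<^sub>F R in generic V. f R \<noteq> 0" using assms by (simp add: nonzero_rational_def)
  then have "\<forall>\<^sub>F R in generic V. f R powi n \<noteq> 0" by eventually_elim simp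
  then show ?thesis using assms rational_power_int by (simp add: nonzero_rational_def)
qed

lemma nonzero_rational_prod:
  "(\<And>i. i \<in> I \<Longrightarrow> nonzero_rational (f i)) \<Longrightarrow> nonzero_rational (\<lambda>R. \<Prod>i\<in>I. f i R)"
  by (induction I rule: infinite_finite_induct)
    (auto intro: nonzero_rational_mult nonzero_rational_unit regular_at_const
      simp: nonzero_rational_def[of "\<lambda>_. 1"])

lemma nonzero_rational_cong:
  assumes "nonzero_rational f" "\<forall>\<^sub>F R in generic V. f R = g R"
  shows "nonzero_rational g"
proof -
  have "\<forall>\<^sub>F R in generic V. f R \<noteq> 0" using assms(1) by (simp add: nonzero_rational_def)
  then have "\<forall>\<^sub>F R in generic V. g R \<noteq> 0" using assms(2) by eventually_elim simp
  then show ?thesis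
    using rational_cong[OF _ assms(2)] assms(1) by (simp add: nonzero_rational_def)
qed

lemma ratfun_int_pow:
  assumes "nonzero_rational t"
  shows "ratfun_class V t [^]\<^bsub>function_field V\<^esub> (n::int) = ratfun_class V (\<lambda>R. t R powi n)"
proof -
  interpret F: cring "function_field V" by (rule cring_function_field)
  have t: "rational V t" using assms by (simp add: nonzero_rational_def)
  have nat: "ratfun_class V t [^]\<^bsub>function_field V\<^esub> (m::nat) = ratfun_class V (\<lambda>R. t R ^ m)" for m
    by (induction m) (simp_all add: ratfun_one ratfun_mult t rational_power mult.commute)
  show ?thesis
  proof (cases "n < 0")
    case False
    then show ?thesis by (simp add: int_pow_def2 nat power_int_def)
  next
    case True
    have "\<forall>\<^sub>F R in generic V. t R ^ nat (- n) * t R powi n = 1"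
      using assms[unfolded nonzero_rational_def, THEN conjunct2]
      by eventually_elim (use True in \<open>simp add: power_int_def power_inverse\<close>)
    then have "ratfun_class V (\<lambda>R. t R ^ nat (- n)) \<otimes>\<^bsub>function_field V\<^esub> ratfun_class V (\<lambda>R. t R powi n)
        = \<one>\<^bsub>function_field V\<^esub>"
      by (simp add: ratfun_mult ratfun_one t rational_power rational_power_int rational_mult ratfun_class_eq_iff)
    then have "inv\<^bsub>function_field V\<^esub> (ratfun_class V (\<lambda>R. t R ^ nat (- n))) = ratfun_class V (\<lambda>R. t R powi n)"
      by (intro F.comm_inv_char)
        (auto simp: carrier_function_field t rational_power rational_power_int)
    then show ?thesis using True by (simp add: int_pow_def2 nat)
  qed
qed

text \<open>Two generators of the maximal ideal divide each other, and the quotients are units. This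
  makes \<open>ord_at\<close> and \<open>ram_index\<close>, both definite descriptions over all
  uniformisers, independent of the choice.\<close>

lemma generates_max_ideal_iff:
  assumes t: "uniformizing P t"
  shows "generates_max_ideal P s \<longleftrightarrow>
    (\<exists>w. regular_at V P w \<and> w P \<noteq> 0 \<and> rational V s \<and> regular_at V P s \<and> (\<forall>\<^sub>F R in generic V. s R = w R * t R))"
proof -
  have tv: "regular_at V P t" "t P = 0" "\<forall>\<^sub>F R in generic V. t R \<noteq> 0"
    using t by (auto simp: uniformizing_def vanishing_at_def)
  have P: "P \<in> V" using tv regular_at_mem by blast
  have tgen: "\<exists>g. regular_at V P g \<and> (\<forall>\<^sub>F R in generic V. f R = g R * t R)" if f: "vanishing_at P f" for f
  proof (cases "\<forall>\<^sub>F R in generic V. f R = 0")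
    case True
    then show ?thesis using regular_at_const[OF P, of 0] by (intro exI[of _ "\<lambda>_. 0"]) simp
  next
    case False
    then obtain n u where u: "regular_at V P u" "u P \<noteq> 0" "\<forall>\<^sub>F R in generic V. f R = u R * t R powi n"
      using t[unfolded uniformizing_def, THEN conjunct2, THEN conjunct2, rule_format, of f] f
        rationalI[of V P f] by (auto simp: vanishing_at_def)
    \<comment> \<open>With a nonpositive exponent, \<open>u = f t^(-n)\<close> would vanish at
      \<open>P\<close> together with \<open>f\<close>.\<close>
    have "n \<ge> 1"
    proof (rule ccontr)
      assume "\<not> n \<ge> 1"
      then have n: "n \<le> 0" by simp
      have "\<forall>\<^sub>F R in generic V. u R = f R * t R ^ nat (- n)"
        using u(3) tv(3)
        by eventually_elim (simp add: mult.assoc powi_nonpos_cancel[OF _ n])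
      then have "u P = f P * t P ^ nat (- n)"
        using f u(1) tv(1) by (intro regular_at_eqD regular_at_mult regular_at_power) (auto simp: vanishing_at_def)
      then show False using u(2) f by (simp add: vanishing_at_def)
    qed
    have "\<forall>\<^sub>F R in generic V. f R = (u R * t R ^ nat (n - 1)) * t R"
      using u(3) tv(3) by eventually_elim (simp add: powi_split[OF _ \<open>n \<ge> 1\<close>])
    then show ?thesis using u(1) tv(1)
      by (intro exI[of _ "\<lambda>R. u R * t R ^ nat (n - 1)"]) (auto intro: regular_at_mult regular_at_power)
  qed
  show ?thesis
  proof
    assume s: "generates_max_ideal P s"
    then have sv: "regular_at V P s" "s P = 0" by (auto simp: generates_max_ideal_def vanishing_at_def)
    obtain w where w: "regular_at V P w" "\<forall>\<^sub>F R in generic V. s R = w R * t R"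
      using tgen sv by (auto simp: vanishing_at_def)
    obtain w' where w': "regular_at V P w'" "\<forall>\<^sub>F R in generic V. t R = w' R * s R"
      using s tv by (auto simp: generates_max_ideal_def vanishing_at_def)
    have "\<forall>\<^sub>F R in generic V. w' R * w R = 1"
      using w(2) w'(2) tv(3) by eventually_elim (metis mult.assoc mult_cancel_right1)
    then have "w' P * w P = 1"
      using regular_at_eqD[OF regular_at_mult[OF w'(1) w(1)] regular_at_const[OF P]] by blast
    then show "\<exists>w. regular_at V P w \<and> w P \<noteq> 0 \<and> rational V s \<and> regular_at V P s \<and>
        (\<forall>\<^sub>F R in generic V. s R = w R * t R)"
      using w sv rationalI by force
  next
    assume "\<exists>w. regular_at V P w \<and> w P \<noteq> 0 \<and> rational V s \<and> regular_at V P s \<and>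
        (\<forall>\<^sub>F R in generic V. s R = w R * t R)"
    then obtain w where w: "regular_at V P w" "w P \<noteq> 0" "regular_at V P s"
      "\<forall>\<^sub>F R in generic V. s R = w R * t R" by blast
    have "s P = w P * t P"
      using regular_at_eqD[OF w(3) regular_at_mult[OF w(1) tv(1)] w(4)] .
    then have "vanishing_at P s" using w tv by (simp add: vanishing_at_def)
    moreover have "\<exists>g. regular_at V P g \<and> (\<forall>\<^sub>F R in generic V. f R = g R * s R)" if f: "vanishing_at P f" for f
    proof -
      obtain g where g: "regular_at V P g" "\<forall>\<^sub>F R in generic V. f R = g R * t R"
        using tgen[OF f] by blast
      have "\<forall>\<^sub>F R in generic V. f R = (g R / w R) * s R"
        using g(2) w(4) eventually_nonzero[OF w(1,2)] by eventually_elim simp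
      then show ?thesis using regular_at_divide[OF g(1) w(1,2)] by blast
    qed
    ultimately show "generates_max_ideal P s" by (simp add: generates_max_ideal_def)
  qed
qed

lemma uniformizing_generates: "uniformizing P t \<Longrightarrow> generates_max_ideal P t"
  by (subst generates_max_ideal_iff, assumption)
    (auto simp: uniformizing_def vanishing_at_def rationalI
      intro!: exI[of _ "\<lambda>_. 1"] regular_at_const dest: regular_at_mem)

text \<open>For \<open>m < n\<close>, cancelling gives \<open>u = v t^(n - m)\<close>, whose
  right-hand side vanishes at \<open>P\<close>.\<close>

lemma unit_mult_powi_unique:
  assumes t: "uniformizing P t"
    and u: "regular_at V P u" "u P \<noteq> 0" and v: "regular_at V P v" "v P \<noteq> 0"
    and eq: "\<forall>\<^sub>F R in generic V. u R * t R powi m = v R * t R powi n"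
  shows "m = n"
proof -
  have tv: "regular_at V P t" "t P = 0" "\<forall>\<^sub>F R in generic V. t R \<noteq> 0"
    using t by (auto simp: uniformizing_def vanishing_at_def)
  have False if u: "regular_at V P u" "u P \<noteq> 0" and v: "regular_at V P v" "v P \<noteq> 0"
    and eq: "\<forall>\<^sub>F R in generic V. u R * t R powi m = v R * t R powi n" and less: "m < n" for u v m n
  proof -
    have "\<forall>\<^sub>F R in generic V. u R = v R * t R ^ nat (n - m)"
      using eq tv(3)
      by eventually_elim (simp add: powi_split[OF _ less_imp_le[OF less]] mult.assoc[symmetric])
    then have "u P = v P * t P ^ nat (n - m)"
      using u v tv by (intro regular_at_eqD regular_at_mult regular_at_power) auto
    then show False using less u tv by simp
  qed
  moreover have "\<forall>\<^sub>F R in generic V. v R * t R powi n = u R * t R powi m"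
    using eq by eventually_elim simp
  ultimately have "\<not> m < n" "\<not> n < m" using u v eq by blast+
  then show ?thesis by simp
qed

lemma ord_at_eqI:
  assumes t: "uniformizing P t" and u: "regular_at V P u" "u P \<noteq> 0"
    and f: "rational V f" "\<forall>\<^sub>F R in generic V. f R = u R * t R powi n"
  shows "ord_at V P (ratfun_class V f) = n"
  unfolding ord_at_def
proof (rule the_equality)
  have tv: "regular_at V P t" "t P = 0" "\<forall>\<^sub>F R in generic V. t R \<noteq> 0"
    using t by (auto simp: uniformizing_def vanishing_at_def)
  have P: "P \<in> V" using tv regular_at_mem by blast
  have nz: "nonzero_rational t" using tv rationalI by (auto simp: nonzero_rational_def)
  have "ratfun_class V f = ratfun_class V u \<otimes>\<^bsub>function_field V\<^esub> (ratfun_class V t [^]\<^bsub>function_field V\<^esub> n)"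
    using u(1) tv(1) f
    by (simp add: ratfun_int_pow[OF nz] ratfun_mult rationalI rational_power_int ratfun_class_eqI)
  then show "\<exists>t u. uniformizer V P t \<and> u \<in> Units (local_ring V P) \<and>
      ratfun_class V f = u \<otimes>\<^bsub>function_field V\<^esub> t [^]\<^bsub>function_field V\<^esub> n"
    using u uniformizing_generates[OF t] by (auto simp: uniformizer_iff Units_local_ring[OF P])
  fix m :: int
  assume "\<exists>t u. uniformizer V P t \<and> u \<in> Units (local_ring V P) \<and>
      ratfun_class V f = u \<otimes>\<^bsub>function_field V\<^esub> t [^]\<^bsub>function_field V\<^esub> m"
  then obtain s v where s: "generates_max_ideal P s" and v: "regular_at V P v" "v P \<noteq> 0"
    and eq: "ratfun_class V f = ratfun_class V v \<otimes>\<^bsub>function_field V\<^esub> (ratfun_class V s [^]\<^bsub>function_field V\<^esub> m)"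
    by (auto simp: uniformizer_iff Units_local_ring[OF P])
  obtain w where w: "regular_at V P w" "w P \<noteq> 0" "regular_at V P s" "\<forall>\<^sub>F R in generic V. s R = w R * t R"
    using s unfolding generates_max_ideal_iff[OF t] by blast
  have "\<forall>\<^sub>F R in generic V. s R \<noteq> 0"
    using w(4) tv(3) eventually_nonzero[OF w(1,2)] by eventually_elim simp
  then have snz: "nonzero_rational s" using w(3) rationalI by (auto simp: nonzero_rational_def)
  have "\<forall>\<^sub>F R in generic V. f R = v R * s R powi m"
    using eq f(1) v(1) w(3)
    by (simp add: ratfun_int_pow[OF snz] ratfun_mult rationalI rational_power_int ratfun_class_eq_iff)
  \<comment> \<open>Replacing \<open>s\<close> by \<open>w t\<close> moves a power of the unit
    \<open>w\<close> into the unit factor; the two exponents now refer to the same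
    \<open>t\<close>.\<close>
  then have "\<forall>\<^sub>F R in generic V. (v R * w R powi m) * t R powi m = u R * t R powi n"
    using w(4) f(2) by eventually_elim (simp add: power_int_mult_distrib mult.assoc)
  moreover have "regular_at V P (\<lambda>R. v R * w R powi m)"
    unfolding power_int_def using v w
    by (cases "m \<ge> 0") (auto intro!: regular_at_mult regular_at_power regular_at_inverse)
  moreover have "v P * w P powi m \<noteq> 0" using v w by simp
  ultimately show "m = n"
    using unit_mult_powi_unique[OF t] u by blast
qed

text \<open>Both halves of the basis property enter. Existence of a coefficient says that
  \<open>t\<close> generates the maximal ideal modulo its square, as Nakayama requires; uniqueness
  excludes \<open>t = 0\<close>.\<close>

lemma cotangent_dim_one:
  assumes V: "V \<subseteq> proj_space n" and P: "P \<in> V" and cot: "cotangent_dim V P 1"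
  shows "\<exists>t. uniformizing P t"
proof -
  interpret R: cring "local_ring V P" by (rule cring_local_ring[OF P])
  obtain j where "coords P j \<noteq> 0" using coords_nonzero by blast
  then obtain L :: "'k mpol" where L: "homogeneous 1 L" "meval (coords P) L \<noteq> 0"
    using homogeneous_variable[of j] by (metis meval_variable)
  define x where "x = (\<lambda>i R. affine_coords L R i - affine_coords L P i)"
  define m2 where "m2 = ideal_prod (local_ring V P) (max_ideal V P) (max_ideal V P)"
  obtain t' where t': "t' 0 \<in> max_ideal V P"
    and ex1: "\<And>f. f \<in> max_ideal V P \<Longrightarrow> \<exists>!c. c \<in> {..<1} \<rightarrow>\<^sub>E UNIV \<and>
      f \<ominus>\<^bsub>local_ring V P\<^esub> (\<Oplus>\<^bsub>local_ring V P\<^esub>i\<in>{..<1::nat}. rat V V (\<lambda>_. c i) \<otimes>\<^bsub>local_ring V P\<^esub> t' i) \<in> m2"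
    using cot unfolding cotangent_dim_def Let_def m2_def by auto
  obtain t where t: "t' 0 = ratfun_class V t" "regular_at V P t" "t P = 0"
    using t' by (auto simp: max_ideal_eq)
  have diff: "ratfun_class V f \<ominus>\<^bsub>local_ring V P\<^esub>
      (\<Oplus>\<^bsub>local_ring V P\<^esub>i\<in>{..<1::nat}. rat V V (\<lambda>_. c i) \<otimes>\<^bsub>local_ring V P\<^esub> t' i)
      = ratfun_class V (\<lambda>R. f R - c 0 * t R)" if f: "regular_at V P f" for f c
  proof -
    have ct: "regular_at V P (\<lambda>R. c 0 * t R)"
      by (intro regular_at_mult regular_at_const P t)
    have e: "rat V V (\<lambda>_. c 0) \<otimes>\<^bsub>local_ring V P\<^esub> t' 0 = ratfun_class V (\<lambda>R. c 0 * t R)"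
      using t by (simp add: rat_const ratfun_mult rationalI rational_const)
    have mem: "ratfun_class V (\<lambda>R. c 0 * t R) \<in> carrier (local_ring V P)"
      unfolding carrier_local_ring using ct by blast
    have "(\<Oplus>\<^bsub>local_ring V P\<^esub>i\<in>{0::nat}. rat V V (\<lambda>_. c i) \<otimes>\<^bsub>local_ring V P\<^esub> t' i)
        = ratfun_class V (\<lambda>R. c 0 * t R)"
      using R.finsum_insert[of "{}" "0::nat" "\<lambda>i. rat V V (\<lambda>_. c i) \<otimes>\<^bsub>local_ring V P\<^esub> t' i"] mem
      unfolding e by (simp del: local_ring_simps)
    moreover have "{..<1::nat} = {0}" by auto
    ultimately show ?thesis
      using f ct local_ring_uminus[OF P ct]
      by (simp add: a_minus_def ratfun_add rationalI rational_uminus)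
  qed
  \<comment> \<open>An element of the square is a sum of products. Expanding the second factor in
    the coordinate differences leaves coefficients from the maximal ideal.\<close>
  have m2: "\<exists>g. y = ratfun_class V g \<and> rational V g \<and> combination (vanishing_at P) {..n} x g"
    if "y \<in> m2" for y
    using that unfolding m2_def
  proof (induction rule: ideal_prod.induct)
    case (prod a b)
    then obtain f g where f: "a = ratfun_class V f" "regular_at V P f" "f P = 0"
      and g: "b = ratfun_class V g" "regular_at V P g" "g P = 0"
      by (auto simp: max_ideal_eq)
    have "regular_combination P {..n} x g"
      using vanishing_at_generators[OF V L g(2)] g(3) by (simp add: x_def)
    then have "combination (vanishing_at P) {..n} x (\<lambda>R. f R * g R)"
      by (rule combination_mult) (use f in \<open>auto simp: vanishing_at_def intro: regular_at_mult\<close>)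
    moreover have "a \<otimes>\<^bsub>local_ring V P\<^esub> b = ratfun_class V (\<lambda>R. f R * g R)"
      using f g by (simp add: ratfun_mult rationalI)
    ultimately show ?case
      using rational_mult[OF rationalI[OF f(2)] rationalI[OF g(2)]]
      by (intro exI[of _ "\<lambda>R. f R * g R"]) simp
  next
    case (sum a b)
    then obtain f g where f: "a = ratfun_class V f" "rational V f" "combination (vanishing_at P) {..n} x f"
      and g: "b = ratfun_class V g" "rational V g" "combination (vanishing_at P) {..n} x g"
      by blast
    have "combination (vanishing_at P) {..n} x (\<lambda>R. f R + g R)"
      by (rule combination_add[OF f(3) g(3)]) (auto simp: vanishing_at_def intro: regular_at_add)
    then show ?case
      using ratfun_add[OF f(2) g(2)] rational_add[OF f(2) g(2)] f(1) g(1)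
      by (intro exI[of _ "\<lambda>R. f R + g R"]) simp
  qed
  have comb: "\<exists>c. combination (vanishing_at P) {..n} x (\<lambda>R. f R - c * t R)" if f: "vanishing_at P f" for f
  proof -
    have fr: "regular_at V P f" "ratfun_class V f \<in> max_ideal V P"
      using f by (auto simp: vanishing_at_def max_ideal_eq)
    obtain c :: "nat \<Rightarrow> 'k" where c: "ratfun_class V (\<lambda>R. f R - c 0 * t R) \<in> m2"
      using ex1_implies_ex[OF ex1[OF fr(2)]] unfolding diff[OF fr(1)] by (elim exE conjE)
    then obtain g where g: "ratfun_class V (\<lambda>R. f R - c 0 * t R) = ratfun_class V g"
      "rational V g" "combination (vanishing_at P) {..n} x g"
      using m2[OF c] by (elim exE conjE)
    have "\<forall>\<^sub>F R in generic V. g R = f R - c 0 * t R"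
      by (rule iffD1[OF ratfun_class_eq_iff[OF g(2)] g(1)[symmetric]])
    from combination_cong[OF g(3) this] show ?thesis by (rule exI)
  qed
  have gen: "generates_max_ideal P t"
    using comb t by (intro cotangent_generator[OF V P _ _ L]) (auto simp: vanishing_at_def x_def)
  \<comment> \<open>For a generically zero \<open>t\<close> every coefficient would represent the
    class of \<open>0\<close>, in particular both \<open>0\<close> and \<open>1\<close>.\<close>
  have "\<not> (\<forall>\<^sub>F R in generic V. t R = 0)"
  proof
    assume t0: "\<forall>\<^sub>F R in generic V. t R = 0"
    have z: "regular_at V P (\<lambda>_. 0)" "ratfun_class V (\<lambda>_. 0) \<in> max_ideal V P"
      using regular_at_const[OF P] by (auto simp: max_ideal_eq)
    have eq: "ratfun_class V (\<lambda>R. 0 - c * t R) = ratfun_class V (\<lambda>_. 0)" for c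
    proof (rule ratfun_class_eqI[symmetric])
      show "\<forall>\<^sub>F R in generic V. 0 = 0 - c * t R"
        using t0 by eventually_elim simp
    qed auto
    from ex1[OF z(2)] have ex: "\<exists>!c. c \<in> {..<1::nat} \<rightarrow>\<^sub>E (UNIV :: 'k set) \<and> ratfun_class V (\<lambda>_. 0) \<in> m2"
      unfolding diff[OF z(1)] eq .
    then have z2: "ratfun_class V (\<lambda>_. 0) \<in> m2" by (elim ex1E conjE)
    from ex obtain c where "\<forall>d. d \<in> {..<1::nat} \<rightarrow>\<^sub>E (UNIV :: 'k set) \<and> ratfun_class V (\<lambda>_. 0) \<in> m2 \<longrightarrow> d = c"
      by (elim ex1E)
    from this[rule_format, of "\<lambda>i\<in>{..<1}. 0"] this[rule_format, of "\<lambda>i\<in>{..<1}. 1"] z2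
    have "(\<lambda>i\<in>{..<1::nat}. 0 :: 'k) = (\<lambda>i\<in>{..<1}. 1)"
      by simp
    then show False by (auto dest: fun_cong[of _ _ "0::nat"])
  qed
  then have "\<forall>\<^sub>F R in generic V. t R \<noteq> 0"
    using rational_not_zero[OF rationalI[OF t(2)]] by blast
  then show ?thesis using uniformizingI[OF V gen] by blast
qed

end

text \<open>Regularity in dimension one, expressed by uniformisers. The same locale thus serves
  \<open>V\<close>, where they come from the cotangent spaces, and \<open>Y\<close>, where they are
  descended from invariant functions.\<close>

locale curve = irreducible_space +
  assumes uniformizing_exists: "P \<in> V \<Longrightarrow> \<exists>t. uniformizing P t"
begin

abbreviation vanishing_order :: "'a proj \<Rightarrow> ('a proj \<Rightarrow> 'a) \<Rightarrow> int" where
  "vanishing_order P f \<equiv> ord_at V P (ratfun_class V f)"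

lemma uniformizing_order:
  assumes "uniformizing P t" "nonzero_rational f"
  shows "\<exists>u. regular_at V P u \<and> u P \<noteq> 0 \<and> (\<forall>\<^sub>F R in generic V. f R = u R * t R powi vanishing_order P f)"
proof -
  obtain n u where u: "regular_at V P u" "u P \<noteq> 0" "\<forall>\<^sub>F R in generic V. f R = u R * t R powi n"
    using assms(1)[unfolded uniformizing_def, THEN conjunct2, THEN conjunct2, rule_format, of f]
      nonzero_rational_not_zero[OF assms(2)] assms(2)[unfolded nonzero_rational_def] by auto
  then have "vanishing_order P f = n"
    using ord_at_eqI[OF assms(1)] assms(2) by (auto simp: nonzero_rational_def)
  then show ?thesis using u by blast
qed

lemma order_mult:
  assumes "P \<in> V" "nonzero_rational f" "nonzero_rational g"
  shows "vanishing_order P (\<lambda>R. f R * g R) = vanishing_order P f + vanishing_order P g"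
proof -
  obtain t where t: "uniformizing P t" using uniformizing_exists[OF assms(1)] by blast
  obtain u v where u: "regular_at V P u" "u P \<noteq> 0" "\<forall>\<^sub>F R in generic V. f R = u R * t R powi vanishing_order P f"
    and v: "regular_at V P v" "v P \<noteq> 0" "\<forall>\<^sub>F R in generic V. g R = v R * t R powi vanishing_order P g"
    using uniformizing_order[OF t assms(2)] uniformizing_order[OF t assms(3)] by auto
  have tnz: "\<forall>\<^sub>F R in generic V. t R \<noteq> 0" using t by (simp add: uniformizing_def)
  have "\<forall>\<^sub>F R in generic V. f R * g R = (u R * v R) * t R powi (vanishing_order P f + vanishing_order P g)"
    using u(3) v(3) tnz by eventually_elim (simp add: power_int_add)
  then show ?thesis
    using u v assms by (intro ord_at_eqI[OF t]) (auto intro: regular_at_mult simp: nonzero_rational_def)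
qed

lemma order_unit: "regular_at V P u \<Longrightarrow> u P \<noteq> 0 \<Longrightarrow> vanishing_order P u = 0"
  using uniformizing_exists[of P] regular_at_mem[of V P u] ord_at_eqI[of P _ u u 0] by (auto simp: rationalI)

lemma order_inverse:
  assumes "P \<in> V" "nonzero_rational f"
  shows "vanishing_order P (\<lambda>R. inverse (f R)) = - vanishing_order P f"
proof -
  have "\<forall>\<^sub>F R in generic V. f R * inverse (f R) = 1"
    using assms(2)[unfolded nonzero_rational_def, THEN conjunct2] by eventually_elim simp
  then have "ratfun_class V (\<lambda>R. f R * inverse (f R)) = ratfun_class V (\<lambda>_. 1)"
    using assms(2) by (intro ratfun_class_eqI) (auto simp: nonzero_rational_def)
  then show ?thesis
    using order_mult[OF assms nonzero_rational_inverse[OF assms(2)]]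
      order_unit[OF regular_at_const[OF assms(1)], of 1] by simp
qed

lemma order_prod:
  assumes "P \<in> V" "\<And>i. i \<in> I \<Longrightarrow> nonzero_rational (f i)"
  shows "vanishing_order P (\<lambda>R. \<Prod>i\<in>I. f i R) = (\<Sum>i\<in>I. vanishing_order P (f i))"
  using assms(2)
proof (induction I rule: infinite_finite_induct)
  case (insert i I)
  then show ?case
    using order_mult[OF assms(1), of "f i" "\<lambda>R. \<Prod>i\<in>I. f i R"] nonzero_rational_prod[of I f] by simp
qed (use order_unit[OF regular_at_const[OF assms(1)], of 1] in simp_all)

lemma order_power:
  assumes "P \<in> V" "nonzero_rational f"
  shows "vanishing_order P (\<lambda>R. f R ^ n) = int n * vanishing_order P f"
  using order_prod[OF assms(1), of "{..<n}" "\<lambda>_. f"] assms(2) by simp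

lemma order_powi:
  assumes "P \<in> V" "nonzero_rational f"
  shows "vanishing_order P (\<lambda>R. f R powi n) = n * vanishing_order P f"
proof (cases "n \<ge> 0")
  case True
  then show ?thesis using order_power[OF assms, of "nat n"] by (simp add: power_int_def)
next
  case False
  then show ?thesis
    using order_power[OF assms(1) nonzero_rational_inverse[OF assms(2)], of "nat (- n)"] order_inverse[OF assms]
    by (simp add: power_int_def)
qed

lemma order_cong:
  "rational V f \<Longrightarrow> \<forall>\<^sub>F R in generic V. f R = g R \<Longrightarrow> vanishing_order P f = vanishing_order P g"
  using ratfun_class_eqI by simp

lemma order_eq_zero:
  assumes "P \<in> V" "nonzero_rational f" "vanishing_order P f = 0"
  shows "\<exists>u. regular_at V P u \<and> u P \<noteq> 0 \<and> (\<forall>\<^sub>F R in generic V. f R = u R)"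
  using uniformizing_order[OF _ assms(2), of P] uniformizing_exists[OF assms(1)] assms(3) by auto

text \<open>Since \<open>f\<close> matters only generically, its own value at \<open>P\<close>
  carries no information; the vanishing at \<open>P\<close> is asserted of a regular representative
  \<open>u\<close>.\<close>

lemma order_pos:
  assumes "P \<in> V" "nonzero_rational f" "vanishing_order P f > 0"
  shows "\<exists>u. regular_at V P u \<and> u P = 0 \<and> (\<forall>\<^sub>F R in generic V. f R = u R)"
proof -
  obtain t where t: "uniformizing P t" using uniformizing_exists[OF assms(1)] by blast
  obtain u where u: "regular_at V P u" "u P \<noteq> 0"
    "\<forall>\<^sub>F R in generic V. f R = u R * t R powi vanishing_order P f"
    using uniformizing_order[OF t assms(2)] by blast
  then show ?thesis
    using assms(3) t
    by (intro exI[of _ "\<lambda>R. u R * t R ^ nat (vanishing_order P f)"])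
      (auto simp: power_int_def uniformizing_def vanishing_at_def intro!: regular_at_mult regular_at_power)
qed

text \<open>At a pole \<open>1/f\<close> would agree generically with some \<open>u\<close>
  vanishing at \<open>P\<close>, and \<open>f u = 1\<close> could be evaluated there.\<close>

lemma order_nonneg:
  assumes "regular_at V P f" "nonzero_rational f"
  shows "vanishing_order P f \<ge> 0" "f P = 0 \<Longrightarrow> vanishing_order P f > 0"
proof -
  have P: "P \<in> V" using assms regular_at_mem by blast
  show ge: "vanishing_order P f \<ge> 0"
  proof (rule ccontr)
    assume "\<not> vanishing_order P f \<ge> 0"
    then have "vanishing_order P (\<lambda>R. inverse (f R)) > 0"
      using order_inverse[OF P assms(2)] by simp
    then obtain u where u: "regular_at V P u" "u P = 0" "\<forall>\<^sub>F R in generic V. inverse (f R) = u R"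
      using order_pos[OF P nonzero_rational_inverse[OF assms(2)]] by blast
    have "\<forall>\<^sub>F R in generic V. f R * u R = 1"
      using u(3) assms(2)[unfolded nonzero_rational_def, THEN conjunct2]
      by eventually_elim (metis right_inverse)
    then have "f P * u P = 1"
      using regular_at_eqD[OF regular_at_mult[OF assms(1) u(1)] regular_at_const[OF P]] by blast
    then show False using u(2) by simp
  qed
  assume f: "f P = 0"
  have "vanishing_order P f \<noteq> 0"
  proof
    assume "vanishing_order P f = 0"
    then obtain u where u: "regular_at V P u" "u P \<noteq> 0" "\<forall>\<^sub>F R in generic V. f R = u R"
      using order_eq_zero[OF P assms(2)] by blast
    then show False using regular_at_eqD[OF assms(1)] f by metis
  qed
  with ge show "vanishing_order P f > 0" by simp
qed

lemma uniformizing_order_one: "uniformizing P t \<Longrightarrow> vanishing_order P t = 1"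
  using ord_at_eqI[of P t "\<lambda>_. 1" t 1] regular_at_const[of P V 1] regular_at_mem[of V P t]
  by (auto simp: uniformizing_def vanishing_at_def rationalI)

lemma uniformizing_nonzero: "uniformizing P t \<Longrightarrow> nonzero_rational t"
  by (auto simp: uniformizing_def vanishing_at_def rationalI nonzero_rational_def)

end

lemma smooth_projective_curve_curve:
  assumes "smooth_projective_curve V"
  shows "curve V"
proof -
  have V: "irreducible_set V" "krull_dim V = 1" "smooth_variety V"
    using assms by (auto simp: smooth_projective_curve_def projective_variety_def)
  obtain n where n: "V \<subseteq> proj_space n"
    using assms by (auto simp: smooth_projective_curve_def projective_variety_def)
  interpret irreducible_space V by unfold_locales (rule V)
  show ?thesis
  proof
    fix P assume P: "P \<in> V"
    then obtain d where "krull_dim V = enat d" "cotangent_dim V P d"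
      using V(3) by (auto simp: smooth_variety_def)
    then have "cotangent_dim V P 1" using V(2) by (simp add: one_enat_def)
    then show "\<exists>t. uniformizing P t" using cotangent_dim_one[OF n P] by blast
  qed
qed

section \<open>Pullback along morphisms\<close>

lemma morphism_preimage_open:
  assumes "morphism V W \<phi>" "openin (zar W) U"
  shows "openin (zar V) (V \<inter> \<phi> -` U)"
proof -
  have "openin (zar V) {P \<in> topspace (zar V). \<phi> P \<in> U}"
    using assms openin_continuous_map_preimage by (fastforce simp: morphism_def)
  then show ?thesis by (simp add: Int_def)
qed

lemma morphism_mem: "morphism V W \<phi> \<Longrightarrow> P \<in> V \<Longrightarrow> \<phi> P \<in> W"
  unfolding morphism_def using continuous_map_image_subset_topspace[of "zar V" "zar W" \<phi>] by auto

lemma morphism_regular_at: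
  assumes "morphism V W \<phi>" "P \<in> V" "regular_at W (\<phi> P) f"
  shows "regular_at V P (\<lambda>R. f (\<phi> R))"
proof -
  obtain U where U: "openin (zar W) U" "\<phi> P \<in> U" "\<forall>Q\<in>U. regular_at W Q f"
    using regular_at_nhd[OF assms(3)] by blast
  then have "regular_fun U f" by (simp add: regular_fun_iff)
  then have "regular_fun (V \<inter> \<phi> -` U) (f \<circ> \<phi>)"
    using assms(1) U(1) by (simp add: morphism_def)
  then show ?thesis
    using regular_fun_iff[OF morphism_preimage_open[OF assms(1) U(1)]] assms(2) U(2)
    by (auto simp: comp_def)
qed

text \<open>Dominance is phrased through open sets because this is what carries the filter of
  \<open>V\<close> to that of \<open>W\<close>: generic identities and rational functions can then
  be pulled back.\<close>

locale dominant = V: irreducible_space V + W: irreducible_space W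
  for V W :: "'k::field proj set" +
  fixes \<phi> :: "'k proj \<Rightarrow> 'k proj"
  assumes morphism: "morphism V W \<phi>"
    and dominant: "openin (zar W) U \<Longrightarrow> U \<noteq> {} \<Longrightarrow> V \<inter> \<phi> -` U \<noteq> {}"
begin

lemma eventually_pullback:
  assumes "eventually A (generic W)"
  shows "\<forall>\<^sub>F P in generic V. A (\<phi> P)"
proof -
  obtain U where U: "openin (zar W) U" "U \<noteq> {}" "\<forall>P\<in>U. A P"
    using assms by (auto simp: W.eventually_generic)
  have "V \<inter> \<phi> -` U \<noteq> {}" using dominant[OF U(1,2)] .
  then show ?thesis
    unfolding V.eventually_generic using morphism_preimage_open[OF morphism U(1)] U(3)
    by (intro exI[of _ "V \<inter> \<phi> -` U"]) auto
qed

lemma rational_pullback: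
  assumes "rational W f"
  shows "rational V (\<lambda>P. f (\<phi> P))"
proof -
  have "\<forall>\<^sub>F P in generic V. regular_at W (\<phi> P) f"
    by (rule eventually_pullback[OF W.eventually_regular[OF assms]])
  then obtain P where "P \<in> V" "regular_at W (\<phi> P) f"
    using V.eventually_ex by blast
  then show ?thesis
    using morphism_regular_at[OF morphism] rationalI by blast
qed

lemma nonzero_rational_pullback:
  "W.nonzero_rational f \<Longrightarrow> V.nonzero_rational (\<lambda>P. f (\<phi> P))"
  unfolding W.nonzero_rational_def V.nonzero_rational_def
  by (simp add: rational_pullback eventually_pullback[of "\<lambda>R. f R \<noteq> 0"])

text \<open>Pullback of rational functions is injective, since a nonzero difference on
  \<open>W\<close> stays nonzero on \<open>V\<close>. This brings identities found on
  \<open>V\<close> down to \<open>Y\<close>.\<close>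

lemma eventually_eq_pullback_iff:
  assumes "rational W f" "rational W g"
  shows "(\<forall>\<^sub>F P in generic V. f (\<phi> P) = g (\<phi> P)) \<longleftrightarrow> (\<forall>\<^sub>F P in generic W. f P = g P)"
proof
  assume e: "\<forall>\<^sub>F P in generic V. f (\<phi> P) = g (\<phi> P)"
  have "rational W (\<lambda>P. f P - g P)" using assms by blast
  then show "\<forall>\<^sub>F P in generic W. f P = g P"
  proof (cases rule: W.rational_cases)
    case 1
    then show ?thesis by simp
  next
    case 2
    have "\<forall>\<^sub>F P in generic V. False"
      using e eventually_pullback[OF 2] by eventually_elim simp
    then show ?thesis by simp
  qed
next
  assume "\<forall>\<^sub>F P in generic W. f P = g P"
  then show "\<forall>\<^sub>F P in generic V. f (\<phi> P) = g (\<phi> P)"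
    by (rule eventually_pullback)
qed

lemma pullback_rat_class:
  assumes "rational W f"
  shows "pullback_rat V W \<phi> (ratfun_class W f) = ratfun_class V (\<lambda>P. f (\<phi> P))"
  unfolding pullback_rat_def
proof (rule W.UN_ratfun_class[OF assms])
  fix U g assume "(U, g) \<in> ratfun_class W f"
  then have U: "openin (zar W) U" "U \<noteq> {}" "\<forall>P\<in>U. regular_at W P g"
    and e: "\<forall>\<^sub>F P in generic W. f P = g P"
    by (auto simp: W.mem_ratfun_class rat_pairs_iff)
  have "(V \<inter> \<phi> -` U, g \<circ> \<phi>) \<in> rat_pairs V"
    using U morphism_preimage_open[OF morphism U(1)] dominant[OF U(1,2)] morphism_regular_at[OF morphism]
    by (auto simp: rat_pairs_iff comp_def)
  then have "rat V (V \<inter> \<phi> -` U) (g \<circ> \<phi>) = ratfun_class V (\<lambda>P. g (\<phi> P))"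
    by (simp add: V.rat_eq comp_def)
  also have "\<dots> = ratfun_class V (\<lambda>P. f (\<phi> P))"
    using V.ratfun_class_eqI[OF rational_pullback[OF assms] eventually_pullback[OF e]] by simp
  finally show "rat V (V \<inter> \<phi> -` U) (g \<circ> \<phi>) = ratfun_class V (\<lambda>P. f (\<phi> P))" .
qed

end

locale dominant_curves = dominant V W \<phi> + V: curve V + W: curve W
  for V W :: "'k::field proj set" and \<phi>
begin

lemma order_pullback:
  assumes P: "P \<in> V" and t: "W.uniformizing (\<phi> P) t" and f: "W.nonzero_rational f"
  shows "V.vanishing_order P (\<lambda>R. f (\<phi> R)) =
    V.vanishing_order P (\<lambda>R. t (\<phi> R)) * W.vanishing_order (\<phi> P) f"
proof -
  define n where "n = W.vanishing_order (\<phi> P) f"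
  obtain u where u: "regular_at W (\<phi> P) u" "u (\<phi> P) \<noteq> 0"
    "\<forall>\<^sub>F R in generic W. f R = u R * t R powi n"
    using W.uniformizing_order[OF t f] unfolding n_def by blast
  have tn: "W.nonzero_rational t"
    using t rationalI by (auto simp: W.uniformizing_def W.vanishing_at_def W.nonzero_rational_def)
  have tV: "V.nonzero_rational (\<lambda>R. t (\<phi> R))" by (rule nonzero_rational_pullback[OF tn])
  have uP: "regular_at V P (\<lambda>R. u (\<phi> R))" by (rule morphism_regular_at[OF morphism P u(1)])
  have "V.vanishing_order P (\<lambda>R. f (\<phi> R)) = V.vanishing_order P (\<lambda>R. u (\<phi> R) * t (\<phi> R) powi n)"
    using rational_pullback f eventually_pullback[OF u(3)] by (intro V.order_cong) (auto simp: W.nonzero_rational_def)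
  also have "\<dots> = V.vanishing_order P (\<lambda>R. u (\<phi> R)) + V.vanishing_order P (\<lambda>R. t (\<phi> R) powi n)"
    using V.nonzero_rational_unit[OF uP] u(2) V.nonzero_rational_powi[OF tV] by (intro V.order_mult P) auto
  also have "\<dots> = n * V.vanishing_order P (\<lambda>R. t (\<phi> R))"
    using V.order_unit[OF uP] u(2) V.order_powi[OF P tV] by simp
  finally show ?thesis by (simp add: n_def)
qed

end

section \<open>A finite group acting on a curve\<close>

text \<open>The group laws are stated for extensional maps, the form in which the deck group
  realises them; \<open>N\<close> bounds the number of homogeneous coordinates on
  \<open>V\<close>.\<close>

locale curve_group = curve V
  for V :: "'k::alg_closed_field proj set" +
  fixes K :: "('k proj \<Rightarrow> 'k proj) set" and N :: nat
  assumes in_proj_space: "V \<subseteq> proj_space N"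
    and finite_K: "finite K"
    and K_Bij: "\<sigma> \<in> K \<Longrightarrow> \<sigma> \<in> Bij V"
    and K_morphism: "\<sigma> \<in> K \<Longrightarrow> morphism V V \<sigma>"
    and K_compose: "\<sigma> \<in> K \<Longrightarrow> \<tau> \<in> K \<Longrightarrow> compose V \<sigma> \<tau> \<in> K"
    and K_id: "(\<lambda>P\<in>V. P) \<in> K"
    and K_inv: "\<sigma> \<in> K \<Longrightarrow> restrict (inv_into V \<sigma>) V \<in> K"
begin

lemma K_bij_betw: "\<sigma> \<in> K \<Longrightarrow> bij_betw \<sigma> V V"
  using K_Bij by (auto simp: Bij_def)

lemma K_mem: "\<sigma> \<in> K \<Longrightarrow> P \<in> V \<Longrightarrow> \<sigma> P \<in> V"
  using K_bij_betw bij_betwE by blast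

lemma K_inverse:
  assumes "\<sigma> \<in> K"
  obtains \<tau> where "\<tau> \<in> K" "\<And>P. P \<in> V \<Longrightarrow> \<sigma> (\<tau> P) = P" "\<And>P. P \<in> V \<Longrightarrow> \<tau> (\<sigma> P) = P"
proof (rule that[OF K_inv[OF assms]])
  have b: "inj_on \<sigma> V" "\<sigma> ` V = V" using K_bij_betw[OF assms] by (auto simp: bij_betw_def)
  fix P assume P: "P \<in> V"
  show "\<sigma> (restrict (inv_into V \<sigma>) V P) = P"
    using P b by (simp add: f_inv_into_f)
  show "restrict (inv_into V \<sigma>) V (\<sigma> P) = P"
    using P b K_mem[OF assms P] by (simp add: inv_into_f_f)
qed

lemma K_eqI: "\<sigma> \<in> K \<Longrightarrow> \<tau> \<in> K \<Longrightarrow> (\<And>P. P \<in> V \<Longrightarrow> \<sigma> P = \<tau> P) \<Longrightarrow> \<sigma> = \<tau>"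
  using K_Bij Bij_imp_extensional by (metis extensionalityI)

lemma dominant_K:
  assumes "\<sigma> \<in> K"
  shows "dominant_curves V V \<sigma>"
proof unfold_locales
  show "morphism V V \<sigma>" by (rule K_morphism[OF assms])
  fix U assume U: "openin (zar V) U" "U \<noteq> {}"
  obtain \<tau> where \<tau>: "\<tau> \<in> K" "\<And>P. P \<in> V \<Longrightarrow> \<sigma> (\<tau> P) = P" using K_inverse[OF assms] by metis
  obtain P where "P \<in> U" using U(2) by blast
  then show "V \<inter> \<sigma> -` U \<noteq> {}"
    using \<tau> K_mem openin_zar_subset[OF U(1)] by fastforce
qed

text \<open>With \<open>\<tau>\<close> inverse to \<open>\<sigma>\<close>, a uniformiser
  \<open>s\<close> at \<open>P\<close> equals \<open>s o \<tau> o \<sigma>\<close>. Thus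
  \<open>1\<close> is a product of two integers, one of them the order of
  \<open>t o \<sigma>\<close>; being nonnegative, that order is \<open>1\<close>.\<close>

lemma order_automorphism:
  assumes "\<sigma> \<in> K" "P \<in> V" "nonzero_rational f"
  shows "vanishing_order P (\<lambda>R. f (\<sigma> R)) = vanishing_order (\<sigma> P) f"
proof -
  interpret \<sigma>: dominant_curves V V \<sigma> by (rule dominant_K[OF assms(1)])
  obtain \<tau> where \<tau>: "\<tau> \<in> K" "\<And>P. P \<in> V \<Longrightarrow> \<sigma> (\<tau> P) = P" "\<And>P. P \<in> V \<Longrightarrow> \<tau> (\<sigma> P) = P"
    using K_inverse[OF assms(1)] by metis
  interpret \<tau>: dominant_curves V V \<tau> by (rule dominant_K[OF \<tau>(1)])
  have \<sigma>P: "\<sigma> P \<in> V" by (rule K_mem[OF assms(1,2)])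
  obtain t where t: "uniformizing (\<sigma> P) t" using uniformizing_exists[OF \<sigma>P] by blast
  obtain s where s: "uniformizing P s" using uniformizing_exists[OF assms(2)] by blast
  have \<tau>\<sigma>: "\<tau> (\<sigma> P) = P" using \<tau>(3) assms(2) by blast
  have st: "nonzero_rational (\<lambda>R. s (\<tau> R))" by (rule \<tau>.nonzero_rational_pullback[OF uniformizing_nonzero[OF s]])
  have "1 = vanishing_order P (\<lambda>R. s (\<tau> (\<sigma> R)))"
  proof -
    have "\<forall>\<^sub>F R in generic V. s R = s (\<tau> (\<sigma> R))"
      using eventually_mem by eventually_elim (simp add: \<tau>(3))
    then show ?thesis using order_cong[of s "\<lambda>R. s (\<tau> (\<sigma> R))" P] uniformizing_nonzero[OF s] uniformizing_order_one[OF s]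
      by (simp add: nonzero_rational_def)
  qed
  also have "\<dots> = vanishing_order P (\<lambda>R. t (\<sigma> R)) * vanishing_order (\<sigma> P) (\<lambda>R. s (\<tau> R))"
    by (rule \<sigma>.order_pullback[OF assms(2) t st])
  finally have "vanishing_order P (\<lambda>R. t (\<sigma> R)) dvd 1" by (metis dvd_triv_left)
  moreover have "vanishing_order P (\<lambda>R. t (\<sigma> R)) \<ge> 0"
    using t morphism_regular_at[OF K_morphism[OF assms(1)] assms(2)] \<sigma>.nonzero_rational_pullback[OF uniformizing_nonzero[OF t]]
    by (intro order_nonneg) (auto simp: uniformizing_def vanishing_at_def)
  ultimately have "vanishing_order P (\<lambda>R. t (\<sigma> R)) = 1" by auto
  then show ?thesis using \<sigma>.order_pullback[OF assms(2) t assms(3)] by simp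
qed

lemma bij_betw_compose_right:
  assumes "\<tau> \<in> K"
  shows "bij_betw (\<lambda>\<sigma>. compose V \<sigma> \<tau>) K K"
proof -
  have "inj_on (\<lambda>\<sigma>. compose V \<sigma> \<tau>) K"
  proof (rule inj_onI)
    fix \<sigma> \<rho> assume K: "\<sigma> \<in> K" "\<rho> \<in> K" and eq: "compose V \<sigma> \<tau> = compose V \<rho> \<tau>"
    obtain \<tau>' where \<tau>': "\<tau>' \<in> K" "\<And>P. P \<in> V \<Longrightarrow> \<tau> (\<tau>' P) = P" using K_inverse[OF assms] by metis
    show "\<sigma> = \<rho>"
    proof (rule K_eqI[OF K])
      fix P assume P: "P \<in> V"
      have "compose V \<sigma> \<tau> (\<tau>' P) = compose V \<rho> \<tau> (\<tau>' P)" using eq by simp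
      then show "\<sigma> P = \<rho> P" using K_mem[OF \<tau>'(1) P] \<tau>'(2)[OF P] by (simp add: compose_def)
    qed
  qed
  moreover have "(\<lambda>\<sigma>. compose V \<sigma> \<tau>) ` K \<subseteq> K" using K_compose assms by blast
  ultimately show ?thesis
    using finite_K by (simp add: bij_betw_def endo_inj_surj)
qed

lemma prod_K_shift:
  assumes "\<tau> \<in> K" "P \<in> V"
  shows "(\<Prod>\<sigma>\<in>K. F (\<sigma> (\<tau> P))) = (\<Prod>\<sigma>\<in>K. F (\<sigma> P))"
  using prod.reindex_bij_betw[OF bij_betw_compose_right[OF assms(1)], of "\<lambda>\<sigma>. F (\<sigma> P)"] assms(2)
  by (simp add: compose_def)

section \<open>Orbits and stabilisers\<close>

definition stabiliser :: "'k proj \<Rightarrow> ('k proj \<Rightarrow> 'k proj) set" where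
  "stabiliser P = {\<sigma> \<in> K. \<sigma> P = P}"

definition orbit :: "'k proj \<Rightarrow> 'k proj set" where
  "orbit P = (\<lambda>\<sigma>. \<sigma> P) ` K"

lemma orbit_self: "P \<in> V \<Longrightarrow> P \<in> orbit P"
  unfolding orbit_def by (rule image_eqI[OF _ K_id]) simp

lemma orbit_subset: "P \<in> V \<Longrightarrow> orbit P \<subseteq> V"
  using K_mem by (auto simp: orbit_def)

lemma finite_orbit: "finite (orbit P)"
  using finite_K by (simp add: orbit_def)

lemma finite_stabiliser: "finite (stabiliser P)"
  using finite_K by (simp add: stabiliser_def)

lemma stabiliser_pos: "P \<in> V \<Longrightarrow> card (stabiliser P) > 0"
  using K_id finite_stabiliser by (auto simp: card_gt_0_iff stabiliser_def)

lemma card_transporter: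
  assumes "P \<in> V" "Q \<in> orbit P"
  shows "card {\<sigma> \<in> K. \<sigma> P = Q} = card (stabiliser P)"
proof -
  obtain \<rho> where \<rho>: "\<rho> \<in> K" "Q = \<rho> P" using assms(2) by (auto simp: orbit_def)
  obtain \<rho>' where \<rho>': "\<rho>' \<in> K" "\<And>P. P \<in> V \<Longrightarrow> \<rho> (\<rho>' P) = P" "\<And>P. P \<in> V \<Longrightarrow> \<rho>' (\<rho> P) = P"
    using K_inverse[OF \<rho>(1)] by metis
  have "bij_betw (compose V \<rho>) (stabiliser P) {\<sigma> \<in> K. \<sigma> P = Q}"
  proof (rule bij_betw_byWitness[where f' = "compose V \<rho>'"])
    have *: "compose V \<rho>' (compose V \<rho> \<sigma>) = \<sigma>" "compose V \<rho> (compose V \<rho>' \<sigma>) = \<sigma>"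
      if \<sigma>: "\<sigma> \<in> K" for \<sigma>
    proof -
      show "compose V \<rho>' (compose V \<rho> \<sigma>) = \<sigma>"
        by (rule K_eqI[OF K_compose[OF \<rho>'(1) K_compose[OF \<rho>(1) \<sigma>]] \<sigma>])
          (simp add: compose_def \<rho>' K_mem \<sigma>)
      show "compose V \<rho> (compose V \<rho>' \<sigma>) = \<sigma>"
        by (rule K_eqI[OF K_compose[OF \<rho>(1) K_compose[OF \<rho>'(1) \<sigma>]] \<sigma>])
          (simp add: compose_def \<rho>' K_mem \<sigma>)
    qed
    show "\<forall>\<sigma>\<in>stabiliser P. compose V \<rho>' (compose V \<rho> \<sigma>) = \<sigma>"
      "\<forall>\<sigma>\<in>{\<sigma> \<in> K. \<sigma> P = Q}. compose V \<rho> (compose V \<rho>' \<sigma>) = \<sigma>"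
      using * by (auto simp: stabiliser_def)
    show "compose V \<rho> ` stabiliser P \<subseteq> {\<sigma> \<in> K. \<sigma> P = Q}"
      "compose V \<rho>' ` {\<sigma> \<in> K. \<sigma> P = Q} \<subseteq> stabiliser P"
      using \<rho> \<rho>' K_compose assms(1) by (auto simp: stabiliser_def compose_def)
  qed
  from bij_betw_same_card[OF this] show ?thesis by simp
qed

text \<open>Each point of the orbit is reached by a coset of the stabiliser. A constant
  \<open>F\<close> gives the orbit-stabiliser formula; the coefficients of a divisor as
  \<open>F\<close> give the comparison of \<open>h^* h_*\<close> with the sum over
  \<open>K\<close>.\<close>

lemma sum_K_orbit:
  assumes "P \<in> V"
  shows "(\<Sum>\<sigma>\<in>K. F (\<sigma> P)) = int (card (stabiliser P)) * (\<Sum>Q\<in>orbit P. F Q :: int)"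
proof -
  have "(\<Sum>\<sigma>\<in>K. F (\<sigma> P)) = (\<Sum>Q\<in>orbit P. \<Sum>\<sigma>\<in>{\<sigma> \<in> K. \<sigma> P = Q}. F (\<sigma> P))"
    unfolding orbit_def by (rule sum.group[symmetric]) (use finite_K in auto)
  also have "\<dots> = (\<Sum>Q\<in>orbit P. int (card (stabiliser P)) * F Q)"
    using card_transporter[OF assms] by (intro sum.cong) auto
  finally show ?thesis by (simp add: sum_distrib_left)
qed

lemma orbit_eq:
  assumes "P \<in> V" "Q \<in> orbit P"
  shows "orbit Q = orbit P"
proof -
  have *: "orbit Q \<subseteq> orbit P" if P: "P \<in> V" and Q: "Q \<in> orbit P" for P Q
  proof
    obtain \<rho> where \<rho>: "\<rho> \<in> K" "Q = \<rho> P" using Q by (auto simp: orbit_def)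
    fix R assume "R \<in> orbit Q"
    then obtain \<sigma> where \<sigma>: "\<sigma> \<in> K" "R = \<sigma> Q" by (auto simp: orbit_def)
    show "R \<in> orbit P"
      unfolding orbit_def
      by (rule image_eqI[OF _ K_compose[OF \<sigma>(1) \<rho>(1)]]) (simp add: compose_def \<sigma> \<rho> P)
  qed
  obtain \<rho> where \<rho>: "\<rho> \<in> K" "Q = \<rho> P" using assms(2) by (auto simp: orbit_def)
  obtain \<rho>' where "\<rho>' \<in> K" "\<And>P. P \<in> V \<Longrightarrow> \<rho>' (\<rho> P) = P" using K_inverse[OF \<rho>(1)] by metis
  then have "P \<in> orbit Q"
    unfolding orbit_def using \<rho> assms(1) by (intro image_eqI[of _ _ \<rho>']) auto
  then show ?thesis using *[of P Q] *[of Q P] assms orbit_subset by blast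
qed

text \<open>By the orbit-stabiliser formula both orders are \<open>|K|\<close> divided by the size
  of the common orbit.\<close>

lemma card_stabiliser_orbit:
  assumes "P \<in> V" "Q \<in> orbit P"
  shows "card (stabiliser Q) = card (stabiliser P)"
proof -
  have "int (card K) = int (card (stabiliser R)) * int (card (orbit R))" if "R \<in> V" for R
    using sum_K_orbit[OF that, of "\<lambda>_. 1"] by simp
  from this[OF assms(1)] this[of Q]
  have "int (card (stabiliser P)) * int (card (orbit P)) = int (card (stabiliser Q)) * int (card (orbit P))"
    using assms orbit_subset[OF assms(1)] orbit_eq[OF assms] by auto
  moreover have "card (orbit P) \<noteq> 0"
    using orbit_self[OF assms(1)] finite_orbit[of P] by auto
  ultimately show ?thesis by simp
qed

section \<open>The norm of a rational function\<close>

definition norm :: "('k proj \<Rightarrow> 'k) \<Rightarrow> 'k proj \<Rightarrow> 'k" where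
  "norm f R = (\<Prod>\<sigma>\<in>K. f (\<sigma> R))"

lemma norm_invariant: "\<tau> \<in> K \<Longrightarrow> R \<in> V \<Longrightarrow> norm f (\<tau> R) = norm f R"
  unfolding norm_def by (rule prod_K_shift)

lemma nonzero_rational_norm:
  assumes "nonzero_rational f"
  shows "nonzero_rational (norm f)"
  unfolding norm_def[abs_def]
proof (rule nonzero_rational_prod)
  fix \<sigma> assume "\<sigma> \<in> K"
  then interpret dominant_curves V V \<sigma> by (rule dominant_K)
  show "nonzero_rational (\<lambda>R. f (\<sigma> R))"
    using assms by (rule nonzero_rational_pullback)
qed

lemma order_norm:
  assumes "P \<in> V" "nonzero_rational f"
  shows "vanishing_order P (norm f) = (\<Sum>\<sigma>\<in>K. vanishing_order (\<sigma> P) f)"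
proof -
  have "nonzero_rational (\<lambda>R. f (\<sigma> R))" if "\<sigma> \<in> K" for \<sigma>
  proof -
    interpret dominant_curves V V \<sigma> using that by (rule dominant_K)
    show ?thesis using assms(2) by (rule nonzero_rational_pullback)
  qed
  then show ?thesis
    unfolding norm_def[abs_def] using assms by (simp add: order_prod order_automorphism)
qed

end

section \<open>Separating points by linear forms\<close>

text \<open>In the pencil \<open>F + c G\<close> each point excludes at most one value of
  \<open>c\<close>, and the field is infinite.\<close>

lemma linear_system_avoids_points:
  fixes S :: "'k::alg_closed_field mpol set"
  assumes "S \<noteq> {}" and S: "\<And>F G c. F \<in> S \<Longrightarrow> G \<in> S \<Longrightarrow> F + Poly_Mapping.single 0 c * G \<in> S"
    and T: "finite T" "\<And>Q. Q \<in> T \<Longrightarrow> \<exists>F\<in>S. meval (coords Q) F \<noteq> 0"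
  shows "\<exists>F\<in>S. \<forall>Q\<in>T. meval (coords Q) F \<noteq> 0"
  using T
proof (induction T rule: finite_induct)
  case empty
  then show ?case using assms(1) by auto
next
  case (insert P T)
  then obtain F where F: "F \<in> S" "\<forall>Q\<in>T. meval (coords Q) F \<noteq> 0" by auto
  obtain G where G: "G \<in> S" "meval (coords P) G \<noteq> 0" using insert.prems by blast
  \<comment> \<open>Where \<open>G\<close> vanishes, division by zero makes the excluded value
    \<open>0\<close>, which does no harm: such points lie in \<open>T\<close>, and \<open>F\<close>
    is nonzero there.\<close>
  obtain c where c: "c \<notin> (\<lambda>Q. - meval (coords Q) F / meval (coords Q) G) ` insert P T"
    using exists_avoiding[of "(\<lambda>Q. - meval (coords Q) F / meval (coords Q) G) ` insert P T"] insert.hyps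
    by auto
  have "meval (coords Q) (F + Poly_Mapping.single 0 c * G) \<noteq> 0" if Q: "Q \<in> insert P T" for Q
  proof
    assume "meval (coords Q) (F + Poly_Mapping.single 0 c * G) = 0"
    then have e: "c * meval (coords Q) G = - meval (coords Q) F"
      by (simp add: meval_add meval_mult eq_neg_iff_add_eq_0 add.commute)
    show False
    proof (cases "meval (coords Q) G = 0")
      case True
      then show False using e Q F(2) G(2) by auto
    next
      case False
      then have "c = - meval (coords Q) F / meval (coords Q) G"
        using e by (simp add: field_simps)
      then show False using c Q by blast
    qed
  qed
  then show ?case using S[OF F(1) G(1)] by blast
qed

text \<open>The coordinate vectors of distinct points are not proportional, so some two-by-two minor
  is nonzero. Read as a linear form in the coordinates of \<open>Q\<close>, this minor vanishes at
  \<open>P\<close>.\<close>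

lemma linear_form_separating:
  assumes "P \<noteq> Q"
  shows "\<exists>M. homogeneous 1 M \<and> meval (coords P) M = 0 \<and> meval (coords Q) M \<noteq> 0"
proof -
  obtain j where j: "coords P j \<noteq> 0" using coords_nonzero by blast
  have "\<exists>i. coords P j * coords Q i - coords P i * coords Q j \<noteq> 0"
  proof (rule ccontr)
    assume "\<not> ?thesis"
    then have "coords P j * coords Q i = coords P i * coords Q j" for i by simp
    then have e: "coords Q i = (coords Q j / coords P j) * coords P i" for i
      using j by (simp add: field_simps)
    have "coords Q j / coords P j \<noteq> 0"
      using coords_nonzero[of Q] e by (metis mult_zero_left)
    then show False using coords_eqI[OF _ e] assms by blast
  qed
  then obtain i where i: "coords P j * coords Q i - coords P i * coords Q j \<noteq> 0" by blast
  let ?M = "Poly_Mapping.single 0 (coords P j) * variable i + Poly_Mapping.single 0 (- coords P i) * variable j"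
  have "homogeneous 1 ?M"
    by (intro homogeneous_add_same homogeneous_scale homogeneous_variable)
  moreover have "meval (coords P) ?M = 0" "meval (coords Q) ?M \<noteq> 0"
    using i by (simp_all add: meval_add meval_mult)
  ultimately show ?thesis by blast
qed

lemma linear_form_nonvanishing:
  fixes T :: "'k::alg_closed_field proj set"
  assumes "finite T"
  obtains L where "homogeneous 1 L" "\<And>Q. Q \<in> T \<Longrightarrow> meval (coords Q) L \<noteq> 0"
proof -
  have "\<exists>F\<in>{F. homogeneous 1 F}. \<forall>Q\<in>T. meval (coords Q) F \<noteq> 0"
  proof (rule linear_system_avoids_points[OF _ _ assms])
    show "{F. homogeneous 1 F} \<noteq> {}" using homogeneous_variable by blast
    show "\<exists>F\<in>{F. homogeneous 1 F}. meval (coords Q) F \<noteq> 0" for Q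
      using coords_nonzero[of Q] homogeneous_variable by (metis mem_Collect_eq meval_variable)
  qed (auto intro: homogeneous_add_same homogeneous_scale)
  then show ?thesis using that by blast
qed

lemma separating_function:
  fixes T V :: "'k::alg_closed_field proj set"
  assumes "finite T" "P \<notin> T" "P \<in> V" "T \<subseteq> V"
  obtains u where "\<And>Q. Q \<in> insert P T \<Longrightarrow> regular_at V Q u" "u P = 0" "\<And>Q. Q \<in> T \<Longrightarrow> u Q \<noteq> 0"
proof -
  obtain L where L: "homogeneous 1 L" "\<And>Q. Q \<in> insert P T \<Longrightarrow> meval (coords Q) L \<noteq> 0"
    using linear_form_nonvanishing[of "insert P T"] assms(1) by auto
  have "\<exists>F\<in>{F. homogeneous 1 F \<and> meval (coords P) F = 0}. \<forall>Q\<in>T. meval (coords Q) F \<noteq> 0"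
  proof (rule linear_system_avoids_points[OF _ _ assms(1)])
    show "{F. homogeneous 1 F \<and> meval (coords P) F = 0} \<noteq> {}"
      by (auto simp: homogeneous_def meval_def intro!: exI[of _ 0])
    show "\<exists>F\<in>{F. homogeneous 1 F \<and> meval (coords P) F = 0}. meval (coords Q) F \<noteq> 0" if "Q \<in> T" for Q
      using linear_form_separating[of P Q] that assms(2) by blast
  qed (auto intro: homogeneous_add_same homogeneous_scale simp: meval_add meval_mult)
  then obtain M where M: "homogeneous 1 M" "meval (coords P) M = 0" "\<forall>Q\<in>T. meval (coords Q) M \<noteq> 0"
    by blast
  show ?thesis
  proof (rule that[of "\<lambda>R. meval (coords R) M / meval (coords R) L"])
    fix Q assume Q: "Q \<in> insert P T"
    then show "regular_at V Q (\<lambda>R. meval (coords R) M / meval (coords R) L)"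
      using assms L(2)[OF Q] by (intro regular_at_quotient[OF _ M(1) L(1)]) auto
  qed (use M L in auto)
qed

lemma separating_pair:
  fixes V :: "'k::alg_closed_field proj set"
  assumes "P \<noteq> Q" "P \<in> V" "Q \<in> V"
  obtains u where "regular_at V P u" "regular_at V Q u" "u P = 0" "u Q \<noteq> 0"
proof (rule separating_function[of "{Q}" P V])
  fix u
  assume "\<And>R. R \<in> insert P {Q} \<Longrightarrow> regular_at V R u" "u P = 0" "\<And>R. R \<in> {Q} \<Longrightarrow> u R \<noteq> 0"
  then show thesis using that[of u] by simp
qed (use assms in auto)

context curve
begin

lemma uniformizing_divides:
  assumes "uniformizing P t" "regular_at V P f" "f P = 0"
  obtains g where "regular_at V P g" "\<forall>\<^sub>F R in generic V. f R = g R * t R"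
  using uniformizing_generates[OF assms(1)] assms(2,3)
  unfolding generates_max_ideal_def vanishing_at_def by blast

end


context curve_group
begin

text \<open>Some coordinate difference has a simple zero at \<open>P\<close>, because together they
  generate the maximal ideal. Adding \<open>c u^2\<close>, with \<open>u\<close> vanishing at
  \<open>P\<close> but nowhere on \<open>T\<close>, changes it only in order at least two, and a
  suitable \<open>c\<close> removes all zeros on \<open>T\<close>.\<close>

lemma order_one_elsewhere_zero:
  assumes P: "P \<in> V" and T: "finite T" "T \<subseteq> V" "P \<notin> T"
  obtains f where "nonzero_rational f" "vanishing_order P f = 1" "\<And>Q. Q \<in> T \<Longrightarrow> vanishing_order Q f = 0"
proof -
  obtain t where t: "uniformizing P t" using uniformizing_exists[OF P] by blast
  have tv: "regular_at V P t" "t P = 0" "\<forall>\<^sub>F R in generic V. t R \<noteq> 0"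
    using t by (auto simp: uniformizing_def vanishing_at_def)
  obtain L where L: "homogeneous 1 L" "\<And>Q. Q \<in> insert P T \<Longrightarrow> meval (coords Q) L \<noteq> 0"
    using linear_form_nonvanishing[of "insert P T"] T(1) by auto
  define x where "x = (\<lambda>i R. affine_coords L R i - affine_coords L P i)"
  have xreg: "regular_at V Q (x i)" if "Q \<in> insert P T" for Q i
    unfolding x_def using that P T L(2)[OF that]
    by (intro regular_at_diff regular_affine_coords regular_at_const L(1)) auto
  have "\<forall>i. \<exists>g. regular_at V P g \<and> (\<forall>\<^sub>F R in generic V. x i R = g R * t R)"
  proof
    fix i
    have "x i P = 0" by (simp add: x_def)
    then show "\<exists>g. regular_at V P g \<and> (\<forall>\<^sub>F R in generic V. x i R = g R * t R)"
      using uniformizing_divides[OF t xreg] by blast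
  qed
  then obtain g where g: "\<And>i. regular_at V P (g i)" "\<And>i. \<forall>\<^sub>F R in generic V. x i R = g i R * t R"
    by metis
  \<comment> \<open>If all quotients \<open>x i / t\<close> vanished at \<open>P\<close>, dividing
    the expansion of \<open>t\<close> by \<open>t\<close> would write \<open>1\<close> as a sum that
    vanishes there.\<close>
  have "\<exists>i. g i P \<noteq> 0"
  proof (rule ccontr)
    assume "\<not> ?thesis"
    then have g0: "g i P = 0" for i by blast
    have "regular_combination P {..N} x t"
      using vanishing_at_generators[OF in_proj_space L(1) _ tv(1), of ] L(2) tv(2) by (simp add: x_def)
    then obtain a where a: "\<And>i. i \<le> N \<Longrightarrow> regular_at V P (a i)"
      "\<forall>\<^sub>F R in generic V. t R = (\<Sum>i\<in>{..N}. a i R * x i R)"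
      by (auto simp: combination_def)
    have "\<forall>\<^sub>F R in generic V. \<forall>i\<in>{..N}. x i R = g i R * t R"
      by (intro eventually_ball_finite ballI g) auto
    then have "\<forall>\<^sub>F R in generic V. 1 = (\<Sum>i\<in>{..N}. a i R * g i R)"
      using a(2) tv(3)
    proof eventually_elim
      case (elim R)
      have "t R = (\<Sum>i\<in>{..N}. a i R * g i R) * t R"
        unfolding sum_distrib_right using elim(2)
        by (rule trans) (intro sum.cong, use elim(1) in auto)
      then show ?case using elim(3) by simp
    qed
    moreover have "regular_at V P (\<lambda>R. \<Sum>i\<in>{..N}. a i R * g i R)"
      using a(1) g(1) P by (intro regular_at_sum regular_at_mult) auto
    ultimately have "1 = (\<Sum>i\<in>{..N}. a i P * g i P)"
      using regular_at_eqD[OF regular_at_const[OF P]] by blast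
    then show False by (simp add: g0)
  qed
  then obtain i where i: "g i P \<noteq> 0" by blast
  obtain u where u: "\<And>Q. Q \<in> insert P T \<Longrightarrow> regular_at V Q u" "u P = 0" "\<And>Q. Q \<in> T \<Longrightarrow> u Q \<noteq> 0"
    using separating_function[OF T(1,3) P T(2)] by blast
  obtain w where w: "regular_at V P w" "\<forall>\<^sub>F R in generic V. u R = w R * t R"
    using uniformizing_divides[OF t u(1)[of P] u(2)] by blast
  obtain c where c: "c \<notin> (\<lambda>Q. - x i Q / (u Q)\<^sup>2) ` T"
    using exists_avoiding[of "(\<lambda>Q. - x i Q / (u Q)\<^sup>2) ` T"] T(1) by blast
  define f where "f R = x i R + c * (u R * u R)" for R
  have freg: "regular_at V Q f" if "Q \<in> insert P T" for Q
  proof -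
    have "Q \<in> V" using that P T by auto
    then show ?thesis
      unfolding f_def using that by (intro regular_at_add regular_at_mult regular_at_const xreg u(1))
  qed
  \<comment> \<open>The cofactor of \<open>t\<close> in \<open>f\<close>. Its second term still
    contains \<open>t\<close>, so its value at \<open>P\<close> is \<open>g i P\<close>.\<close>
  define v where "v R = g i R + c * (w R * w R) * t R" for R
  have v: "regular_at V P v" "v P \<noteq> 0"
  proof -
    show "regular_at V P v"
      unfolding v_def by (intro regular_at_add regular_at_mult regular_at_const P g w tv)
    show "v P \<noteq> 0" using i tv(2) by (simp add: v_def)
  qed
  have fv: "\<forall>\<^sub>F R in generic V. f R = v R * t R powi 1"
    using g(2)[of i] w(2) by eventually_elim (simp add: f_def v_def algebra_simps)
  have fr: "rational V f" using freg[of P] rationalI by blast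
  show ?thesis
  proof (rule that)
    have "\<forall>\<^sub>F R in generic V. f R \<noteq> 0"
      using fv tv(3) eventually_nonzero[OF v] by eventually_elim simp
    then show "nonzero_rational f" using fr by (simp add: nonzero_rational_def)
    show "vanishing_order P f = 1" by (rule ord_at_eqI[OF t v fr fv])
    fix Q assume Q: "Q \<in> T"
    have "f Q \<noteq> 0"
    proof
      assume "f Q = 0"
      then have "c = - x i Q / (u Q)\<^sup>2"
        using u(3)[OF Q] by (simp add: f_def field_simps power2_eq_square eq_neg_iff_add_eq_0)
      then show False using c Q by blast
    qed
    then show "vanishing_order Q f = 0" using order_unit[OF freg] Q by blast
  qed
qed

section \<open>Orders of invariant functions at a point\<close>

lemma invariant_of_order_card_stabiliser:
  assumes "P \<in> V"
  obtains f where "nonzero_rational f" "\<And>\<sigma> R. \<sigma> \<in> K \<Longrightarrow> R \<in> V \<Longrightarrow> f (\<sigma> R) = f R"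
    "vanishing_order P f = int (card (stabiliser P))"
proof -
  obtain t where t: "nonzero_rational t" "vanishing_order P t = 1"
    "\<And>Q. Q \<in> orbit P - {P} \<Longrightarrow> vanishing_order Q t = 0"
    using order_one_elsewhere_zero[of P "orbit P - {P}"] finite_orbit orbit_subset assms by blast
  show ?thesis
  proof (rule that)
    have "vanishing_order P (norm t) = int (card (stabiliser P)) * (\<Sum>Q\<in>orbit P. vanishing_order Q t)"
      using order_norm[OF assms t(1)] sum_K_orbit[OF assms, of "\<lambda>Q. vanishing_order Q t"] by simp
    also have "(\<Sum>Q\<in>orbit P. vanishing_order Q t) = 1"
      using t sum.remove[OF finite_orbit orbit_self[OF assms], of "\<lambda>Q. vanishing_order Q t"] by simp
    finally show "vanishing_order P (norm t) = int (card (stabiliser P))" by simp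
  qed (use t nonzero_rational_norm norm_invariant in auto)
qed

lemma stabiliser_regular:
  "\<sigma> \<in> stabiliser P \<Longrightarrow> regular_at V P f \<Longrightarrow> regular_at V P (\<lambda>R. f (\<sigma> R))"
  using morphism_regular_at[OF K_morphism, of \<sigma> P f] regular_at_mem[of V P f] by (auto simp: stabiliser_def)

lemma eventually_K:
  assumes "\<sigma> \<in> K" "eventually A (generic V)"
  shows "\<forall>\<^sub>F R in generic V. A (\<sigma> R)"
proof -
  interpret dominant_curves V V \<sigma> by (rule dominant_K[OF assms(1)])
  show ?thesis by (rule eventually_pullback[OF assms(2)])
qed

text \<open>In terms of completions: local functions are power series in \<open>t\<close>, so an
  element of the stabiliser is determined by its effect on \<open>t\<close>. Here one subtracts
  constants and divides by \<open>t\<close> repeatedly, whence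
  \<open>g o \<sigma> - g o \<rho>\<close> is divisible by all powers of \<open>t o \<sigma>\<close>
  and is zero. Functions separating two points then force \<open>\<sigma> = \<rho>\<close>.\<close>

lemma stabiliser_eqI:
  assumes P: "P \<in> V" and \<sigma>: "\<sigma> \<in> stabiliser P" and \<rho>: "\<rho> \<in> stabiliser P" and t: "uniformizing P t"
    and eq: "\<forall>\<^sub>F R in generic V. t (\<sigma> R) = t (\<rho> R)"
  shows "\<sigma> = \<rho>"
proof -
  have K: "\<sigma> \<in> K" "\<rho> \<in> K" "\<sigma> P = P" "\<rho> P = P" using \<sigma> \<rho> by (auto simp: stabiliser_def)
  interpret \<sigma>: dominant_curves V V \<sigma> by (rule dominant_K[OF K(1)])
  interpret \<rho>: dominant_curves V V \<rho> by (rule dominant_K[OF K(2)])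
  have expand: "\<exists>h. regular_at V P h \<and>
      (\<forall>\<^sub>F R in generic V. g (\<sigma> R) - g (\<rho> R) = t (\<sigma> R) ^ m * (h (\<sigma> R) - h (\<rho> R)))"
    if "regular_at V P g" for g m
    using that
  proof (induction m arbitrary: g)
    case 0
    then show ?case by (intro exI[of _ g]) simp
  next
    case (Suc m)
    have "regular_at V P (\<lambda>R. g R - g P)"
      using Suc.prems by (intro regular_at_diff regular_at_const P)
    then obtain g' where g': "regular_at V P g'" "\<forall>\<^sub>F R in generic V. g R - g P = g' R * t R"
      using uniformizing_divides[OF t, of "\<lambda>R. g R - g P"] by auto
    obtain h where h: "regular_at V P h"
      "\<forall>\<^sub>F R in generic V. g' (\<sigma> R) - g' (\<rho> R) = t (\<sigma> R) ^ m * (h (\<sigma> R) - h (\<rho> R))"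
      using Suc.IH[OF g'(1)] by blast
    have "\<forall>\<^sub>F R in generic V. g (\<sigma> R) - g (\<rho> R) = t (\<sigma> R) ^ Suc m * (h (\<sigma> R) - h (\<rho> R))"
      using eventually_K[OF K(1) g'(2)] eventually_K[OF K(2) g'(2)] eq h(2)
    proof eventually_elim
      case (elim R)
      have "g (\<sigma> R) - g (\<rho> R) = (g (\<sigma> R) - g P) - (g (\<rho> R) - g P)" by simp
      also have "\<dots> = t (\<sigma> R) * (g' (\<sigma> R) - g' (\<rho> R))"
        using elim by (simp add: algebra_simps)
      finally show ?case using elim(4) by simp
    qed
    then show ?case using h(1) by blast
  qed
  have same: "\<forall>\<^sub>F R in generic V. g (\<sigma> R) = g (\<rho> R)" if g: "regular_at V P g" for g
  proof (rule ccontr)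
    assume neg: "\<not> ?thesis"
    define d where "d R = g (\<sigma> R) - g (\<rho> R)" for R
    have d: "regular_at V P d"
      unfolding d_def by (intro regular_at_diff stabiliser_regular[OF \<sigma> g] stabiliser_regular[OF \<rho> g])
    have dn: "nonzero_rational d"
    proof (rule nonzero_rationalI[OF rationalI[OF d]])
      show "\<not> (\<forall>\<^sub>F R in generic V. d R = 0)" using neg by (simp add: d_def)
    qed
    \<comment> \<open>Larger than the order of \<open>d\<close>, so that divisibility of
      \<open>d\<close> by this power is absurd.\<close>
    define n where "n = Suc (nat (vanishing_order P d))"
    obtain h where h: "regular_at V P h"
      "\<forall>\<^sub>F R in generic V. g (\<sigma> R) - g (\<rho> R) = t (\<sigma> R) ^ n * (h (\<sigma> R) - h (\<rho> R))"
      using expand[OF g] by blast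
    define d' where "d' R = h (\<sigma> R) - h (\<rho> R)" for R
    have d': "regular_at V P d'"
      unfolding d'_def by (intro regular_at_diff stabiliser_regular[OF \<sigma> h(1)] stabiliser_regular[OF \<rho> h(1)])
    have dd': "\<forall>\<^sub>F R in generic V. d R = t (\<sigma> R) ^ n * d' R"
      using h(2) by (simp add: d_def d'_def)
    have d'n: "nonzero_rational d'"
    proof (rule nonzero_rationalI[OF rationalI[OF d']], rule)
      assume "\<forall>\<^sub>F R in generic V. d' R = 0"
      then have "\<forall>\<^sub>F R in generic V. d R = 0" using dd' by eventually_elim simp
      then show False using nonzero_rational_not_zero[OF dn] by blast
    qed
    have tn: "nonzero_rational (\<lambda>R. t (\<sigma> R))"
      by (rule \<sigma>.nonzero_rational_pullback[OF uniformizing_nonzero[OF t]])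
    have "vanishing_order P (\<lambda>R. t (\<sigma> R)) = 1"
      using order_automorphism[OF K(1) P uniformizing_nonzero[OF t]] uniformizing_order_one[OF t] K(3) by simp
    moreover have "vanishing_order P d = vanishing_order P (\<lambda>R. t (\<sigma> R) ^ n * d' R)"
      using dn dd' by (intro order_cong) (auto simp: nonzero_rational_def)
    moreover have "nonzero_rational (\<lambda>R. t (\<sigma> R) ^ n)"
      using nonzero_rational_powi[OF tn, of "int n"] by simp
    ultimately have "vanishing_order P d = int n + vanishing_order P d'"
      using order_mult[OF P _ d'n] order_power[OF P tn] by simp
    then show False using order_nonneg(1)[OF d' d'n] by (simp add: n_def split: if_splits)
  qed
  show ?thesis
  proof (rule K_eqI[OF K(1,2)], rule ccontr)
    fix R assume R: "R \<in> V" and ne: "\<sigma> R \<noteq> \<rho> R"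
    have \<sigma>R: "\<sigma> R \<in> V" "\<rho> R \<in> V" using K R K_mem by auto
    obtain u where u: "regular_at V (\<sigma> R) u" "regular_at V (\<rho> R) u" "u (\<sigma> R) = 0" "u (\<rho> R) \<noteq> 0"
      by (rule separating_pair[OF ne \<sigma>R])
    have un: "nonzero_rational u" by (rule nonzero_rational_unit[OF u(2,4)])
    \<comment> \<open>\<open>u\<close> is regular at the two images but perhaps not at
      \<open>P\<close>. Either \<open>u\<close> or \<open>1/u\<close> has nonnegative order at
      \<open>P\<close>, and \<open>same\<close> applies to that one.\<close>
    have "\<forall>\<^sub>F R in generic V. u (\<sigma> R) = u (\<rho> R)"
    proof (cases "vanishing_order P u \<ge> 0")
      case True
      then obtain g where g: "regular_at V P g" "\<forall>\<^sub>F R in generic V. u R = g R"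
        using order_eq_zero[OF P un] order_pos[OF P un] by (cases "vanishing_order P u = 0") auto
      show ?thesis
        using same[OF g(1)] eventually_K[OF K(1) g(2)] eventually_K[OF K(2) g(2)] by eventually_elim simp
    next
      case False
      then have "vanishing_order P (\<lambda>R. inverse (u R)) > 0"
        using order_inverse[OF P un] by simp
      then obtain g where g: "regular_at V P g" "\<forall>\<^sub>F R in generic V. inverse (u R) = g R"
        using order_pos[OF P nonzero_rational_inverse[OF un]] by blast
      show ?thesis
        using same[OF g(1)] eventually_K[OF K(1) g(2)] eventually_K[OF K(2) g(2)]
      proof eventually_elim
        case (elim R)
        then have "inverse (u (\<sigma> R)) = inverse (u (\<rho> R))" by simp
        then show ?case by simp
      qed
    qed
    then have "u (\<sigma> R) = u (\<rho> R)"
      using regular_at_eqD[OF morphism_regular_at[OF K_morphism[OF K(1)] R u(1)]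
          morphism_regular_at[OF K_morphism[OF K(2)] R u(2)]] by blast
    then show False using u by simp
  qed
qed

text \<open>The residue field is \<open>k\<close>, so a constant can be subtracted and the
  difference divided by \<open>t\<close>, again and again.\<close>

lemma taylor_expansion:
  assumes "uniformizing P t" "regular_at V P g"
  shows "\<exists>a h. regular_at V P h \<and> (\<forall>\<^sub>F R in generic V. g R = (\<Sum>k<e. a k * t R ^ k) + h R * t R ^ e)"
proof (induction e)
  case 0
  then show ?case using assms(2) by auto
next
  case (Suc e)
  then obtain a h where h: "regular_at V P h" "\<forall>\<^sub>F R in generic V. g R = (\<Sum>k<e. a k * t R ^ k) + h R * t R ^ e"
    by blast
  have "regular_at V P (\<lambda>R. h R - h P)"
    using h(1) regular_at_mem by (intro regular_at_diff regular_at_const)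
  then obtain h' where h': "regular_at V P h'" "\<forall>\<^sub>F R in generic V. h R - h P = h' R * t R"
    using uniformizing_divides[OF assms(1), of "\<lambda>R. h R - h P"] by auto
  have "\<forall>\<^sub>F R in generic V. g R = (\<Sum>k<Suc e. (a(e := h P)) k * t R ^ k) + h' R * t R ^ Suc e"
    using h(2) h'(2)
  proof eventually_elim
    case (elim R)
    have "h R = h P + h' R * t R" using elim(2) by (simp add: algebra_simps)
    then show ?case using elim(1) by (simp add: algebra_simps)
  qed
  then show ?case using h'(1) by blast
qed

text \<open>If \<open>f\<close> had order \<open>e < |Stab(P)|\<close>, choose \<open>e + 1\<close> elements \<open>\<sigma>\<close> of the stabiliser. The functional
  \<open>\<Lambda> g = \<Sum> c\<^sub>\<sigma> (g \<circ> \<sigma>)\<close>, with \<open>c\<^sub>\<sigma>\<close> the Lagrange weights of the nodes \<open>t \<circ> \<sigma>\<close>, kills \<open>t\<^sup>k\<close> for \<open>k < e\<close>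
  and is linear over the invariant \<open>f\<close>. Expanding \<open>g\<close> in powers of \<open>f\<close> with coefficients polynomials
  of degree less than \<open>e\<close> in \<open>t\<close> shows that \<open>\<Lambda> g\<close> vanishes to infinite order, although
  \<open>\<Lambda> (t\<^sup>e) = 1\<close>.\<close>

lemma card_stabiliser_le_order:
  assumes P: "P \<in> V" and f: "nonzero_rational f"
    and inv: "\<And>\<sigma>. \<sigma> \<in> stabiliser P \<Longrightarrow> \<forall>\<^sub>F R in generic V. f (\<sigma> R) = f R"
    and pos: "vanishing_order P f > 0"
  shows "int (card (stabiliser P)) \<le> vanishing_order P f"
proof (rule ccontr)
  define e where "e = nat (vanishing_order P f)"
  assume "\<not> int (card (stabiliser P)) \<le> vanishing_order P f"
  then have "Suc e \<le> card (stabiliser P)" using pos by (simp add: e_def)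
  then obtain T where T: "T \<subseteq> stabiliser P" "card T = Suc e" "finite T"
    using obtain_subset_with_card_n by metis
  obtain t where t: "uniformizing P t" using uniformizing_exists[OF P] by blast
  have tv: "regular_at V P t" "t P = 0" "\<forall>\<^sub>F R in generic V. t R \<noteq> 0"
    using t by (auto simp: uniformizing_def vanishing_at_def)
  have K: "\<sigma> \<in> K" "\<sigma> P = P" if "\<sigma> \<in> T" for \<sigma> using that T(1) by (auto simp: stabiliser_def)
  have treg: "regular_at V P (\<lambda>R. t (\<sigma> R))" if "\<sigma> \<in> T" for \<sigma>
    using stabiliser_regular[OF _ tv(1)] T(1) that by blast
  have diff: "nonzero_rational (\<lambda>R. t (\<sigma> R) - t (\<rho> R))" if "\<sigma> \<in> T" "\<rho> \<in> T" "\<sigma> \<noteq> \<rho>" for \<sigma> \<rho>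
  proof (rule nonzero_rationalI)
    show "rational V (\<lambda>R. t (\<sigma> R) - t (\<rho> R))"
      using rationalI[OF regular_at_diff[OF treg treg]] that by blast
    show "\<not> (\<forall>\<^sub>F R in generic V. t (\<sigma> R) - t (\<rho> R) = 0)"
    proof
      assume "\<forall>\<^sub>F R in generic V. t (\<sigma> R) - t (\<rho> R) = 0"
      then have "\<forall>\<^sub>F R in generic V. t (\<sigma> R) = t (\<rho> R)" by eventually_elim simp
      then show False using stabiliser_eqI[OF P _ _ t] T(1) that by blast
    qed
  qed
  define c where "c \<sigma> R = (\<Prod>\<rho>\<in>T - {\<sigma>}. inverse (t (\<sigma> R) - t (\<rho> R)))" for \<sigma> R
  have c: "nonzero_rational (c \<sigma>)" if "\<sigma> \<in> T" for \<sigma>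
    unfolding c_def using diff that by (intro nonzero_rational_prod nonzero_rational_inverse) auto
  have "\<forall>\<^sub>F R in generic V. \<forall>\<sigma>\<in>T. \<forall>\<rho>\<in>T - {\<sigma>}. t (\<sigma> R) - t (\<rho> R) \<noteq> 0"
    using diff T(3) by (intro eventually_ball_finite ballI) (auto simp: nonzero_rational_def)
  then have lagrange: "\<forall>\<^sub>F R in generic V. \<forall>k\<le>e. (\<Sum>\<sigma>\<in>T. c \<sigma> R * t (\<sigma> R) ^ k) = (if k = e then 1 else 0)"
  proof eventually_elim
    case (elim R)
    define r where "r \<sigma> = t (\<sigma> R)" for \<sigma>
    have inj: "inj_on r T" using elim by (auto simp: inj_on_def r_def)
    have "(\<Sum>x\<in>r ` T. x ^ k * (\<Prod>y\<in>r ` T - {x}. inverse (x - y))) = (\<Sum>\<sigma>\<in>T. c \<sigma> R * t (\<sigma> R) ^ k)" for k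
    proof -
      have "(\<Prod>y\<in>r ` T - {r \<sigma>}. inverse (r \<sigma> - y)) = c \<sigma> R" if "\<sigma> \<in> T" for \<sigma>
      proof -
        have "r ` T - {r \<sigma>} = r ` (T - {\<sigma>})" using inj that by (auto simp: inj_on_def)
        moreover have "inj_on r (T - {\<sigma>})" using inj by (rule inj_on_subset) auto
        ultimately have "(\<Prod>y\<in>r ` T - {r \<sigma>}. inverse (r \<sigma> - y)) = (\<Prod>\<rho>\<in>T - {\<sigma>}. inverse (r \<sigma> - r \<rho>))"
          by (simp add: prod.reindex)
        then show ?thesis by (simp add: c_def r_def)
      qed
      then have "(\<Sum>x\<in>r ` T. x ^ k * (\<Prod>y\<in>r ` T - {x}. inverse (x - y))) = (\<Sum>\<sigma>\<in>T. c \<sigma> R * r \<sigma> ^ k)"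
        using inj by (simp add: sum.reindex mult.commute)
      then show ?thesis by (simp add: r_def)
    qed
    moreover have "card (r ` T) = Suc e" using inj T by (simp add: card_image)
    ultimately show ?case
      using sum_power_div_differences[of "r ` T" e] T(3) by simp
  qed
  define \<Lambda> where "\<Lambda> g R = (\<Sum>\<sigma>\<in>T. c \<sigma> R * g (\<sigma> R))" for g R
  obtain u where u: "regular_at V P u" "u P \<noteq> 0" "\<forall>\<^sub>F R in generic V. f R = u R * t R powi vanishing_order P f"
    using uniformizing_order[OF t f] by blast
  have step: "\<exists>h. regular_at V P h \<and> (\<forall>\<^sub>F R in generic V. \<Lambda> g R = f R * \<Lambda> h R)"
    if g: "regular_at V P g" for g
  proof -
    obtain a g' where g': "regular_at V P g'"
      "\<forall>\<^sub>F R in generic V. g R = (\<Sum>k<e. a k * t R ^ k) + g' R * t R ^ e"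
      using taylor_expansion[OF t g] by blast
    \<comment> \<open>\<open>f\<close> is the unit \<open>u\<close> times \<open>t^e\<close>, so the
      remainder \<open>g' t^e\<close> becomes \<open>h f\<close>; here \<open>e\<close> has to be
      the exact order of \<open>f\<close>.\<close>
    define h where "h R = g' R / u R" for R
    have h: "regular_at V P h" unfolding h_def by (rule regular_at_divide[OF g'(1) u(1,2)])
    have gh: "\<forall>\<^sub>F R in generic V. g R = (\<Sum>k<e. a k * t R ^ k) + h R * f R"
      using g'(2) u(3) eventually_nonzero[OF u(1,2)]
      by eventually_elim (use pos in \<open>simp add: h_def e_def power_int_def\<close>)
    have "\<forall>\<^sub>F R in generic V. \<forall>\<sigma>\<in>T. g (\<sigma> R) = (\<Sum>k<e. a k * t (\<sigma> R) ^ k) + h (\<sigma> R) * f (\<sigma> R)"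
      using eventually_K[OF K(1) gh] T(3) by (intro eventually_ball_finite ballI) auto
    moreover have "\<forall>\<^sub>F R in generic V. \<forall>\<sigma>\<in>T. f (\<sigma> R) = f R"
      using inv T by (intro eventually_ball_finite ballI) auto
    ultimately have "\<forall>\<^sub>F R in generic V. \<Lambda> g R = f R * \<Lambda> h R"
      using lagrange
    proof eventually_elim
      case (elim R)
      have "\<Lambda> g R = (\<Sum>\<sigma>\<in>T. (\<Sum>k<e. a k * (c \<sigma> R * t (\<sigma> R) ^ k)) + f R * (c \<sigma> R * h (\<sigma> R)))"
        unfolding \<Lambda>_def by (intro sum.cong) (auto simp: elim(1,2) sum_distrib_left distrib_left mult_ac)
      also have "\<dots> = (\<Sum>k<e. a k * (\<Sum>\<sigma>\<in>T. c \<sigma> R * t (\<sigma> R) ^ k)) + f R * \<Lambda> h R"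
        unfolding \<Lambda>_def sum.distrib sum_distrib_left by (subst sum.swap) simp
      \<comment> \<open>Only powers below \<open>e\<close> occur, and these are killed by the
        interpolation weights.\<close>
      also have "(\<Sum>k<e. a k * (\<Sum>\<sigma>\<in>T. c \<sigma> R * t (\<sigma> R) ^ k)) = 0"
        using elim(3) by (intro sum.neutral) auto
      finally show ?case by simp
    qed
    then show ?thesis using h by blast
  qed
  have iterate: "\<exists>h. regular_at V P h \<and> (\<forall>\<^sub>F R in generic V. \<Lambda> (\<lambda>R. t R ^ e) R = f R ^ m * \<Lambda> h R)" for m
  proof (induction m)
    case 0
    then show ?case using regular_at_power[OF tv(1)] by (intro exI[of _ "\<lambda>R. t R ^ e"]) simp
  next
    case (Suc m)
    then obtain h where h: "regular_at V P h" "\<forall>\<^sub>F R in generic V. \<Lambda> (\<lambda>R. t R ^ e) R = f R ^ m * \<Lambda> h R"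
      by blast
    obtain h' where h': "regular_at V P h'" "\<forall>\<^sub>F R in generic V. \<Lambda> h R = f R * \<Lambda> h' R"
      using step[OF h(1)] by blast
    have "\<forall>\<^sub>F R in generic V. \<Lambda> (\<lambda>R. t R ^ e) R = f R ^ Suc m * \<Lambda> h' R"
      using h(2) h'(2) by eventually_elim (simp add: mult_ac)
    then show ?case using h'(1) by blast
  qed
  \<comment> \<open>The weights \<open>c \<sigma>\<close> may have poles at \<open>P\<close>. Since
    \<open>f\<close> has positive order, its \<open>m\<close>-th power outweighs all of them, so
    every \<open>f^m c \<sigma>\<close> vanishes at \<open>P\<close> and the identity
    \<open>\<Lambda> (t^e) = 1\<close> becomes absurd there.\<close>
  define m where "m = Suc (\<Sum>\<sigma>\<in>T. nat \<bar>vanishing_order P (c \<sigma>)\<bar>)"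
  have "\<forall>\<sigma>\<in>T. \<exists>b. regular_at V P b \<and> b P = 0 \<and> (\<forall>\<^sub>F R in generic V. f R ^ m * c \<sigma> R = b R)"
  proof
    fix \<sigma> assume \<sigma>: "\<sigma> \<in> T"
    have fm: "nonzero_rational (\<lambda>R. f R ^ m)" using nonzero_rational_powi[OF f, of "int m"] by simp
    have "nat \<bar>vanishing_order P (c \<sigma>)\<bar> \<le> (\<Sum>\<sigma>\<in>T. nat \<bar>vanishing_order P (c \<sigma>)\<bar>)"
      using \<sigma> T(3) by (intro member_le_sum) auto
    then have "nat \<bar>vanishing_order P (c \<sigma>)\<bar> < m" by (simp only: m_def less_Suc_eq_le)
    then have "int m > \<bar>vanishing_order P (c \<sigma>)\<bar>" by (simp add: nat_less_iff)
    moreover have "int m * vanishing_order P f \<ge> int m"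
      using pos by (simp add: mult_le_cancel_left1)
    ultimately have "vanishing_order P (\<lambda>R. f R ^ m * c \<sigma> R) > 0"
      using order_mult[OF P fm c[OF \<sigma>]] order_power[OF P f] by simp
    then show "\<exists>b. regular_at V P b \<and> b P = 0 \<and> (\<forall>\<^sub>F R in generic V. f R ^ m * c \<sigma> R = b R)"
      using order_pos[OF P nonzero_rational_mult[OF fm c[OF \<sigma>]]] by blast
  qed
  then obtain b where b: "\<And>\<sigma>. \<sigma> \<in> T \<Longrightarrow> regular_at V P (b \<sigma>)" "\<And>\<sigma>. \<sigma> \<in> T \<Longrightarrow> b \<sigma> P = 0"
    "\<And>\<sigma>. \<sigma> \<in> T \<Longrightarrow> \<forall>\<^sub>F R in generic V. f R ^ m * c \<sigma> R = b \<sigma> R"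
    by metis
  obtain h where h: "regular_at V P h" "\<forall>\<^sub>F R in generic V. \<Lambda> (\<lambda>R. t R ^ e) R = f R ^ m * \<Lambda> h R"
    using iterate by blast
  have "\<forall>\<^sub>F R in generic V. \<forall>\<sigma>\<in>T. f R ^ m * c \<sigma> R = b \<sigma> R"
    using b(3) T(3) by (intro eventually_ball_finite ballI) auto
  then have "\<forall>\<^sub>F R in generic V. 1 = (\<Sum>\<sigma>\<in>T. b \<sigma> R * h (\<sigma> R))"
    using h(2) lagrange
  proof eventually_elim
    case (elim R)
    have "1 = \<Lambda> (\<lambda>R. t R ^ e) R" using elim(3) by (simp add: \<Lambda>_def)
    also have "\<dots> = f R ^ m * \<Lambda> h R" by (rule elim(2))
    also have "\<dots> = (\<Sum>\<sigma>\<in>T. f R ^ m * c \<sigma> R * h (\<sigma> R))"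
      by (simp add: \<Lambda>_def sum_distrib_left mult.assoc)
    also have "\<dots> = (\<Sum>\<sigma>\<in>T. b \<sigma> R * h (\<sigma> R))"
      by (intro sum.cong) (auto simp: elim(1))
    finally show ?case .
  qed
  moreover have "regular_at V P (\<lambda>R. \<Sum>\<sigma>\<in>T. b \<sigma> R * h (\<sigma> R))"
    using b(1) stabiliser_regular[OF _ h(1)] T(1) P
    by (intro regular_at_sum regular_at_mult) auto
  ultimately have "1 = (\<Sum>\<sigma>\<in>T. b \<sigma> P * h (\<sigma> P))"
    using regular_at_eqD[OF regular_at_const[OF P]] by blast
  then show False using b(2) by simp
qed

text \<open>Division with remainder: a power of the invariant function of order
  \<open>|Stab(P)|\<close> reduces \<open>f\<close> to an invariant function whose order is the
  remainder, and the preceding bound forbids a positive remainder below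
  \<open>|Stab(P)|\<close>.\<close>

lemma card_stabiliser_dvd_order:
  assumes P: "P \<in> V" and f: "nonzero_rational f"
    and inv: "\<And>\<sigma>. \<sigma> \<in> K \<Longrightarrow> \<forall>\<^sub>F R in generic V. f (\<sigma> R) = f R"
  shows "int (card (stabiliser P)) dvd vanishing_order P f"
proof (rule ccontr)
  define s where "s = int (card (stabiliser P))"
  have s: "s > 0" using stabiliser_pos[OF P] by (simp add: s_def)
  obtain n where n: "nonzero_rational n" "\<And>\<sigma> R. \<sigma> \<in> K \<Longrightarrow> R \<in> V \<Longrightarrow> n (\<sigma> R) = n R"
    "vanishing_order P n = s"
    using invariant_of_order_card_stabiliser[OF P] unfolding s_def by blast
  define q where "q = vanishing_order P f div s"
  define g where "g R = f R * n R powi (- q)" for R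
  assume "\<not> ?thesis"
  then have "vanishing_order P f mod s \<noteq> 0" by (simp add: s_def dvd_eq_mod_eq_0)
  moreover have "vanishing_order P f mod s \<ge> 0" using s by simp
  ultimately have r: "vanishing_order P f mod s > 0" by linarith
  have "vanishing_order P g = vanishing_order P f - q * s"
    unfolding g_def using order_mult[OF P f nonzero_rational_powi[OF n(1)]] order_powi[OF P n(1)] n(3) by simp
  then have ord: "vanishing_order P g = vanishing_order P f mod s"
    by (simp add: q_def minus_div_mult_eq_mod)
  have gn: "nonzero_rational g"
    unfolding g_def by (intro nonzero_rational_mult f nonzero_rational_powi n)
  have "\<forall>\<^sub>F R in generic V. g (\<sigma> R) = g R" if "\<sigma> \<in> stabiliser P" for \<sigma>
  proof -
    have \<sigma>: "\<sigma> \<in> K" using that by (simp add: stabiliser_def)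
    show ?thesis
      using inv[OF \<sigma>] eventually_mem by eventually_elim (use n(2) \<sigma> in \<open>simp add: g_def\<close>)
  qed
  then have "s \<le> vanishing_order P g"
    unfolding s_def using card_stabiliser_le_order[OF P gn] ord r by simp
  then show False using ord pos_mod_bound[OF s, of "vanishing_order P f"] by linarith
qed

end

section \<open>The quotient curve\<close>

lemma (in dominant_curves) ram_index_eq:
  assumes P: "P \<in> V" and t: "W.uniformizing (\<phi> P) t"
  shows "ram_index V W \<phi> P = V.vanishing_order P (\<lambda>R. t (\<phi> R))"
proof -
  have *: "ord_at V P (pullback_rat V W \<phi> s) = V.vanishing_order P (\<lambda>R. t (\<phi> R))"
    if "uniformizer W (\<phi> P) s" for s
  proof -
    obtain r where r: "s = ratfun_class W r" "W.generates_max_ideal (\<phi> P) r"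
      using \<open>uniformizer W (\<phi> P) s\<close> W.uniformizer_iff by blast
    then obtain w where w: "regular_at W (\<phi> P) w" "w (\<phi> P) \<noteq> 0" "rational W r"
      "\<forall>\<^sub>F R in generic W. r R = w R * t R"
      using W.generates_max_ideal_iff[OF t] by blast
    have "\<forall>\<^sub>F R in generic W. t R \<noteq> 0" using t by (simp add: W.uniformizing_def)
    then have "\<forall>\<^sub>F R in generic W. r R \<noteq> 0"
      using w(4) W.eventually_nonzero[OF w(1,2)] by eventually_elim simp
    then have rn: "W.nonzero_rational r" using w(3) by (simp add: W.nonzero_rational_def)
    have "\<forall>\<^sub>F R in generic W. r R = w R * t R powi 1" using w(4) by simp
    then have "W.vanishing_order (\<phi> P) r = 1"
      by (rule W.ord_at_eqI[OF t w(1,2,3)])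
    then show ?thesis
      using order_pullback[OF P t rn] by (simp add: r(1) pullback_rat_class[OF w(3)])
  qed
  have ex: "uniformizer W (\<phi> P) (ratfun_class W t)"
    using W.uniformizer_iff W.uniformizing_generates[OF t] by blast
  show ?thesis
    unfolding ram_index_def
  proof (rule the_equality)
    show "\<exists>s. uniformizer W (\<phi> P) s \<and>
        V.vanishing_order P (\<lambda>R. t (\<phi> R)) = ord_at V P (pullback_rat V W \<phi> s)"
      using ex * by metis
  qed (use * in metis)
qed

lemma (in dominant_curves) order_pullback_ram_index:
  assumes "P \<in> V" "W.nonzero_rational f"
  shows "V.vanishing_order P (\<lambda>R. f (\<phi> R)) = ram_index V W \<phi> P * W.vanishing_order (\<phi> P) f"
proof -
  obtain t where "W.uniformizing (\<phi> P) t"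
    using W.uniformizing_exists[OF morphism_mem[OF morphism assms(1)]] by blast
  then show ?thesis using order_pullback ram_index_eq assms by simp
qed

lemma (in curve_group) ram_index_automorphism:
  assumes "\<sigma> \<in> K" "P \<in> V"
  shows "ram_index V V \<sigma> P = 1"
proof -
  interpret \<sigma>: dominant_curves V V \<sigma> by (rule dominant_K[OF assms(1)])
  obtain t where t: "uniformizing (\<sigma> P) t"
    using uniformizing_exists[OF K_mem[OF assms]] by blast
  show ?thesis
    using \<sigma>.ram_index_eq[OF assms(2) t] order_automorphism[OF assms uniformizing_nonzero[OF t]]
      uniformizing_order_one[OF t] by simp
qed

text \<open>\<open>h\<close> is given as a factorisation of \<open>q\<close> through the
  normalisation. Its invariance, surjectivity and fibres are derived from that relation and from the
  description of \<open>Z\<close> as a quotient.\<close>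

locale curve_quotient = curve_group V K N
  for V :: "'k::alg_closed_field proj set" and K N +
  fixes Y Z :: "'k proj set" and q \<nu> h :: "'k proj \<Rightarrow> 'k proj"
  assumes quotient: "is_quotient V K Z q"
    and normalisation: "is_normalisation Y Z \<nu>"
    and h_morphism: "morphism V Y h"
    and \<nu>_h: "P \<in> V \<Longrightarrow> \<nu> (h P) = q P"
begin

text \<open>Invariance is required only along the filter, so that it survives a change of
  representative (\<open>invariant_cong\<close>).\<close>

definition invariant :: "('k proj \<Rightarrow> 'k) \<Rightarrow> bool" where
  "invariant f \<longleftrightarrow> (\<forall>\<sigma>\<in>K. \<forall>\<^sub>F R in generic V. f (\<sigma> R) = f R)"

lemma invariant_cong:
  assumes "invariant f" "\<forall>\<^sub>F R in generic V. f R = g R"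
  shows "invariant g"
  unfolding invariant_def
proof
  fix \<sigma> assume \<sigma>: "\<sigma> \<in> K"
  then have "\<forall>\<^sub>F R in generic V. f (\<sigma> R) = f R" using assms(1) by (simp add: invariant_def)
  then show "\<forall>\<^sub>F R in generic V. g (\<sigma> R) = g R"
    using assms(2) eventually_K[OF \<sigma> assms(2)] by eventually_elim simp
qed

lemma irreducible_Y: "irreducible_set Y"
  using normalisation by (simp add: is_normalisation_def variety_def)

lemma \<nu>_morphism: "morphism Y Z \<nu>"
  using normalisation by (simp add: is_normalisation_def birational_morphism_def)

lemma q_eq_iff: "P \<in> V \<Longrightarrow> P' \<in> V \<Longrightarrow> q P = q P' \<longleftrightarrow> (\<exists>\<sigma>\<in>K. P' = \<sigma> P)"
  using quotient by (simp add: is_quotient_def)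

lemma q_image: "q ` V = Z"
  using quotient by (simp add: is_quotient_def quotient_map_def)

lemma q_invariant: "\<sigma> \<in> K \<Longrightarrow> P \<in> V \<Longrightarrow> q (\<sigma> P) = q P"
  using q_eq_iff[of P "\<sigma> P"] K_mem[of \<sigma> P] by metis

lemma openin_quotient:
  assumes "W \<subseteq> Z" "openin (zar V) (V \<inter> q -` W)"
  shows "openin (zar Z) W"
proof -
  have "{x \<in> topspace (zar V). q x \<in> W} = V \<inter> q -` W" by auto
  moreover have "openin (zar V) {x \<in> topspace (zar V). q x \<in> W} \<longleftrightarrow> openin (zar Z) W"
    using quotient assms(1) by (simp add: is_quotient_def quotient_map_def)
  ultimately show ?thesis using assms(2) by metis
qed

lemma regular_fun_quotient:
  "openin (zar Z) U \<Longrightarrow> regular_fun U f \<longleftrightarrow> regular_fun (V \<inter> q -` U) (f \<circ> q)"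
  using quotient by (simp add: is_quotient_def)

text \<open>On the translates of an open set where \<open>f\<close> is regular, \<open>f\<close> is replaced by an honestly
  invariant function.\<close>

lemma descend_to_quotient:
  assumes f: "regular_at V P f" and inv: "invariant f"
  obtains g where "regular_at Z (q P) g" "\<forall>\<^sub>F R in generic V. g (q R) = f R" "g (q P) = f P"
proof -
  obtain U where U: "openin (zar V) U" "P \<in> U" "\<And>Q. Q \<in> U \<Longrightarrow> regular_at V Q f"
    using regular_at_nhd[OF f] by blast
  have UV: "U \<subseteq> V" by (rule openin_zar_subset[OF U(1)])
  define U' where "U' = (\<Union>\<sigma>\<in>K. V \<inter> \<sigma> -` U)"
  define f' where "f' R = f ((SOME \<sigma>. \<sigma> \<in> K \<and> \<sigma> R \<in> U) R)" for R
  have f\<sigma>: "regular_at V R (\<lambda>R. f (\<sigma> R))" if "\<sigma> \<in> K" "R \<in> V" "\<sigma> R \<in> U" for \<sigma> R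
    by (rule morphism_regular_at[OF K_morphism[OF that(1)] that(2) U(3)[OF that(3)]])
  \<comment> \<open>The choice made in \<open>f'\<close> does not matter: \<open>f o \<rho>\<close>
    and \<open>f o \<sigma>\<close> both agree generically with \<open>f\<close>, and where both are
    regular they have the same value.\<close>
  have f': "f' R = f (\<sigma> R)" if \<sigma>: "\<sigma> \<in> K" "R \<in> V" "\<sigma> R \<in> U" for \<sigma> R
  proof -
    define \<rho> where "\<rho> = (SOME \<sigma>. \<sigma> \<in> K \<and> \<sigma> R \<in> U)"
    have \<rho>: "\<rho> \<in> K" "\<rho> R \<in> U"
      using someI_ex[of "\<lambda>\<sigma>. \<sigma> \<in> K \<and> \<sigma> R \<in> U"] \<sigma> unfolding \<rho>_def by blast+
    have "\<forall>\<^sub>F R in generic V. f (\<rho> R) = f R" "\<forall>\<^sub>F R in generic V. f (\<sigma> R) = f R"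
      using inv \<rho>(1) \<sigma>(1) by (auto simp: invariant_def)
    then have "\<forall>\<^sub>F R in generic V. f (\<rho> R) = f (\<sigma> R)"
      by eventually_elim simp
    then have "f (\<rho> R) = f (\<sigma> R)"
      using regular_at_eqD[OF f\<sigma>[OF \<rho>(1) \<sigma>(2) \<rho>(2)] f\<sigma>[OF \<sigma>]] by blast
    then show ?thesis by (simp add: f'_def \<rho>_def)
  qed
  have U'_open: "openin (zar V) U'"
    unfolding U'_def using morphism_preimage_open[OF K_morphism U(1)] by blast
  have f'_reg: "regular_at V R f'" if R: "R \<in> U'" for R
  proof -
    obtain \<sigma> where \<sigma>: "\<sigma> \<in> K" "R \<in> V" "\<sigma> R \<in> U" using R by (auto simp: U'_def)
    show ?thesis
      by (rule regular_at_cong[OF f\<sigma>[OF \<sigma>] morphism_preimage_open[OF K_morphism[OF \<sigma>(1)] U(1)]])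
        (use \<sigma> f' in auto)
  qed
  have shift: "\<tau> R \<in> U' \<and> f' (\<tau> R) = f' R" if \<tau>: "\<tau> \<in> K" and R: "R \<in> U'" for \<tau> R
  proof -
    obtain \<sigma> where \<sigma>: "\<sigma> \<in> K" "R \<in> V" "\<sigma> R \<in> U" using R by (auto simp: U'_def)
    obtain \<tau>' where \<tau>': "\<tau>' \<in> K" "\<And>P. P \<in> V \<Longrightarrow> \<tau>' (\<tau> P) = P" using K_inverse[OF \<tau>] by metis
    define \<rho> where "\<rho> = compose V \<sigma> \<tau>'"
    have \<rho>: "\<rho> \<in> K" unfolding \<rho>_def by (rule K_compose[OF \<sigma>(1) \<tau>'(1)])
    have "\<tau> R \<in> V" by (rule K_mem[OF \<tau> \<sigma>(2)])
    moreover from this have "\<rho> (\<tau> R) = \<sigma> R"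
      using \<tau>'(2)[OF \<sigma>(2)] by (simp add: \<rho>_def compose_def)
    ultimately show ?thesis
      using \<rho> \<sigma> f'[OF \<sigma>] f'[of \<rho> "\<tau> R"] by (auto simp: U'_def intro!: bexI[of _ \<rho>])
  qed
  \<comment> \<open>Any point of the fibre will do, because \<open>f'\<close> is constant on the
    orbits contained in \<open>U'\<close>.\<close>
  define g where "g z = f' (SOME R. R \<in> V \<and> q R = z)" for z
  have U'V: "U' \<subseteq> V" by (auto simp: U'_def)
  have gq: "g (q R) = f' R" if R: "R \<in> U'" for R
  proof -
    define R0 where "R0 = (SOME R'. R' \<in> V \<and> q R' = q R)"
    have "R0 \<in> V" "q R0 = q R"
      using someI_ex[of "\<lambda>R'. R' \<in> V \<and> q R' = q R"] R U'V unfolding R0_def by blast+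
    then obtain \<sigma> where "\<sigma> \<in> K" "R0 = \<sigma> R" using q_eq_iff[of R R0] R U'V by auto
    then show ?thesis using shift[OF _ R] by (simp add: g_def R0_def)
  qed
  define W where "W = q ` U'"
  have preimage: "V \<inter> q -` W = U'"
  proof (intro equalityI subsetI)
    fix R assume "R \<in> V \<inter> q -` W"
    then obtain R' where R': "R \<in> V" "R' \<in> U'" "q R' = q R" by (auto simp: W_def)
    then obtain \<sigma> where "\<sigma> \<in> K" "R = \<sigma> R'" using q_eq_iff[of R' R] U'V by auto
    then show "R \<in> U'" using shift R'(2) by blast
  qed (use U'V in \<open>auto simp: W_def\<close>)
  have W: "openin (zar Z) W"
  proof (rule openin_quotient)
    show "W \<subseteq> Z" using q_image U'V by (auto simp: W_def)
    show "openin (zar V) (V \<inter> q -` W)" unfolding preimage by (rule U'_open)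
  qed
  have "regular_at V R (g \<circ> q)" if "R \<in> U'" for R
    by (rule regular_at_cong[OF f'_reg[OF that] U'_open that]) (simp add: gq)
  then have "regular_fun W g"
    unfolding regular_fun_quotient[OF W] preimage regular_fun_iff[OF U'_open] by blast
  have PU': "R \<in> U'" "f' R = f R" if "R \<in> U" for R
    using that K_id UV f'[OF K_id, of R] by (auto simp: U'_def intro!: bexI[of _ "\<lambda>P\<in>V. P"])
  show ?thesis
  proof (rule that)
    show "regular_at Z (q P) g"
      using \<open>regular_fun W g\<close> regular_fun_iff[OF W] PU'(1)[OF U(2)] by (auto simp: W_def)
    show "\<forall>\<^sub>F R in generic V. g (q R) = f R"
      by (rule eventually_open[OF U(1,2)]) (simp add: gq PU')
    show "g (q P) = f P" by (simp add: gq PU' U(2))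
  qed
qed

text \<open>The last clause says that \<open>A\<close> is saturated: no point outside
  \<open>A\<close> has the same image as a point of \<open>A\<close>. A point of \<open>A\<close> is
  therefore recognised by its image in \<open>Z\<close>.\<close>

lemma isomorphic_open:
  obtains A where "openin (zar Y) A" "A \<noteq> {}" "inj_on \<nu> A" "\<forall>R\<in>Y. \<nu> R \<in> \<nu> ` A \<longrightarrow> R \<in> A"
proof -
  obtain U where U: "openin (zar Z) U" "U \<noteq> {}" "isomorphism (Y \<inter> \<nu> -` U) U \<nu>"
    using normalisation by (auto simp: is_normalisation_def birational_morphism_def)
  then obtain \<chi> where \<chi>: "morphism U (Y \<inter> \<nu> -` U) \<chi>" "\<And>P. P \<in> Y \<inter> \<nu> -` U \<Longrightarrow> \<chi> (\<nu> P) = P"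
    by (auto simp: isomorphism_def)
  show ?thesis
  proof (rule that)
    show "openin (zar Y) (Y \<inter> \<nu> -` U)" by (rule morphism_preimage_open[OF \<nu>_morphism U(1)])
    show "Y \<inter> \<nu> -` U \<noteq> {}" using morphism_mem[OF \<chi>(1)] U(2) by blast
    show "inj_on \<nu> (Y \<inter> \<nu> -` U)" by (rule inj_on_inverseI[where g = \<chi> and f = \<nu>, OF \<chi>(2)])
  qed auto
qed

lemma h_mem: "P \<in> V \<Longrightarrow> h P \<in> Y"
  by (rule morphism_mem[OF h_morphism])

lemma q_preimage:
  assumes "y \<in> Y"
  obtains P where "P \<in> V" "q P = \<nu> y"
proof -
  have "\<nu> y \<in> q ` V" unfolding q_image by (rule morphism_mem[OF \<nu>_morphism assms])
  then obtain P where "P \<in> V" "\<nu> y = q P" by auto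
  then show ?thesis using that[of P] by simp
qed

sublocale Y: irreducible_space Y
  by unfold_locales (rule irreducible_Y)

text \<open>The image of \<open>h\<close> contains \<open>A\<close>: if \<open>q P = \<nu> y\<close>
  with \<open>y\<close> in \<open>A\<close>, saturation puts \<open>h P\<close> into
  \<open>A\<close>, where \<open>\<nu>\<close> is injective. Every nonempty open set meets
  \<open>A\<close>.\<close>

sublocale h: dominant V Y h
proof unfold_locales
  show "morphism V Y h" by (rule h_morphism)
  fix W assume W: "openin (zar Y) W" "W \<noteq> {}"
  obtain A where A: "openin (zar Y) A" "A \<noteq> {}" "inj_on \<nu> A"
    "\<forall>R\<in>Y. \<nu> R \<in> \<nu> ` A \<longrightarrow> R \<in> A"
    by (rule isomorphic_open)
  obtain y where y: "y \<in> W" "y \<in> A" using Y.open_Int_nonempty[OF W(1) A(1) W(2) A(2)] by blast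
  then have "y \<in> Y" using openin_zar_subset[OF W(1)] by blast
  then obtain P where P: "P \<in> V" "q P = \<nu> y" by (rule q_preimage)
  then have e: "\<nu> (h P) = \<nu> y" using \<nu>_h by simp
  then have "h P \<in> A" using A(4)[rule_format, OF h_mem[OF P(1)]] y(2) by simp
  then have "h P = y" using A(3) e y(2) by (auto simp: inj_on_def)
  then show "V \<inter> h -` W \<noteq> {}" using P(1) y(1) by blast
qed

lemma eventually_h_invariant:
  assumes "\<sigma> \<in> K"
  shows "\<forall>\<^sub>F R in generic V. h (\<sigma> R) = h R"
proof -
  obtain A where A: "openin (zar Y) A" "A \<noteq> {}" "inj_on \<nu> A"
    "\<forall>R\<in>Y. \<nu> R \<in> \<nu> ` A \<longrightarrow> R \<in> A"
    by (rule isomorphic_open)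
  have "\<forall>\<^sub>F R in generic Y. R \<in> A"
    unfolding Y.eventually_generic using A by blast
  then have hA: "\<forall>\<^sub>F R in generic V. h R \<in> A" by (rule h.eventually_pullback)
  show ?thesis
    using hA eventually_K[OF assms hA] eventually_mem
  proof eventually_elim
    case (elim R)
    have "\<nu> (h (\<sigma> R)) = \<nu> (h R)"
      using elim \<nu>_h q_invariant K_mem assms by simp
    then show ?case using A(3) elim by (auto simp: inj_on_def)
  qed
qed

lemma invariant_pullback: "invariant (\<lambda>R. r (h R))"
  unfolding invariant_def
proof
  fix \<sigma> assume "\<sigma> \<in> K"
  from eventually_h_invariant[OF this] show "\<forall>\<^sub>F R in generic V. r (h (\<sigma> R)) = r (h R)"
    by eventually_elim simp
qed

text \<open>The generic identity extends to all points because functions on \<open>Y\<close>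
  separate points: one that tells the two images apart would pull back to a function that is not
  invariant.\<close>

lemma h_invariant:
  assumes "\<sigma> \<in> K" "P \<in> V"
  shows "h (\<sigma> P) = h P"
proof (rule ccontr)
  assume ne: "h (\<sigma> P) \<noteq> h P"
  have \<sigma>P: "\<sigma> P \<in> V" by (rule K_mem[OF assms])
  obtain r where r: "regular_at Y (h P) r" "regular_at Y (h (\<sigma> P)) r" "r (h P) = 0" "r (h (\<sigma> P)) \<noteq> 0"
    by (rule separating_pair[OF ne[symmetric] h_mem[OF assms(2)] h_mem[OF \<sigma>P]])
  have 1: "regular_at V P (\<lambda>R. r (h R))" by (rule morphism_regular_at[OF h_morphism assms(2) r(1)])
  have 2: "regular_at V (\<sigma> P) (\<lambda>R. r (h R))" by (rule morphism_regular_at[OF h_morphism \<sigma>P r(2)])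
  have 3: "regular_at V P (\<lambda>R. r (h (\<sigma> R)))"
    by (rule morphism_regular_at[OF K_morphism[OF assms(1)] assms(2) 2])
  have "\<forall>\<^sub>F R in generic V. r (h (\<sigma> R)) = r (h R)"
    using invariant_pullback[of r] assms(1) by (simp add: invariant_def)
  from regular_at_eqD[OF 3 1 this] show False using r by simp
qed

text \<open>In substance the injectivity of \<open>\<nu>\<close>. If \<open>q P = \<nu> y\<close>
  but \<open>h P\<close> differs from \<open>y\<close>, let \<open>r\<close> separate them. The
  invariant function \<open>r o h\<close> is regular at \<open>P\<close> and descends to some
  \<open>g\<close> near \<open>q P\<close>; then \<open>g o \<nu>\<close> is regular at
  \<open>y\<close> and equals \<open>r\<close>, so \<open>r\<close> takes the same value at
  \<open>y\<close> as at \<open>h P\<close>.\<close>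

lemma h_surj:
  assumes "y \<in> Y"
  obtains P where "P \<in> V" "h P = y"
proof -
  obtain P where P: "P \<in> V" "q P = \<nu> y" using assms by (rule q_preimage)
  have "h P = y"
  proof (rule ccontr)
    assume ne: "h P \<noteq> y"
    obtain r where r: "regular_at Y (h P) r" "regular_at Y y r" "r (h P) = 0" "r y \<noteq> 0"
      by (rule separating_pair[OF ne h_mem[OF P(1)] assms])
    obtain g where g: "regular_at Z (q P) g" "\<forall>\<^sub>F R in generic V. g (q R) = r (h R)" "g (q P) = r (h P)"
      by (rule descend_to_quotient[OF morphism_regular_at[OF h_morphism P(1) r(1)] invariant_pullback])
    have gy: "regular_at Y y (\<lambda>R. g (\<nu> R))"
      using morphism_regular_at[OF \<nu>_morphism assms] g(1) P(2) by simp
    have "\<forall>\<^sub>F R in generic V. g (\<nu> (h R)) = r (h R)"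
      using g(2) eventually_mem by eventually_elim (simp add: \<nu>_h)
    then have "\<forall>\<^sub>F R in generic Y. g (\<nu> R) = r R"
      by (rule iffD1[OF h.eventually_eq_pullback_iff[OF rationalI[OF gy] rationalI[OF r(2)]]])
    from Y.regular_at_eqD[OF gy r(2) this] show False using g(3) r P(2) by simp
  qed
  then show ?thesis using that P(1) by blast
qed

lemma fibre_eq_orbit:
  assumes "P \<in> V"
  shows "{R \<in> V. h R = h P} = orbit P"
proof (intro equalityI subsetI)
  fix R assume "R \<in> {R \<in> V. h R = h P}"
  then have "R \<in> V" "q P = q R" using \<nu>_h[of R] \<nu>_h[OF assms] by auto
  then show "R \<in> orbit P" using q_eq_iff[OF assms] by (auto simp: orbit_def)
next
  fix R assume "R \<in> orbit P"
  then show "R \<in> {R \<in> V. h R = h P}"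
    using h_invariant assms K_mem by (auto simp: orbit_def)
qed

text \<open>The function descends to \<open>Z\<close> and returns to \<open>Y\<close> by pullback
  along \<open>\<nu>\<close>, since \<open>q = \<nu> o h\<close> on \<open>V\<close>.\<close>

lemma descend:
  assumes f: "regular_at V P f" and inv: "invariant f"
  obtains g where "regular_at Y (h P) g" "\<forall>\<^sub>F R in generic V. g (h R) = f R" "g (h P) = f P"
proof -
  have P: "P \<in> V" using f regular_at_mem by blast
  obtain g where g: "regular_at Z (q P) g" "\<forall>\<^sub>F R in generic V. g (q R) = f R" "g (q P) = f P"
    by (rule descend_to_quotient[OF assms])
  show ?thesis
  proof (rule that)
    show "regular_at Y (h P) (\<lambda>R. g (\<nu> R))"
      using morphism_regular_at[OF \<nu>_morphism h_mem[OF P]] g(1) \<nu>_h[OF P] by simp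
    show "\<forall>\<^sub>F R in generic V. g (\<nu> (h R)) = f R"
      using g(2) eventually_mem by eventually_elim (simp add: \<nu>_h)
    show "g (\<nu> (h P)) = f P" using g(3) \<nu>_h[OF P] by simp
  qed
qed

lemma descend_rational:
  assumes f: "nonzero_rational f" and inv: "invariant f"
  obtains g where "Y.nonzero_rational g" "\<forall>\<^sub>F R in generic V. g (h R) = f R"
proof -
  obtain P where P: "regular_at V P f"
    using f by (auto simp: nonzero_rational_def rational_def)
  obtain g where g: "regular_at Y (h P) g" "\<forall>\<^sub>F R in generic V. g (h R) = f R" "g (h P) = f P"
    by (rule descend[OF P inv])
  have "\<not> (\<forall>\<^sub>F R in generic Y. g R = 0)"
  proof
    assume "\<forall>\<^sub>F R in generic Y. g R = 0"
    then have "\<forall>\<^sub>F R in generic V. g (h R) = 0" by (rule h.eventually_pullback)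
    then have "\<forall>\<^sub>F R in generic V. f R = 0" using g(2) by eventually_elim simp
    then show False using nonzero_rational_not_zero[OF f] by blast
  qed
  then have "Y.nonzero_rational g" by (rule Y.nonzero_rationalI[OF rationalI[OF g(1)]])
  then show ?thesis using that[of g] g(2) by simp
qed

text \<open>Functions pulled back from \<open>Y\<close> have order divisible by
  \<open>s = |Stab(P)|\<close> at \<open>P\<close>. Dividing by a power of an invariant function of
  order \<open>s\<close> leaves an invariant function of order zero; a representative that is
  regular and nonzero at \<open>P\<close> descends to the unit of the factorisation at
  \<open>h P\<close>.\<close>

lemma uniformizing_quotient:
  assumes P: "P \<in> V"
  shows "\<exists>\<tau>. Y.uniformizing (h P) \<tau> \<and> vanishing_order P (\<lambda>R. \<tau> (h R)) = int (card (stabiliser P))"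
proof -
  define s where "s = int (card (stabiliser P))"
  have s: "s > 0" using stabiliser_pos[OF P] by (simp add: s_def)
  obtain n where n: "nonzero_rational n" "\<And>\<sigma> R. \<sigma> \<in> K \<Longrightarrow> R \<in> V \<Longrightarrow> n (\<sigma> R) = n R"
    "vanishing_order P n = s"
    using invariant_of_order_card_stabiliser[OF P] unfolding s_def by blast
  have "invariant n"
    unfolding invariant_def
  proof
    fix \<sigma> assume "\<sigma> \<in> K"
    then show "\<forall>\<^sub>F R in generic V. n (\<sigma> R) = n R"
      using eventually_mem by (auto elim: eventually_mono simp: n(2))
  qed
  obtain u where u: "regular_at V P u" "u P = 0" "\<forall>\<^sub>F R in generic V. n R = u R"
    using order_pos[OF P n(1)] n(3) s by auto
  have un: "nonzero_rational u" by (rule nonzero_rational_cong[OF n(1) u(3)])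
  have uinv: "invariant u" by (rule invariant_cong[OF \<open>invariant n\<close> u(3)])
  have us: "vanishing_order P u = s"
    using order_cong[OF _ u(3)] n by (simp add: nonzero_rational_def)
  obtain \<tau> where \<tau>: "regular_at Y (h P) \<tau>" "\<forall>\<^sub>F R in generic V. \<tau> (h R) = u R" "\<tau> (h P) = u P"
    by (rule descend[OF u(1) uinv])
  have \<tau>r: "rational Y \<tau>" by (rule rationalI[OF \<tau>(1)])
  have \<tau>h: "vanishing_order P (\<lambda>R. \<tau> (h R)) = s"
    using order_cong[OF h.rational_pullback[OF \<tau>r] \<tau>(2)] us by simp
  have "\<not> (\<forall>\<^sub>F R in generic Y. \<tau> R = 0)"
  proof
    assume "\<forall>\<^sub>F R in generic Y. \<tau> R = 0"
    then have "\<forall>\<^sub>F R in generic V. \<tau> (h R) = 0" by (rule h.eventually_pullback)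
    then have "\<forall>\<^sub>F R in generic V. u R = 0" using \<tau>(2) by eventually_elim simp
    then show False using nonzero_rational_not_zero[OF un] by blast
  qed
  then have \<tau>n: "\<forall>\<^sub>F R in generic Y. \<tau> R \<noteq> 0" by (rule Y.rational_not_zero[OF \<tau>r])
  have "\<exists>m w. regular_at Y (h P) w \<and> w (h P) \<noteq> 0 \<and> (\<forall>\<^sub>F R in generic Y. r R = w R * \<tau> R powi m)"
    if r: "rational Y r" "\<not> (\<forall>\<^sub>F R in generic Y. r R = 0)" for r
  proof -
    have rh: "nonzero_rational (\<lambda>R. r (h R))"
      by (rule h.nonzero_rational_pullback[OF Y.nonzero_rationalI[OF r]])
    have "s dvd vanishing_order P (\<lambda>R. r (h R))"
      unfolding s_def using invariant_pullback[of r]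
      by (intro card_stabiliser_dvd_order[OF P rh]) (simp add: invariant_def)
    then obtain m where m: "vanishing_order P (\<lambda>R. r (h R)) = s * m" by (elim dvdE)
    define w where "w R = r (h R) * u R powi (- m)" for R
    have wn: "nonzero_rational w"
      unfolding w_def by (intro nonzero_rational_mult rh nonzero_rational_powi un)
    have "vanishing_order P w = 0"
      unfolding w_def using order_mult[OF P rh nonzero_rational_powi[OF un]] order_powi[OF P un] us m by simp
    then obtain w' where w': "regular_at V P w'" "w' P \<noteq> 0" "\<forall>\<^sub>F R in generic V. w R = w' R"
      using order_eq_zero[OF P wn] by blast
    have "invariant w"
      unfolding invariant_def
    proof
      fix \<sigma> assume \<sigma>: "\<sigma> \<in> K"
      have "\<forall>\<^sub>F R in generic V. r (h (\<sigma> R)) = r (h R)" "\<forall>\<^sub>F R in generic V. u (\<sigma> R) = u R"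
        using invariant_pullback[of r] uinv \<sigma> by (auto simp: invariant_def)
      then show "\<forall>\<^sub>F R in generic V. w (\<sigma> R) = w R"
        by eventually_elim (simp add: w_def)
    qed
    then have w'inv: "invariant w'" by (rule invariant_cong[OF _ w'(3)])
    obtain w'' where w'': "regular_at Y (h P) w''" "\<forall>\<^sub>F R in generic V. w'' (h R) = w' R"
      "w'' (h P) = w' P"
      by (rule descend[OF w'(1) w'inv])
    have "\<forall>\<^sub>F R in generic V. u R \<noteq> 0" using un by (simp add: nonzero_rational_def)
    then have "\<forall>\<^sub>F R in generic V. r (h R) = w'' (h R) * \<tau> (h R) powi m"
      using w'(3) w''(2) \<tau>(2)
    proof eventually_elim
      case (elim R)
      have "r (h R) = w R * u R powi m" using elim(1) by (simp add: w_def power_int_minus)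
      then show ?case using elim(2-4) by simp
    qed
    then have "\<forall>\<^sub>F R in generic Y. r R = w'' R * \<tau> R powi m"
      by (rule iffD1[OF h.eventually_eq_pullback_iff[OF r(1)
            Y.rational_mult[OF rationalI[OF w''(1)] Y.rational_power_int[OF \<tau>r]]]])
    then show ?thesis using w'' w'(2) by (intro exI[of _ m] exI[of _ w'']) simp
  qed
  then have "Y.uniformizing (h P) \<tau>"
    using \<tau> \<tau>n u(2) by (simp add: Y.uniformizing_def Y.vanishing_at_def)
  then show ?thesis using \<tau>h s_def by blast
qed

sublocale Y: curve Y
proof unfold_locales
  fix y assume "y \<in> Y"
  then obtain P where "P \<in> V" "h P = y" by (rule h_surj)
  then show "\<exists>t. Y.uniformizing y t" using uniformizing_quotient by blast
qed

sublocale h: dominant_curves V Y h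
  by unfold_locales

lemma ram_index_quotient:
  assumes "P \<in> V"
  shows "ram_index V Y h P = int (card (stabiliser P))"
  using uniformizing_quotient[OF assms] h.ram_index_eq[OF assms] by force

lemma order_pullback_quotient:
  "P \<in> V \<Longrightarrow> Y.nonzero_rational g \<Longrightarrow>
    vanishing_order P (\<lambda>R. g (h R)) = int (card (stabiliser P)) * Y.vanishing_order (h P) g"
  using h.order_pullback_ram_index ram_index_quotient by simp

lemma invariant_norm: "invariant (norm f)"
  unfolding invariant_def
proof
  fix \<sigma> assume "\<sigma> \<in> K"
  then show "\<forall>\<^sub>F R in generic V. norm f (\<sigma> R) = norm f R"
    using eventually_mem by (auto elim: eventually_mono simp: norm_invariant)
qed

end

section \<open>Divisors and the Picard group\<close>

lemma lookup_frag_cmul: "Poly_Mapping.lookup (frag_cmul c x) i = c * Poly_Mapping.lookup x i"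
  by (simp add: frag_cmul_def)

lemma lookup_frag_of: "Poly_Mapping.lookup (frag_of x) y = (if x = y then 1 else 0)"
  by (simp add: lookup_single when_def)

lemma mem_Div: "D \<in> carrier (Div V) \<longleftrightarrow> Poly_Mapping.keys D \<subseteq> V"
  by (simp add: free_Abelian_group_def)

lemma Div_closed:
  "0 \<in> carrier (Div V)" "D \<in> carrier (Div V) \<Longrightarrow> E \<in> carrier (Div V) \<Longrightarrow> D + E \<in> carrier (Div V)"
  "D \<in> carrier (Div V) \<Longrightarrow> E \<in> carrier (Div V) \<Longrightarrow> D - E \<in> carrier (Div V)"
  "D \<in> carrier (Div V) \<Longrightarrow> frag_cmul c D \<in> carrier (Div V)"
  unfolding mem_Div using Poly_Mapping.keys_add[of D E] keys_diff[of D E] keys_cmul[of c D] by auto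

lemma Div_sum: "(\<And>i. i \<in> I \<Longrightarrow> f i \<in> carrier (Div V)) \<Longrightarrow> (\<Sum>i\<in>I. f i) \<in> carrier (Div V)"
proof (induction I rule: infinite_finite_induct)
  case (insert i I)
  then have "f i + (\<Sum>i\<in>I. f i) \<in> carrier (Div V)" by (intro Div_closed(2)) blast+
  then show ?case by (simp only: sum.insert[OF insert.hyps])
qed simp_all

lemma Div_eqI:
  assumes "D \<in> carrier (Div V)" "E \<in> carrier (Div V)"
    "\<And>P. P \<in> V \<Longrightarrow> Poly_Mapping.lookup D P = Poly_Mapping.lookup E P"
  shows "D = E"
proof (rule poly_mapping_eqI)
  fix P show "Poly_Mapping.lookup D P = Poly_Mapping.lookup E P"
  proof (cases "P \<in> V")
    case True
    then show ?thesis by (rule assms(3))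
  next
    case False
    then have "P \<notin> Poly_Mapping.keys D" "P \<notin> Poly_Mapping.keys E"
      using assms(1,2) unfolding mem_Div by auto
    then show ?thesis by (simp add: in_keys_iff)
  qed
qed

lemma frag_cmul_diff_right: "frag_cmul c (D - E) = frag_cmul c D - frag_cmul c E"
  by (rule poly_mapping_eqI) (simp add: lookup_frag_cmul lookup_minus right_diff_distrib)

lemma div_degree_superset:
  "finite A \<Longrightarrow> Poly_Mapping.keys D \<subseteq> A \<Longrightarrow> div_degree D = (\<Sum>P\<in>A. Poly_Mapping.lookup D P)"
  unfolding div_degree_def by (rule sum.mono_neutral_left) (auto simp: in_keys_iff)

lemma div_degree_add: "div_degree (D + E) = div_degree D + div_degree E"
proof -
  let ?A = "Poly_Mapping.keys D \<union> Poly_Mapping.keys E"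
  show ?thesis
    using div_degree_superset[of ?A D] div_degree_superset[of ?A E] div_degree_superset[of ?A "D + E"]
      Poly_Mapping.keys_add[of D E] by (simp add: lookup_add sum.distrib)
qed

lemma div_degree_cmul: "div_degree (frag_cmul c D) = c * div_degree D"
  using div_degree_superset[of "Poly_Mapping.keys D" "frag_cmul c D"] keys_cmul[of c D]
  by (simp add: div_degree_def lookup_frag_cmul sum_distrib_left)

lemma div_degree_0: "div_degree 0 = 0"
  by (simp add: div_degree_def)

lemma div_degree_sum: "div_degree (\<Sum>i\<in>I. f i) = (\<Sum>i\<in>I. div_degree (f i))"
  by (induction I rule: infinite_finite_induct) (simp_all add: div_degree_0 div_degree_add)

lemma div_degree_frag_of: "div_degree (frag_of P) = 1"
  by (simp add: div_degree_def)

lemma div_degree_frag_extend: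
  "div_degree (frag_extend f D) = (\<Sum>P\<in>Poly_Mapping.keys D. Poly_Mapping.lookup D P * div_degree (f P))"
  by (simp add: frag_extend_def div_degree_sum div_degree_cmul)

text \<open>The fibres must be finite for the inner sum in \<open>pullback_div\<close> to be
  genuine, as a sum over an infinite set is \<open>0\<close> by convention.\<close>

lemma lookup_pullback_div:
  assumes "D \<in> carrier (Div W)" "\<And>Q. Q \<in> W \<Longrightarrow> finite {P \<in> V. \<phi> P = Q}"
    and "P \<in> V \<Longrightarrow> \<phi> P \<in> W"
  shows "Poly_Mapping.lookup (pullback_div V W \<phi> D) P =
    (if P \<in> V then ram_index V W \<phi> P * Poly_Mapping.lookup D (\<phi> P) else 0)"
proof -
  have fibre: "(\<Sum>R\<in>{R \<in> V. \<phi> R = Q}. ram_index V W \<phi> R * (if R = P then 1 else 0)) =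
      (if P \<in> V \<and> \<phi> P = Q then ram_index V W \<phi> P else 0)" if "Q \<in> W" for Q
  proof -
    have "(\<Sum>R\<in>{R \<in> V. \<phi> R = Q}. ram_index V W \<phi> R * (if R = P then 1 else 0)) =
        (\<Sum>R\<in>{R \<in> V. \<phi> R = Q}. if R = P then ram_index V W \<phi> R else 0)"
      by (intro sum.cong) auto
    then show ?thesis using assms(2)[OF that] by simp
  qed
  have "Poly_Mapping.lookup (pullback_div V W \<phi> D) P =
      (\<Sum>Q\<in>Poly_Mapping.keys D. Poly_Mapping.lookup D Q *
        (\<Sum>R\<in>{R \<in> V. \<phi> R = Q}. ram_index V W \<phi> R * (if R = P then 1 else 0)))"
    unfolding pullback_div_def frag_extend_def lookup_sum lookup_frag_cmul lookup_frag_of ..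
  also have "\<dots> = (\<Sum>Q\<in>Poly_Mapping.keys D.
      if Q = \<phi> P then (if P \<in> V then ram_index V W \<phi> P * Poly_Mapping.lookup D Q else 0) else 0)"
  proof (rule sum.cong[OF refl])
    fix Q assume "Q \<in> Poly_Mapping.keys D"
    then have "Q \<in> W" using assms(1) by (auto simp: mem_Div)
    from fibre[OF this] show "Poly_Mapping.lookup D Q *
        (\<Sum>R\<in>{R \<in> V. \<phi> R = Q}. ram_index V W \<phi> R * (if R = P then 1 else 0)) =
      (if Q = \<phi> P then (if P \<in> V then ram_index V W \<phi> P * Poly_Mapping.lookup D Q else 0) else 0)"
      by auto
  qed
  also have "\<dots> = (if P \<in> V then ram_index V W \<phi> P * Poly_Mapping.lookup D (\<phi> P) else 0)"
    by (simp add: in_keys_iff)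
  finally show ?thesis .
qed

lemma pullback_div_add: "pullback_div V W \<phi> (D + E) = pullback_div V W \<phi> D + pullback_div V W \<phi> E"
  by (simp add: pullback_div_def frag_extend_add)

lemma pullback_div_diff: "pullback_div V W \<phi> (D - E) = pullback_div V W \<phi> D - pullback_div V W \<phi> E"
  by (simp add: pullback_div_def frag_extend_diff)

lemma pullback_div_cmul: "pullback_div V W \<phi> (frag_cmul c D) = frag_cmul c (pullback_div V W \<phi> D)"
  by (simp add: pullback_div_def frag_extend_cmul)

lemma pullback_div_closed:
  assumes "D \<in> carrier (Div W)" "\<And>Q. Q \<in> W \<Longrightarrow> finite {P \<in> V. \<phi> P = Q}"
    and "\<And>P. P \<in> V \<Longrightarrow> \<phi> P \<in> W"
  shows "pullback_div V W \<phi> D \<in> carrier (Div V)"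
  unfolding mem_Div using lookup_pullback_div[OF assms] by (auto simp: in_keys_iff split: if_splits)

section \<open>Principal divisors and divisor classes\<close>

context curve
begin

lemma Prin_iff:
  "D \<in> Prin V \<longleftrightarrow> D \<in> carrier (Div V) \<and>
    (\<exists>f. nonzero_rational f \<and> (\<forall>P\<in>V. Poly_Mapping.lookup D P = vanishing_order P f))"
proof -
  have "carrier (function_field V) - {\<zero>\<^bsub>function_field V\<^esub>} = ratfun_class V ` {f. nonzero_rational f}"
  proof (intro equalityI subsetI)
    fix x assume "x \<in> carrier (function_field V) - {\<zero>\<^bsub>function_field V\<^esub>}"
    then obtain f where f: "rational V f" "x = ratfun_class V f" "x \<noteq> \<zero>\<^bsub>function_field V\<^esub>"
      by (auto simp: carrier_function_field)
    then have "nonzero_rational f"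
      using nonzero_rationalI[OF f(1)] ratfun_eq_zero_iff[OF f(1)] by simp
    then show "x \<in> ratfun_class V ` {f. nonzero_rational f}" using f(2) by simp
  next
    fix x assume "x \<in> ratfun_class V ` {f. nonzero_rational f}"
    then obtain f where f: "nonzero_rational f" "x = ratfun_class V f" by auto
    then have r: "rational V f" by (simp add: nonzero_rational_def)
    then show "x \<in> carrier (function_field V) - {\<zero>\<^bsub>function_field V\<^esub>}"
      using f nonzero_rational_not_zero[OF f(1)] ratfun_eq_zero_iff[OF r]
      by (simp add: carrier_function_field)
  qed
  then show ?thesis by (auto simp: Prin_def)
qed

lemma PrinI:
  "D \<in> carrier (Div V) \<Longrightarrow> nonzero_rational f \<Longrightarrow>
    (\<And>P. P \<in> V \<Longrightarrow> Poly_Mapping.lookup D P = vanishing_order P f) \<Longrightarrow> D \<in> Prin V"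
  unfolding Prin_iff by blast

lemma PrinE:
  assumes "D \<in> Prin V"
  obtains f where "nonzero_rational f" "\<forall>P\<in>V. Poly_Mapping.lookup D P = vanishing_order P f"
  using assms unfolding Prin_iff by blast

lemma Prin_Div: "D \<in> Prin V \<Longrightarrow> D \<in> carrier (Div V)"
  by (simp add: Prin_def)

lemma Prin_zero: "0 \<in> Prin V"
  by (rule PrinI[of _ "\<lambda>_. 1"])
    (auto simp: Div_closed nonzero_rational_def order_unit regular_at_const)

lemma Prin_add:
  assumes "D \<in> Prin V" "E \<in> Prin V"
  shows "D + E \<in> Prin V"
proof -
  obtain f where f: "nonzero_rational f" "\<forall>P\<in>V. Poly_Mapping.lookup D P = vanishing_order P f"
    using assms(1) by (rule PrinE)
  obtain g where g: "nonzero_rational g" "\<forall>P\<in>V. Poly_Mapping.lookup E P = vanishing_order P g"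
    using assms(2) by (rule PrinE)
  show ?thesis
    by (rule PrinI[OF Div_closed(2)[OF assms[THEN Prin_Div]] nonzero_rational_mult[OF f(1) g(1)]])
      (simp add: lookup_add order_mult f g)
qed

lemma Prin_cmul:
  assumes "D \<in> Prin V"
  shows "frag_cmul c D \<in> Prin V"
proof -
  obtain f where f: "nonzero_rational f" "\<forall>P\<in>V. Poly_Mapping.lookup D P = vanishing_order P f"
    using assms by (rule PrinE)
  show ?thesis
    by (rule PrinI[OF Div_closed(4)[OF Prin_Div[OF assms]] nonzero_rational_powi[OF f(1), of c]])
      (simp add: lookup_frag_cmul order_powi f)
qed

lemma Prin_uminus: "D \<in> Prin V \<Longrightarrow> - D \<in> Prin V"
  using Prin_cmul[of D "-1"] by simp

lemma Prin_diff: "D \<in> Prin V \<Longrightarrow> E \<in> Prin V \<Longrightarrow> D - E \<in> Prin V"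
  using Prin_add[OF _ Prin_uminus, of D E] by simp

lemma Prin_sum: "(\<And>i. i \<in> I \<Longrightarrow> D i \<in> Prin V) \<Longrightarrow> (\<Sum>i\<in>I. D i) \<in> Prin V"
  by (induction I rule: infinite_finite_induct) (auto intro: Prin_zero Prin_add)

abbreviation divisor_class :: "('a proj \<Rightarrow>\<^sub>0 int) \<Rightarrow> ('a proj \<Rightarrow>\<^sub>0 int) set" where
  "divisor_class D \<equiv> Prin V #>\<^bsub>Div V\<^esub> D"

lemma divisor_class_eq: "divisor_class D = (\<lambda>x. x + D) ` Prin V"
  by (auto simp: r_coset_def free_Abelian_group_def)

lemma divisor_class_eq_iff: "divisor_class D = divisor_class E \<longleftrightarrow> D - E \<in> Prin V"
proof
  assume "divisor_class D = divisor_class E"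
  moreover have "D \<in> divisor_class D" unfolding divisor_class_eq using Prin_zero by force
  ultimately obtain x where "x \<in> Prin V" "D = x + E" unfolding divisor_class_eq by auto
  then show "D - E \<in> Prin V" by simp
next
  assume d: "D - E \<in> Prin V"
  have "x + D \<in> (\<lambda>x. x + E) ` Prin V" if "x \<in> Prin V" for x
    by (rule image_eqI[OF _ Prin_add[OF that d]]) (simp add: algebra_simps)
  moreover have "x + E \<in> (\<lambda>x. x + D) ` Prin V" if "x \<in> Prin V" for x
    by (rule image_eqI[OF _ Prin_diff[OF that d]]) (simp add: algebra_simps)
  ultimately show "divisor_class D = divisor_class E" unfolding divisor_class_eq by auto
qed

lemma divisor_class_mult: "divisor_class D \<otimes>\<^bsub>Pic0 V\<^esub> divisor_class E = divisor_class (D + E)"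
proof -
  have "x + (D + E) \<in> {x + D + (y + E) |x y. x \<in> Prin V \<and> y \<in> Prin V}" if "x \<in> Prin V" for x
    using that Prin_zero by (intro CollectI exI[of _ x] exI[of _ 0]) (simp add: algebra_simps)
  moreover have "x + D + (y + E) \<in> (\<lambda>x. x + (D + E)) ` Prin V" if "x \<in> Prin V" "y \<in> Prin V" for x y
    by (rule image_eqI[OF _ Prin_add[OF that]]) (simp add: algebra_simps)
  ultimately have "(\<lambda>x. x + (D + E)) ` Prin V = {x + D + (y + E) |x y. x \<in> Prin V \<and> y \<in> Prin V}"
    by auto
  moreover have "divisor_class D \<otimes>\<^bsub>Pic0 V\<^esub> divisor_class E =
      {x + D + (y + E) |x y. x \<in> Prin V \<and> y \<in> Prin V}"
    unfolding Pic0_def Pic_def FactGroup_def set_mult_def divisor_class_eq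
    by (auto simp: free_Abelian_group_def)
  ultimately show ?thesis by (simp add: divisor_class_eq)
qed

lemma Pic0_one: "\<one>\<^bsub>Pic0 V\<^esub> = divisor_class 0"
  unfolding divisor_class_eq by (simp add: Pic0_def Pic_def FactGroup_def)

lemma divisor_class_pow: "divisor_class D [^]\<^bsub>Pic0 V\<^esub> (n::nat) = divisor_class (frag_cmul (int n) D)"
  by (induction n) (simp_all add: Pic0_one divisor_class_mult frag_cmul_distrib add.commute)

text \<open>Moves torsion from classes to divisors. The degree condition is placed on a chosen
  representative, just as in the carrier of \<open>Pic0\<close>.\<close>

lemma torsion_Pic0:
  "torsion (Pic0 V) n = divisor_class `
    {D \<in> carrier (Div V). div_degree D = 0 \<and> frag_cmul (int n) D \<in> Prin V}"
proof -
  have car: "carrier (Pic0 V) = divisor_class ` {D \<in> carrier (Div V). div_degree D = 0}"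
    by (auto simp: Pic0_def)
  have pow: "divisor_class D [^]\<^bsub>Pic0 V\<^esub> n = \<one>\<^bsub>Pic0 V\<^esub> \<longleftrightarrow> frag_cmul (int n) D \<in> Prin V" for D
    by (simp add: divisor_class_pow Pic0_one divisor_class_eq_iff)
  show ?thesis
  proof (intro equalityI subsetI)
    fix c assume c: "c \<in> torsion (Pic0 V) n"
    then have "c \<in> divisor_class ` {D \<in> carrier (Div V). div_degree D = 0}"
      unfolding torsion_def car by (elim CollectE conjE)
    then obtain D where D: "c = divisor_class D" "D \<in> carrier (Div V)" "div_degree D = 0"
      by (elim imageE CollectE conjE)
    have "frag_cmul (int n) D \<in> Prin V"
      using c pow[of D] by (simp add: torsion_def D(1))
    then show "c \<in> divisor_class ` {D \<in> carrier (Div V). div_degree D = 0 \<and> frag_cmul (int n) D \<in> Prin V}"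
      unfolding D(1) using D(2,3) by (intro imageI CollectI conjI)
  next
    fix c assume "c \<in> divisor_class ` {D \<in> carrier (Div V). div_degree D = 0 \<and> frag_cmul (int n) D \<in> Prin V}"
    then obtain D where D: "c = divisor_class D" "D \<in> carrier (Div V)" "div_degree D = 0"
      "frag_cmul (int n) D \<in> Prin V"
      by (elim imageE CollectE conjE)
    have "c \<in> carrier (Pic0 V)"
      unfolding car D(1) using D(2,3) by (intro imageI CollectI conjI)
    then show "c \<in> torsion (Pic0 V) n"
      using pow[of D] D(4) by (simp add: torsion_def D(1))
  qed
qed

end

section \<open>Pullback of divisor classes\<close>

locale finite_dominant_curves = dominant_curves V W \<phi>
  for V W :: "'k::field proj set" and \<phi> +
  assumes finite_fibre: "Q \<in> W \<Longrightarrow> finite {P \<in> V. \<phi> P = Q}"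
begin

lemma \<phi>_mem: "P \<in> V \<Longrightarrow> \<phi> P \<in> W"
  by (rule morphism_mem[OF morphism])

lemma lookup_pullback:
  "D \<in> carrier (Div W) \<Longrightarrow> P \<in> V \<Longrightarrow>
    Poly_Mapping.lookup (pullback_div V W \<phi> D) P = ram_index V W \<phi> P * Poly_Mapping.lookup D (\<phi> P)"
  using lookup_pullback_div[of D W V \<phi> P] finite_fibre \<phi>_mem by simp

lemma pullback_Div: "D \<in> carrier (Div W) \<Longrightarrow> pullback_div V W \<phi> D \<in> carrier (Div V)"
  by (rule pullback_div_closed) (auto simp: finite_fibre \<phi>_mem)

text \<open>The multiplicity used in \<open>pullback_div\<close> is the factor by which orders grow
  under pullback of functions, so the divisor of \<open>f\<close> goes to that of
  \<open>f o \<phi>\<close>.\<close>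

lemma pullback_Prin:
  assumes "D \<in> Prin W"
  shows "pullback_div V W \<phi> D \<in> Prin V"
proof -
  obtain f where f: "W.nonzero_rational f"
    "\<forall>Q\<in>W. Poly_Mapping.lookup D Q = W.vanishing_order Q f"
    using assms by (rule W.PrinE)
  show ?thesis
    by (rule V.PrinI[OF pullback_Div[OF W.Prin_Div[OF assms]] nonzero_rational_pullback[OF f(1)]])
      (simp add: lookup_pullback[OF W.Prin_Div[OF assms]] f(2)[rule_format, OF \<phi>_mem]
        order_pullback_ram_index[OF _ f(1)])
qed

text \<open>\<open>pullback_pic\<close> is a union over the representatives of a class; they all
  yield the same class, because their differences pull back to principal divisors.\<close>

lemma pullback_pic_class:
  "pullback_pic V W \<phi> (W.divisor_class D) = V.divisor_class (pullback_div V W \<phi> D)"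
proof -
  have "V.divisor_class (pullback_div V W \<phi> (x + D)) = V.divisor_class (pullback_div V W \<phi> D)"
    if "x \<in> Prin W" for x
    unfolding V.divisor_class_eq_iff using pullback_Prin[OF that] by (simp add: pullback_div_add)
  then show ?thesis
    unfolding pullback_pic_def W.divisor_class_eq using W.Prin_zero by auto
qed

end

lemma (in curve_group) finite_dominant_K:
  assumes "\<sigma> \<in> K"
  shows "finite_dominant_curves V V \<sigma>"
proof -
  interpret dominant_curves V V \<sigma> by (rule dominant_K[OF assms])
  show ?thesis
  proof
    fix Q
    have "inj_on \<sigma> V" using K_bij_betw[OF assms] by (simp add: bij_betw_def)
    then have "inj_on \<sigma> {P \<in> V. \<sigma> P = Q}" by (rule inj_on_subset) auto
    moreover have "finite (\<sigma> ` {P \<in> V. \<sigma> P = Q})" by (rule finite_subset[of _ "{Q}"]) auto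
    ultimately show "finite {P \<in> V. \<sigma> P = Q}" by (rule finite_imageD[rotated])
  qed
qed

section \<open>Pullback and push-forward of divisors along the quotient map\<close>

context curve_quotient
begin

sublocale h: finite_dominant_curves V Y h
proof
  fix y assume "y \<in> Y"
  then obtain P where "P \<in> V" "h P = y" by (rule h_surj)
  then show "finite {P \<in> V. h P = y}" using fibre_eq_orbit[of P] finite_orbit by simp
qed

lemma lookup_pullback_automorphism:
  assumes "\<sigma> \<in> K" "D \<in> carrier (Div V)" "P \<in> V"
  shows "Poly_Mapping.lookup (pullback_div V V \<sigma> D) P = Poly_Mapping.lookup D (\<sigma> P)"
proof -
  interpret \<sigma>: finite_dominant_curves V V \<sigma> by (rule finite_dominant_K[OF assms(1)])
  show ?thesis using \<sigma>.lookup_pullback[OF assms(2,3)] ram_index_automorphism[OF assms(1,3)] by simp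
qed

text \<open>The coefficient of \<open>h^* D\<close> at \<open>P\<close> is \<open>|Stab(P)|\<close>
  times that of \<open>D\<close> at \<open>h P\<close>, and both factors are constant on
  orbits.\<close>

lemma pullback_automorphism_pullback:
  assumes "\<sigma> \<in> K" "D \<in> carrier (Div Y)"
  shows "pullback_div V V \<sigma> (pullback_div V Y h D) = pullback_div V Y h D"
proof -
  interpret \<sigma>: finite_dominant_curves V V \<sigma> by (rule finite_dominant_K[OF assms(1)])
  note D = h.pullback_Div[OF assms(2)]
  show ?thesis
  proof (rule Div_eqI[OF \<sigma>.pullback_Div[OF D] D])
    fix P assume P: "P \<in> V"
    have "\<sigma> P \<in> orbit P" using assms(1) by (auto simp: orbit_def)
    then show "Poly_Mapping.lookup (pullback_div V V \<sigma> (pullback_div V Y h D)) P =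
        Poly_Mapping.lookup (pullback_div V Y h D) P"
      using lookup_pullback_automorphism[OF assms(1) D P] h.lookup_pullback[OF assms(2)] P
        K_mem[OF assms(1) P] h_invariant[OF assms(1) P] ram_index_quotient card_stabiliser_orbit[OF P]
      by simp
  qed
qed

text \<open>A fibre is an orbit whose points all carry the multiplicity \<open>|Stab(P)|\<close>, so
  it contributes the size of the orbit times \<open>|Stab(P)|\<close>, which is
  \<open>|K|\<close>.\<close>

lemma div_degree_pullback:
  assumes "D \<in> carrier (Div Y)"
  shows "div_degree (pullback_div V Y h D) = int (card K) * div_degree D"
proof -
  have "div_degree (\<Sum>P\<in>{P \<in> V. h P = y}. frag_cmul (ram_index V Y h P) (frag_of P)) = int (card K)"
    if y: "y \<in> Y" for y
  proof -
    obtain P where P: "P \<in> V" "h P = y" using y by (rule h_surj)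
    have "div_degree (\<Sum>P\<in>{P \<in> V. h P = y}. frag_cmul (ram_index V Y h P) (frag_of P)) =
        (\<Sum>R\<in>orbit P. ram_index V Y h R)"
      using fibre_eq_orbit[OF P(1)] P(2)
      by (simp add: div_degree_sum div_degree_cmul div_degree_frag_of)
    also have "\<dots> = (\<Sum>R\<in>orbit P. int (card (stabiliser P)))"
      using orbit_subset[OF P(1)] card_stabiliser_orbit[OF P(1)] ram_index_quotient
      by (intro sum.cong) auto
    also have "\<dots> = int (card K)"
      using sum_K_orbit[OF P(1), of "\<lambda>_. 1"] by simp
    finally show ?thesis .
  qed
  then show ?thesis
    using assms unfolding pullback_div_def div_degree_frag_extend
    by (auto simp: div_degree_def sum_distrib_left mult.commute mem_Div subset_iff intro!: sum.cong)
qed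

definition push_forward :: "('k proj \<Rightarrow>\<^sub>0 int) \<Rightarrow> ('k proj \<Rightarrow>\<^sub>0 int)" where
  "push_forward D = frag_extend (\<lambda>P. frag_of (h P)) D"

lemma push_forward_Div:
  assumes "D \<in> carrier (Div V)"
  shows "push_forward D \<in> carrier (Div Y)"
proof -
  have "Poly_Mapping.keys (push_forward D) \<subseteq> (\<Union>P\<in>Poly_Mapping.keys D. Poly_Mapping.keys (frag_of (h P)))"
    unfolding push_forward_def by (rule keys_frag_extend)
  also have "\<dots> \<subseteq> Y" using assms h_mem by (auto simp: mem_Div)
  finally show ?thesis by (simp add: mem_Div)
qed

lemma div_degree_push_forward: "div_degree (push_forward D) = div_degree D"
  unfolding push_forward_def div_degree_frag_extend div_degree_frag_of by (simp add: div_degree_def)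

text \<open>At \<open>P\<close> both sides count the coefficients of \<open>D\<close> on the orbit
  with multiplicity \<open>|Stab(P)|\<close>: on the left it is the ramification index, on the right
  the number of group elements leading to a given point.\<close>

lemma pullback_push_forward:
  assumes D: "D \<in> carrier (Div V)"
  shows "pullback_div V Y h (push_forward D) = (\<Sum>\<sigma>\<in>K. pullback_div V V \<sigma> D)"
proof (rule Div_eqI)
  show "pullback_div V Y h (push_forward D) \<in> carrier (Div V)"
    by (rule h.pullback_Div[OF push_forward_Div[OF D]])
  have "pullback_div V V \<sigma> D \<in> carrier (Div V)" if "\<sigma> \<in> K" for \<sigma>
  proof -
    interpret \<sigma>: finite_dominant_curves V V \<sigma> by (rule finite_dominant_K[OF that])
    show ?thesis by (rule \<sigma>.pullback_Div[OF D])
  qed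
  then show "(\<Sum>\<sigma>\<in>K. pullback_div V V \<sigma> D) \<in> carrier (Div V)"
    by (rule Div_sum)
  fix P assume P: "P \<in> V"
  have "Poly_Mapping.lookup (push_forward D) (h P) =
      (\<Sum>R\<in>Poly_Mapping.keys D. if h R = h P then Poly_Mapping.lookup D R else 0)"
    unfolding push_forward_def frag_extend_def
    by (auto simp: lookup_sum lookup_frag_cmul lookup_frag_of intro!: sum.cong)
  also have "\<dots> = (\<Sum>R\<in>Poly_Mapping.keys D \<inter> orbit P. Poly_Mapping.lookup D R)"
    using D fibre_eq_orbit[OF P, symmetric]
    by (subst sum.inter_restrict) (auto simp: mem_Div intro!: sum.cong)
  also have "\<dots> = (\<Sum>R\<in>orbit P. Poly_Mapping.lookup D R)"
    by (rule sum.mono_neutral_left) (auto simp: finite_orbit in_keys_iff)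
  finally have "Poly_Mapping.lookup (pullback_div V Y h (push_forward D)) P =
      (\<Sum>\<sigma>\<in>K. Poly_Mapping.lookup D (\<sigma> P))"
    using h.lookup_pullback[OF push_forward_Div[OF D] P] ram_index_quotient[OF P] sum_K_orbit[OF P] by simp
  then show "Poly_Mapping.lookup (pullback_div V Y h (push_forward D)) P =
      Poly_Mapping.lookup (\<Sum>\<sigma>\<in>K. pullback_div V V \<sigma> D) P"
    by (simp add: lookup_sum lookup_pullback_automorphism[OF _ D P])
qed

text \<open>If \<open>\<Sum>\<sigma>\<in>K. \<sigma>\<^sup>* div f = h\<^sup>* E\<close>, then \<open>E\<close> is the divisor of the function on \<open>Y\<close> to which
  the norm of \<open>f\<close> descends.\<close>

lemma Prin_of_norm:
  assumes f: "nonzero_rational f" and E: "E \<in> carrier (Div Y)"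
    and eq: "\<And>P. P \<in> V \<Longrightarrow> (\<Sum>\<sigma>\<in>K. vanishing_order (\<sigma> P) f) = Poly_Mapping.lookup (pullback_div V Y h E) P"
  shows "E \<in> Prin Y"
proof -
  obtain g where g: "Y.nonzero_rational g" "\<forall>\<^sub>F R in generic V. g (h R) = norm f R"
    using descend_rational[OF nonzero_rational_norm[OF f] invariant_norm] by blast
  show ?thesis
  proof (rule Y.PrinI[OF E g(1)])
    fix y assume "y \<in> Y"
    then obtain P where P: "P \<in> V" "h P = y" by (rule h_surj)
    have "int (card (stabiliser P)) * Y.vanishing_order y g = vanishing_order P (\<lambda>R. g (h R))"
      using order_pullback_quotient[OF P(1) g(1)] P(2) by simp
    also have "\<dots> = vanishing_order P (norm f)"
      using h.nonzero_rational_pullback[OF g(1)] by (intro order_cong g(2)) (simp add: nonzero_rational_def)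
    also have "\<dots> = int (card (stabiliser P)) * Poly_Mapping.lookup E y"
      using order_norm[OF P(1) f] eq[OF P(1)] h.lookup_pullback[OF E P(1)] ram_index_quotient[OF P(1)] P(2)
      by simp
    finally show "Poly_Mapping.lookup E y = Y.vanishing_order y g"
      using stabiliser_pos[OF P(1)] by simp
  qed
qed

text \<open>If \<open>h^* D\<close> is the divisor of \<open>f\<close>, its invariance gives the
  norm of \<open>f\<close> the divisor \<open>|K| h^* D\<close>, the pullback of
  \<open>|K| D\<close>. Hence the kernel of \<open>h^*\<close> on classes is killed by
  \<open>|K|\<close>.\<close>

lemma Prin_of_pullback:
  assumes D: "D \<in> carrier (Div Y)" and "pullback_div V Y h D \<in> Prin V"
  shows "frag_cmul (int (card K)) D \<in> Prin Y"
proof -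
  obtain f where f: "nonzero_rational f"
    "\<forall>P\<in>V. Poly_Mapping.lookup (pullback_div V Y h D) P = vanishing_order P f"
    using assms(2) by (rule PrinE)
  show ?thesis
  proof (rule Prin_of_norm[OF f(1) Div_closed(4)[OF D]])
    fix P assume P: "P \<in> V"
    have "vanishing_order (\<sigma> P) f = Poly_Mapping.lookup (pullback_div V Y h D) P" if "\<sigma> \<in> K" for \<sigma>
      using lookup_pullback_automorphism[OF that h.pullback_Div[OF D] P]
        pullback_automorphism_pullback[OF that D] f(2)[rule_format, OF K_mem[OF that P]] by simp
    then show "(\<Sum>\<sigma>\<in>K. vanishing_order (\<sigma> P) f) =
        Poly_Mapping.lookup (pullback_div V Y h (frag_cmul (int (card K)) D)) P"
      by (simp add: pullback_div_cmul lookup_frag_cmul)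
  qed
qed

lemma Prin_push_forward:
  assumes "D \<in> Prin V"
  shows "push_forward D \<in> Prin Y"
proof -
  obtain f where f: "nonzero_rational f"
    "\<forall>P\<in>V. Poly_Mapping.lookup D P = vanishing_order P f"
    using assms by (rule PrinE)
  note D = Prin_Div[OF assms]
  show ?thesis
  proof (rule Prin_of_norm[OF f(1) push_forward_Div[OF D]])
    fix P assume P: "P \<in> V"
    then show "(\<Sum>\<sigma>\<in>K. vanishing_order (\<sigma> P) f) =
        Poly_Mapping.lookup (pullback_div V Y h (push_forward D)) P"
      using K_mem f(2) by (simp add: pullback_push_forward[OF D] lookup_sum lookup_pullback_automorphism[OF _ D])
  qed
qed

theorem torsion_invariants:
  assumes "coprime (int l) (int (card K))"
  shows "inj_on (pullback_pic V Y h) (torsion (Pic0 Y) l)"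
    and "{c \<in> torsion (Pic0 V) l. \<forall>\<sigma>\<in>K. pullback_pic V V \<sigma> c = c} = pullback_pic V Y h ` torsion (Pic0 Y) l"
proof -
  \<comment> \<open>Bezout coefficients: \<open>D\<close> is recovered as
    \<open>x (l D) + y (|K| D)\<close>, so it is principal as soon as both multiples are.\<close>
  obtain x y where xy: "x * int l + y * int (card K) = 1"
    using bezout_int[of "int l" "int (card K)"] assms by (auto simp: coprime_iff_gcd_eq_1)
  have split: "D = frag_cmul x (frag_cmul (int l) D) + frag_cmul y (frag_cmul (int (card K)) D)"
    for D :: "'k proj \<Rightarrow>\<^sub>0 int"
    using xy by (simp flip: frag_cmul_distrib)
  show "inj_on (pullback_pic V Y h) (torsion (Pic0 Y) l)"
  proof (rule inj_onI)
    fix c c' assume "c \<in> torsion (Pic0 Y) l" "c' \<in> torsion (Pic0 Y) l"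
      and eq: "pullback_pic V Y h c = pullback_pic V Y h c'"
    then obtain D E where D: "c = Y.divisor_class D" "D \<in> carrier (Div Y)" "frag_cmul (int l) D \<in> Prin Y"
      and E: "c' = Y.divisor_class E" "E \<in> carrier (Div Y)" "frag_cmul (int l) E \<in> Prin Y"
      by (auto simp: Y.torsion_Pic0)
    have "pullback_div V Y h (D - E) \<in> Prin V"
      using eq by (simp add: D(1) E(1) h.pullback_pic_class divisor_class_eq_iff pullback_div_diff)
    then have n: "frag_cmul (int (card K)) (D - E) \<in> Prin Y"
      by (rule Prin_of_pullback[OF Div_closed(3)[OF D(2) E(2)]])
    have l: "frag_cmul (int l) (D - E) \<in> Prin Y"
      using Y.Prin_diff[OF D(3) E(3)] by (simp add: frag_cmul_diff_right)
    have "D - E \<in> Prin Y"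
      by (subst split[of "D - E"]) (rule Y.Prin_add[OF Y.Prin_cmul[OF l] Y.Prin_cmul[OF n]])
    then show "c = c'" by (simp add: D(1) E(1) Y.divisor_class_eq_iff)
  qed
  show "{c \<in> torsion (Pic0 V) l. \<forall>\<sigma>\<in>K. pullback_pic V V \<sigma> c = c} = pullback_pic V Y h ` torsion (Pic0 Y) l"
  proof (intro equalityI subsetI)
    fix c assume "c \<in> {c \<in> torsion (Pic0 V) l. \<forall>\<sigma>\<in>K. pullback_pic V V \<sigma> c = c}"
    then obtain D where D: "c = divisor_class D" "D \<in> carrier (Div V)" "div_degree D = 0"
      "frag_cmul (int l) D \<in> Prin V" and inv: "\<And>\<sigma>. \<sigma> \<in> K \<Longrightarrow> pullback_pic V V \<sigma> c = c"
      by (auto simp: torsion_Pic0)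
    have \<sigma>D: "pullback_div V V \<sigma> D - D \<in> Prin V" if "\<sigma> \<in> K" for \<sigma>
    proof -
      interpret \<sigma>: finite_dominant_curves V V \<sigma> by (rule finite_dominant_K[OF that])
      show ?thesis
        using inv[OF that] by (simp add: D(1) \<sigma>.pullback_pic_class divisor_class_eq_iff)
    qed
    \<comment> \<open>The class of \<open>y E\<close> will be the preimage: \<open>h^* h_*\<close>
      multiplies the invariant class of \<open>D\<close> by \<open>|K|\<close>, and \<open>y\<close>
      inverts \<open>|K|\<close> modulo \<open>l\<close>.\<close>
    define E where "E = push_forward D"
    have E: "E \<in> carrier (Div Y)" unfolding E_def by (rule push_forward_Div[OF D(2)])
    have "(\<Sum>\<sigma>\<in>K. D) = frag_cmul (int (card K)) D"
      by (rule poly_mapping_eqI) (simp add: lookup_sum lookup_frag_cmul)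
    then have "pullback_div V Y h E - frag_cmul (int (card K)) D = (\<Sum>\<sigma>\<in>K. pullback_div V V \<sigma> D - D)"
      unfolding E_def pullback_push_forward[OF D(2)] by (simp add: sum_subtractf)
    then have diff: "pullback_div V Y h E - frag_cmul (int (card K)) D \<in> Prin V"
      using \<sigma>D by (simp add: Prin_sum)
    have "D - pullback_div V Y h (frag_cmul y E) =
        frag_cmul x (frag_cmul (int l) D) - frag_cmul y (pullback_div V Y h E - frag_cmul (int (card K)) D)"
      by (subst split[of D]) (simp add: pullback_div_cmul frag_cmul_diff_right)
    also have "\<dots> \<in> Prin V" by (intro Prin_diff Prin_cmul D(4) diff)
    finally have "c = pullback_pic V Y h (Y.divisor_class (frag_cmul y E))"
      by (simp add: D(1) h.pullback_pic_class divisor_class_eq_iff)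
    moreover have "Y.divisor_class (frag_cmul y E) \<in> torsion (Pic0 Y) l"
    proof -
      have "push_forward (frag_cmul (int l) D) \<in> Prin Y" by (rule Prin_push_forward[OF D(4)])
      then have "frag_cmul (int l) E \<in> Prin Y" by (simp add: push_forward_def E_def frag_extend_cmul)
      then have "frag_cmul y (frag_cmul (int l) E) \<in> Prin Y" by (rule Y.Prin_cmul)
      then have "frag_cmul (int l) (frag_cmul y E) \<in> Prin Y" by (simp add: mult.commute)
      moreover have "div_degree (frag_cmul y E) = 0"
        by (simp add: div_degree_cmul E_def div_degree_push_forward D(3))
      ultimately show ?thesis
        unfolding Y.torsion_Pic0 using Div_closed(4)[OF E] by blast
    qed
    ultimately show "c \<in> pullback_pic V Y h ` torsion (Pic0 Y) l" by blast
  next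
    fix c assume "c \<in> pullback_pic V Y h ` torsion (Pic0 Y) l"
    then obtain D where D: "c = pullback_pic V Y h (Y.divisor_class D)" "D \<in> carrier (Div Y)"
      "div_degree D = 0" "frag_cmul (int l) D \<in> Prin Y"
      by (auto simp: Y.torsion_Pic0)
    have c: "c = divisor_class (pullback_div V Y h D)" by (simp add: D(1) h.pullback_pic_class)
    have "pullback_div V Y h D \<in> carrier (Div V)" by (rule h.pullback_Div[OF D(2)])
    moreover have "div_degree (pullback_div V Y h D) = 0" by (simp add: div_degree_pullback[OF D(2)] D(3))
    moreover have "frag_cmul (int l) (pullback_div V Y h D) \<in> Prin V"
      using h.pullback_Prin[OF D(4)] by (simp add: pullback_div_cmul)
    ultimately have "c \<in> torsion (Pic0 V) l" unfolding torsion_Pic0 c by blast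
    moreover have "pullback_pic V V \<sigma> c = c" if "\<sigma> \<in> K" for \<sigma>
    proof -
      interpret \<sigma>: finite_dominant_curves V V \<sigma> by (rule finite_dominant_K[OF that])
      show ?thesis
        by (simp add: c \<sigma>.pullback_pic_class pullback_automorphism_pullback[OF that D(2)])
    qed
    ultimately show "c \<in> {c \<in> torsion (Pic0 V) l. \<forall>\<sigma>\<in>K. pullback_pic V V \<sigma> c = c}" by blast
  qed
qed

end

section \<open>The deck group as a finite group of automorphisms\<close>

lemma morphismI:
  assumes "continuous_map (zar V) (zar W) \<phi>"
    and "\<And>P f. P \<in> V \<Longrightarrow> regular_at W (\<phi> P) f \<Longrightarrow> regular_at V P (\<lambda>R. f (\<phi> R))"
  shows "morphism V W \<phi>"
  unfolding morphism_def
proof (intro conjI allI impI assms(1))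
  fix U f assume U: "openin (zar W) U \<and> regular_fun U f"
  have "openin (zar V) {P \<in> topspace (zar V). \<phi> P \<in> U}"
    using openin_continuous_map_preimage[OF assms(1)] U by blast
  then have "openin (zar V) (V \<inter> \<phi> -` U)" by (simp add: Int_def)
  then show "regular_fun (V \<inter> \<phi> -` U) (f \<circ> \<phi>)"
    using U assms(2) regular_fun_iff[of W U f] by (simp add: regular_fun_iff comp_def)
qed

lemma morphism_cong:
  assumes "morphism V W \<phi>" "\<And>P. P \<in> V \<Longrightarrow> \<phi> P = \<chi> P"
  shows "morphism V W \<chi>"
proof (rule morphismI)
  show "continuous_map (zar V) (zar W) \<chi>"
    by (rule continuous_map_eq[of _ _ \<phi>]) (use assms in \<open>auto simp: morphism_def\<close>)
  fix P f assume P: "P \<in> V" and f: "regular_at W (\<chi> P) f"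
  then have "regular_at V P (\<lambda>R. f (\<phi> R))"
    using morphism_regular_at[OF assms(1) P] assms(2)[OF P] by simp
  then show "regular_at V P (\<lambda>R. f (\<chi> R))"
    by (rule regular_at_cong[OF _ openin_zar_self P]) (simp add: assms(2))
qed

lemma morphism_id: "morphism V V (\<lambda>P. P)"
  by (rule morphismI) (simp_all add: continuous_map_id[unfolded id_def])

lemma morphism_comp:
  assumes "morphism V W \<phi>" "morphism W U \<chi>"
  shows "morphism V U (\<lambda>P. \<chi> (\<phi> P))"
proof (rule morphismI)
  show "continuous_map (zar V) (zar U) (\<lambda>P. \<chi> (\<phi> P))"
    using assms continuous_map_compose[of "zar V" "zar W" \<phi> "zar U" \<chi>] by (simp add: morphism_def comp_def)
  fix P f assume P: "P \<in> V" and f: "regular_at U (\<chi> (\<phi> P)) f"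
  show "regular_at V P (\<lambda>R. f (\<chi> (\<phi> R)))"
    by (rule morphism_regular_at[OF assms(1) P morphism_regular_at[OF assms(2) morphism_mem[OF assms(1) P] f]])
qed

text \<open>Associativity and the neutral element are inherited from \<open>BijGroup V\<close>. The
  point is closure: the inverse morphism provided by \<open>isomorphism\<close> has to be matched
  with the extensional inverse map.\<close>

lemma group_deck_group: "group (deck_group V \<psi>)"
proof -
  interpret B: group "BijGroup V" by (rule group_BijGroup)
  have carrier: "\<sigma> \<in> carrier (deck_group V \<psi>) \<longleftrightarrow>
      \<sigma> \<in> Bij V \<and> isomorphism V V \<sigma> \<and> (\<forall>P\<in>V. \<psi> (\<sigma> P) = \<psi> P)" for \<sigma>
    by (simp add: deck_group_def)
  have ops: "\<sigma> \<otimes>\<^bsub>deck_group V \<psi>\<^esub> \<tau> = \<sigma> \<otimes>\<^bsub>BijGroup V\<^esub> \<tau>" "\<one>\<^bsub>deck_group V \<psi>\<^esub> = \<one>\<^bsub>BijGroup V\<^esub>" for \<sigma> \<tau>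
    by (simp_all add: deck_group_def)
  have Bij: "carrier (BijGroup V) = Bij V" by (simp add: BijGroup_def)
  have mult: "\<sigma> \<otimes>\<^bsub>BijGroup V\<^esub> \<tau> = compose V \<sigma> \<tau>" if "\<sigma> \<in> Bij V" "\<tau> \<in> Bij V" for \<sigma> \<tau>
    using that by (simp add: BijGroup_def)
  have mem: "\<sigma> P \<in> V" if "\<sigma> \<in> Bij V" "P \<in> V" for \<sigma> P
    using Bij_imp_funcset[OF that(1)] that(2) by auto
  show ?thesis
  proof (rule groupI)
    fix \<sigma> \<tau> assume \<sigma>: "\<sigma> \<in> carrier (deck_group V \<psi>)" and \<tau>: "\<tau> \<in> carrier (deck_group V \<psi>)"
    then have B: "\<sigma> \<in> Bij V" "\<tau> \<in> Bij V" by (simp_all add: carrier)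
    obtain \<sigma>' where \<sigma>': "morphism V V \<sigma>" "morphism V V \<sigma>'" "\<forall>P\<in>V. \<sigma>' (\<sigma> P) = P" "\<forall>P\<in>V. \<sigma> (\<sigma>' P) = P"
      using \<sigma> by (auto simp: carrier isomorphism_def)
    obtain \<tau>' where \<tau>': "morphism V V \<tau>" "morphism V V \<tau>'" "\<forall>P\<in>V. \<tau>' (\<tau> P) = P" "\<forall>P\<in>V. \<tau> (\<tau>' P) = P"
      using \<tau> by (auto simp: carrier isomorphism_def)
    have "morphism V V (compose V \<sigma> \<tau>)"
      by (rule morphism_cong[OF morphism_comp[OF \<tau>'(1) \<sigma>'(1)]]) (simp add: compose_def)
    moreover have "morphism V V (\<lambda>P. \<tau>' (\<sigma>' P))" by (rule morphism_comp[OF \<sigma>'(2) \<tau>'(2)])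
    ultimately have "isomorphism V V (compose V \<sigma> \<tau>)"
      unfolding isomorphism_def using \<sigma>' \<tau>' mem B morphism_mem[OF \<sigma>'(2)] morphism_mem[OF \<tau>'(2)]
      by (intro conjI exI[of _ "\<lambda>P. \<tau>' (\<sigma>' P)"]) (auto simp: compose_def)
    moreover have "\<psi> (compose V \<sigma> \<tau> P) = \<psi> P" if "P \<in> V" for P
      using \<sigma> \<tau> that mem[OF B(2) that] by (simp add: carrier compose_def)
    ultimately show "\<sigma> \<otimes>\<^bsub>deck_group V \<psi>\<^esub> \<tau> \<in> carrier (deck_group V \<psi>)"
      using B by (simp add: ops mult carrier compose_Bij)
  next
    have one: "\<one>\<^bsub>BijGroup V\<^esub> = (\<lambda>P\<in>V. P)" by (simp add: BijGroup_def)
    have "morphism V V (\<lambda>P\<in>V. P)" by (rule morphism_cong[OF morphism_id]) simp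
    then have "isomorphism V V (\<lambda>P\<in>V. P)"
      unfolding isomorphism_def by (intro conjI exI[of _ "\<lambda>P\<in>V. P"]) auto
    then show "\<one>\<^bsub>deck_group V \<psi>\<^esub> \<in> carrier (deck_group V \<psi>)"
      by (simp add: ops one carrier id_Bij)
  next
    fix \<rho> \<sigma> \<tau> assume "\<rho> \<in> carrier (deck_group V \<psi>)" "\<sigma> \<in> carrier (deck_group V \<psi>)" "\<tau> \<in> carrier (deck_group V \<psi>)"
    then show "\<rho> \<otimes>\<^bsub>deck_group V \<psi>\<^esub> \<sigma> \<otimes>\<^bsub>deck_group V \<psi>\<^esub> \<tau> =
        \<rho> \<otimes>\<^bsub>deck_group V \<psi>\<^esub> (\<sigma> \<otimes>\<^bsub>deck_group V \<psi>\<^esub> \<tau>)"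
      unfolding ops by (intro B.m_assoc) (simp_all add: carrier Bij)
  next
    fix \<sigma> assume "\<sigma> \<in> carrier (deck_group V \<psi>)"
    then show "\<one>\<^bsub>deck_group V \<psi>\<^esub> \<otimes>\<^bsub>deck_group V \<psi>\<^esub> \<sigma> = \<sigma>"
      unfolding ops by (intro B.l_one) (simp add: carrier Bij)
  next
    fix \<sigma> assume \<sigma>: "\<sigma> \<in> carrier (deck_group V \<psi>)"
    then have B: "\<sigma> \<in> Bij V" "bij_betw \<sigma> V V" by (simp_all add: carrier Bij_def)
    obtain \<chi> where \<chi>: "morphism V V \<sigma>" "morphism V V \<chi>" "\<forall>P\<in>V. \<chi> (\<sigma> P) = P" "\<forall>P\<in>V. \<sigma> (\<chi> P) = P"
      using \<sigma> by (auto simp: carrier isomorphism_def)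
    define \<tau> where "\<tau> = (\<lambda>P\<in>V. inv_into V \<sigma> P)"
    \<comment> \<open>\<open>\<chi>\<close> is prescribed only on \<open>V\<close>. The extensional
      map \<open>\<tau>\<close> agrees with it there and so inherits the property of being a
      morphism.\<close>
    have \<tau>\<chi>: "\<chi> P = \<tau> P" if "P \<in> V" for P
      using inv_into_f_f[of \<sigma> V "\<chi> P"] \<chi>(4) that morphism_mem[OF \<chi>(2) that] B(2)
      by (simp add: \<tau>_def bij_betw_def)
    have "morphism V V \<tau>" by (rule morphism_cong[OF \<chi>(2) \<tau>\<chi>])
    then have "isomorphism V V \<tau>"
      unfolding isomorphism_def using \<chi> \<tau>\<chi> mem[OF B(1)] by (intro conjI exI[of _ \<sigma>]) auto
    moreover have "\<psi> (\<tau> P) = \<psi> P" if "P \<in> V" for P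
    proof -
      have "\<psi> (\<sigma> (\<chi> P)) = \<psi> (\<chi> P)"
        using \<sigma> morphism_mem[OF \<chi>(2) that] by (simp add: carrier)
      then show ?thesis using \<chi>(4)[rule_format, OF that] \<tau>\<chi>[OF that] by simp
    qed
    moreover have \<tau>B: "\<tau> \<in> Bij V" unfolding \<tau>_def by (rule restrict_inv_into_Bij[OF B(1)])
    ultimately have "\<tau> \<in> carrier (deck_group V \<psi>)" by (simp add: carrier)
    moreover have "\<tau> \<otimes>\<^bsub>deck_group V \<psi>\<^esub> \<sigma> = \<one>\<^bsub>deck_group V \<psi>\<^esub>"
      unfolding ops mult[OF \<tau>B B(1)] using Bij_compose_restrict_eq[OF B(1)]
      by (simp add: \<tau>_def BijGroup_def)
    ultimately show "\<exists>\<tau>\<in>carrier (deck_group V \<psi>). \<tau> \<otimes>\<^bsub>deck_group V \<psi>\<^esub> \<sigma> = \<one>\<^bsub>deck_group V \<psi>\<^esub>"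
      by blast
  qed
qed

lemma deck_group_curve_group:
  assumes V: "smooth_projective_curve V" and fin: "finite (carrier (deck_group V \<psi>))"
    and K: "subgroup K (deck_group V \<psi>)"
  shows "\<exists>N. curve_group V K N"
proof -
  interpret curve V by (rule smooth_projective_curve_curve[OF V])
  have G: "group (deck_group V \<psi>)" by (rule group_deck_group)
  obtain N where N: "V \<subseteq> proj_space N"
    using V by (auto simp: smooth_projective_curve_def projective_variety_def)
  have KG: "K \<subseteq> carrier (deck_group V \<psi>)" using K by (rule subgroup.subset)
  then have K_Bij: "\<sigma> \<in> Bij V" and K_iso: "isomorphism V V \<sigma>" if "\<sigma> \<in> K" for \<sigma>
    using that by (auto simp: deck_group_def)
  have "curve_group V K N"
  proof
    show "V \<subseteq> proj_space N" by (rule N)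
    show "finite K" by (rule finite_subset[OF KG fin])
    show "\<sigma> \<in> Bij V" if "\<sigma> \<in> K" for \<sigma> by (rule K_Bij[OF that])
    show "morphism V V \<sigma>" if "\<sigma> \<in> K" for \<sigma> using K_iso[OF that] by (simp add: isomorphism_def)
    show "compose V \<sigma> \<tau> \<in> K" if "\<sigma> \<in> K" "\<tau> \<in> K" for \<sigma> \<tau>
      using subgroup.m_closed[OF K that] K_Bij that by (simp add: deck_group_def BijGroup_def)
    show "(\<lambda>P\<in>V. P) \<in> K"
      using subgroup.one_closed[OF K] by (simp add: deck_group_def BijGroup_def)
    show "restrict (inv_into V \<sigma>) V \<in> K" if \<sigma>: "\<sigma> \<in> K" for \<sigma>
    proof -
      define \<rho> where "\<rho> = inv\<^bsub>deck_group V \<psi>\<^esub> \<sigma>"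
      have \<rho>: "\<rho> \<in> K" unfolding \<rho>_def by (rule subgroup.m_inv_closed[OF K \<sigma>])
      have "\<rho> \<otimes>\<^bsub>deck_group V \<psi>\<^esub> \<sigma> = \<one>\<^bsub>deck_group V \<psi>\<^esub>"
        unfolding \<rho>_def using KG \<sigma> by (intro group.l_inv[OF G]) auto
      then have c: "compose V \<rho> \<sigma> = (\<lambda>P\<in>V. P)"
        using K_Bij[OF \<rho>] K_Bij[OF \<sigma>] by (simp add: deck_group_def BijGroup_def)
      have b: "bij_betw \<sigma> V V" using K_Bij[OF \<sigma>] by (simp add: Bij_def)
      \<comment> \<open>The inverse taken in the group is the inverse function: both are extensional
        and agree on \<open>V\<close>, the image of \<open>\<sigma>\<close>.\<close>
      have "restrict (inv_into V \<sigma>) V = \<rho>"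
      proof (rule extensionalityI[of _ V])
        show "\<rho> \<in> extensional V" using K_Bij[OF \<rho>] by (rule Bij_imp_extensional)
        fix Q assume Q: "Q \<in> V"
        then obtain P where P: "P \<in> V" "Q = \<sigma> P" using b by (auto simp: bij_betw_def)
        have "\<rho> (\<sigma> P) = P" using fun_cong[OF c, of P] P(1) by (simp add: compose_def)
        then show "restrict (inv_into V \<sigma>) V Q = \<rho> Q"
          using b P Q by (simp add: bij_betw_def inv_into_f_f)
      qed simp
      then show ?thesis using \<rho> by simp
    qed
  qed
  then show ?thesis by blast
qed

text \<open>Injectivity of \<open>h^*\<close> on the torsion is part of the conclusion, since it is
  what justifies identifying \<open>Pic0(Y)[l]\<close> with its image. The map \<open>h\<close> to
  the normalisation is characterised by \<open>\<nu> o h = q\<close> on \<open>V\<close>.\<close>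

theorem lemma3p3:
  fixes V X' Y Z B :: "'k::alg_closed_field proj set"
    and \<psi> q \<nu> h :: "'k proj \<Rightarrow> 'k proj"
    and K :: "('k proj \<Rightarrow> 'k proj) set"
    and p l a :: nat
  assumes "p = CHAR('k)" and "p > 0"
    and "Factorial_Ring.prime l" and "l \<noteq> p"
    and "smooth_projective_curve V" and "smooth_projective_curve X'"
    and "galois_cover V X' \<psi>"
    and "cyclic_group (deck_group V \<psi>)" and "order (deck_group V \<psi>) = p ^ a" and "a \<ge> 1"
    and "finite B" and "B \<noteq> {}" and "B \<subseteq> X'"
    and "\<And>P. P \<in> V \<Longrightarrow> \<psi> P \<notin> B \<Longrightarrow> etale_at V X' \<psi> P"
    and "subgroup K (deck_group V \<psi>)"
    and "is_quotient V K Z q"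
    and "is_normalisation Y Z \<nu>"
    and "morphism V Y h" and "\<And>P. P \<in> V \<Longrightarrow> \<nu> (h P) = q P"
  shows "inj_on (pullback_pic V Y h) (torsion (Pic0 Y) l) \<and>
    {c \<in> torsion (Pic0 V) l. \<forall>\<sigma>\<in>K. pullback_pic V V \<sigma> c = c}
      = pullback_pic V Y h ` torsion (Pic0 Y) l"
proof -
  have G: "group (deck_group V \<psi>)" by (rule group_deck_group)
  have fin: "finite (carrier (deck_group V \<psi>))" using assms(7) by (simp add: galois_cover_def)
  obtain N where "curve_group V K N"
    using deck_group_curve_group[OF assms(5) fin assms(15)] by blast
  then interpret curve_group V K N .
  interpret curve_quotient V K N Y Z q \<nu> h
    by unfold_locales (use assms in auto)
  \<comment> \<open>By Lagrange \<open>|K|\<close> divides a power of \<open>p\<close>. As the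
    positive characteristic of a field, \<open>p\<close> is prime, so the prime \<open>l\<close>
    different from \<open>p\<close> is coprime to \<open>|K|\<close>.\<close>
  have "card (rcosets\<^bsub>deck_group V \<psi>\<^esub> K) * card K = p ^ a"
    using group.lagrange[OF G assms(15)] assms(9) by simp
  then have dvd: "card K dvd p ^ a" by (metis dvd_triv_right)
  have p: "Factorial_Ring.prime p"
    using assms(1,2) prime_CHAR_semidom[where 'a = 'k] by simp
  have "coprime l p" using assms(3,4) p primes_coprime by blast
  then have "coprime l (card K)"
    using dvd coprime_divisors[of l l "card K" "p ^ a"] by simp
  then have "coprime (int l) (int (card K))" by simp
  from torsion_invariants[OF this] show ?thesis by blast
qed

end
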